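(* Let $d \geq 2$. Then $$\|(-\Delta)^{\frac{4-d}{4}}(|u|^2) \|_{L^2(\mathbb{R}^{1+d})}^2 \leq \frac{2^{-d}\pi^{\frac{2-d}{2}}}{\Gamma(\tfrac{d+2}{2})} \|u_0\|_{\dot{H}^1}^2\|u_0\|_{L^2}^2$$ for all solutions $u$ of the free Schrödinger equation $i\partial_t u + \Delta u = 0$ on $\mathbb{R}^{1+d}$ with initial data $u(0)=u_0 \in H^1(\mathbb{R}^d)$, and the constant is optimal. Furthermore, nonzero initial data $u_0\in H^1(\mathbb{R}^d)$ is an extremiser (that is, equality holds) if and only if $\widehat{u}_0 \in \mathfrak{G}_r$.
   Context: The Fourier transform is $\widehat{f}(\xi) = \int_{\mathbb{R}^d} f(x) e^{-ix \cdot \xi}\,\mathrm{d}x$. The solution of $i\partial_t u+\Delta u=0$, $u(0)=u_0$ is $u(t,\cdot)=e^{it\Delta}u_0$, i.e. the spatial Fourier transform of $u(t,\cdot)$ is $e^{-it|\xi|^2}\widehat{u}_0(\xi)$. The operator $(-\Delta)^\sigma$ acts in the spatial variable as the Fourier multiplier $|\xi|^{2\sigma}$. The homogeneous Sobolev norm is $\|f\|_{\dot{H}^s} = \|(-\Delta)^{\frac{s}{2}} f\|_{L^2(\mathbb{R}^d)}$, and $H^s = L^2\cap\dot{H}^s$. $\mathfrak{G}_r$ is the class of functions on $\mathbb{R}^d$ of the form $\eta\mapsto\exp(a|\eta|^2 + i b \cdot \eta + c)$ with $a, c \in \mathbb{C}$, $b \in \mathbb{R}^d$ and $\mathrm{Re}(a)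 < 0$. Functions are identified when equal almost everywhere. *)

theory Defs
  imports "HOL-Analysis.Analysis"
begin

text \<open>Elements of \<open>L\<^sup>2\<close> are represented by Borel measurable functions; identification
  almost everywhere is made explicit wherever it matters.\<close>

definition L2 :: "('b::euclidean_space \<Rightarrow> complex) set" where
  "L2 = {f \<in> borel_measurable lborel. integrable lborel (\<lambda>x. (cmod (f x))\<^sup>2)}"

definition L2_norm :: "('b::euclidean_space \<Rightarrow> complex) \<Rightarrow> real" where
  "L2_norm f = sqrt (LINT x|lborel. (cmod (f x))\<^sup>2)"

definition fourier_integral :: "('a::euclidean_space \<Rightarrow> complex) \<Rightarrow> 'a \<Rightarrow> complex" where
  "fourier_integral f \<xi> = (LINT x|lborel. f x * exp (- \<i> * complex_of_real (x \<bullet> \<xi>)))"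

text \<open>\<open>has_fourier f h\<close>: the function \<open>h\<close> represents the Fourier transform of \<open>f\<close>. On \<open>L\<^sup>1\<close> this is
  the integral; on \<open>L\<^sup>2\<close> it is the \<open>L\<^sup>2\<close> limit of the integrals over balls of radius \<open>R\<close>. The two
  clauses agree on the intersection. The limit is stated with the extended
  integral, so that it cannot hold for want of integrability.\<close>

definition has_fourier ::
  "('a::euclidean_space \<Rightarrow> complex) \<Rightarrow> ('a \<Rightarrow> complex) \<Rightarrow> bool" where
  "has_fourier f h \<longleftrightarrow>
     (integrable lborel f \<and> h \<in> borel_measurable lborel \<and>
        (AE \<xi> in lborel. h \<xi> = fourier_integral f \<xi>)) \<or>
     (f \<in> L2 \<and> h \<in> L2 \<and>
        ((\<lambda>R. \<integral>\<^sup>+\<xi>. ennreal ((cmod (fourier_integral (\<lambda>x. indicator (ball 0 R) x * f x) \<xi> - h \<xi>))\<^sup>2)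
            \<partial>lborel) \<longlongrightarrow> 0) at_top)"

text \<open>\<open>g\<close> is an \<open>L\<^sup>2\<close> function representing \<open>(-\<Delta>)\<^sup>\<sigma> f\<close>. The value of the multiplier at the
  origin (where \<open>0 powr a = 0\<close> for every \<open>a\<close>) is irrelevant.\<close>

definition has_frac_laplacian ::
  "real \<Rightarrow> ('a::euclidean_space \<Rightarrow> complex) \<Rightarrow> ('a \<Rightarrow> complex) \<Rightarrow> bool" where
  "has_frac_laplacian \<sigma> f g \<longleftrightarrow>
     g \<in> L2 \<and> (\<exists>h. has_fourier f h \<and>
       has_fourier g (\<lambda>\<xi>. complex_of_real (norm \<xi> powr (2 * \<sigma>)) * h \<xi>))"

text \<open>Unique up to null sets where it exists.\<close>

definition frac_laplacian ::
  "real \<Rightarrow> ('a::euclidean_space \<Rightarrow> complex) \<Rightarrow> 'a \<Rightarrow> complex" where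
  "frac_laplacian \<sigma> f = (SOME g. has_frac_laplacian \<sigma> f g)"

definition Hdot_norm :: "real \<Rightarrow> ('a::euclidean_space \<Rightarrow> complex) \<Rightarrow> real" where
  "Hdot_norm s f = L2_norm (frac_laplacian (s / 2) f)"

definition Sobolev :: "real \<Rightarrow> ('a::euclidean_space \<Rightarrow> complex) set" where
  "Sobolev s = {f \<in> L2. \<exists>g. has_frac_laplacian (s / 2) f g}"

text \<open>The same operator acting in the spatial variable of functions on space-time, again with
  values in \<open>L\<^sup>2\<close> of space-time.\<close>

definition has_spatial_frac_laplacian ::
  "real \<Rightarrow> (real \<times> 'a::euclidean_space \<Rightarrow> complex) \<Rightarrow> (real \<times> 'a \<Rightarrow> complex) \<Rightarrow> bool" where
  "has_spatial_frac_laplacian \<sigma> F G \<longleftrightarrow>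
     G \<in> L2 \<and> (AE t in lborel. has_frac_laplacian \<sigma> (\<lambda>x. F (t, x)) (\<lambda>x. G (t, x)))"

definition spatial_frac_laplacian ::
  "real \<Rightarrow> (real \<times> 'a::euclidean_space \<Rightarrow> complex) \<Rightarrow> real \<times> 'a \<Rightarrow> complex" where
  "spatial_frac_laplacian \<sigma> F = (SOME G. has_spatial_frac_laplacian \<sigma> F G)"

text \<open>\<open>u(t, \<cdot>) = e\<^bsup>it\<Delta>\<^esup> u\<^sub>0\<close> for every time \<open>t\<close>. The case \<open>t = 0\<close> says that \<open>u(0, \<cdot>) = u\<^sub>0\<close> almost
  everywhere.\<close>

definition schroedinger_solution ::
  "('a::euclidean_space \<Rightarrow> complex) \<Rightarrow> (real \<times> 'a \<Rightarrow> complex) \<Rightarrow> bool" where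
  "schroedinger_solution u0 u \<longleftrightarrow>
     u \<in> borel_measurable lborel \<and>
     (\<exists>h. has_fourier u0 h \<and>
       (\<forall>t. (\<lambda>x. u (t, x)) \<in> L2 \<and>
         has_fourier (\<lambda>x. u (t, x))
           (\<lambda>\<xi>. exp (- \<i> * complex_of_real (t * (norm \<xi>)\<^sup>2)) * h \<xi>)))"

definition gaussians :: "('a::euclidean_space \<Rightarrow> complex) set" where
  "gaussians = {G. \<exists>(a::complex) (b::'a) (c::complex). Re a < 0 \<and>
     G = (\<lambda>\<eta>. exp (a * complex_of_real ((norm \<eta>)\<^sup>2) + \<i> * complex_of_real (b \<bullet> \<eta>) + c))}"

end

theory Submission
  imports Defs "HOL-Probability.Characteristic_Functions"
begin

text \<open>Write \<open>f\<close> for the Fourier transform of \<open>u\<^sub>0\<close>. The spatial transform of \<open>|u(t)|\<^sup>2\<close> at \<open>\<xi>\<close> is, up to a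
  phase and a constant, the one-dimensional Fourier transform in \<open>t\<close> of the integrals of \<open>f(\<xi> + \<eta>) cnj (f \<eta>)\<close> over the
  hyperplanes orthogonal to \<open>\<xi>\<close>. Splitting \<open>\<xi>\<close> into its length and its direction \<open>\<omega>\<close> and slicing space by the hyperplanes orthogonal
  to \<open>\<omega>\<close>, Plancherel in time turns the left-hand side into the integral over \<open>\<omega>\<close>, \<open>r\<close> and \<open>s\<close> of
  \<open>(r - s)\<^sup>2 |\<langle>f\<^sub>r, f\<^sub>s\<rangle>|\<^sup>2\<close>, where \<open>f\<^sub>r\<close> is the restriction of \<open>f\<close> to a slice. The estimate is then the Cauchy-Schwarz inequality, in the
  exact form of Lagrange's identity: the defect is the weighted square norm of \<open>f(x) f(y) - f(x') f(y')\<close>, where \<open>x', y'\<close> arise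
  from \<open>x, y\<close> by an elastic collision in the direction \<open>\<omega>\<close>, plus the squared length of the momentum of \<open>|f|\<^sup>2\<close>, which appears
  when \<open>|x - y|\<^sup>2\<close> is integrated. So equality means that \<open>f \<otimes> f\<close> is a collision invariant with zero momentum, and such an \<open>f\<close> is a Gaussian.\<close>

section \<open>Lebesgue measure and the Fourier integral\<close>

text \<open>The exponent \<open>(4 - d) / 4\<close> makes the dimension drop out: the squared
  multiplier is \<open>|\<xi>|^(4 - d)\<close>, polar coordinates add \<open>\<rho>^(d - 1)\<close>,
  and the substitution \<open>\<tau> = 2 * \<rho> * t\<close> in time takes one power away. What is
  left is \<open>\<rho>^2\<close>, the squared distance of two slices. Averaging
  \<open>(\<omega> \<bullet> (x - y))^2\<close> over directions gives \<open>|x - y|^2 / d\<close>,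
  through which the \<open>H^1\<close> norm enters. Every step is an equality with its defect kept,
  so that the inequality, the optimality of the constant and the extremisers are read off one
  identity. Its terms stay in the extended nonnegative reals, on the same side, until finiteness is
  known. Two obstacles shape the rest. The left-hand side is a function on space-time, but inverting
  the transform at separate times gives functions only up to null sets, so a jointly measurable
  version has to be built. And vanishing defect gives invariance under collisions only almost
  everywhere, for almost every direction, while the functional equation is solved for continuous
  functions at every point.\<close>

lemma nn_integral_lborel_affine:
  fixes f :: "'a::euclidean_space \<Rightarrow> ennreal"
  assumes [measurable]: "f \<in> borel_measurable borel" and c: "c \<noteq> 0"
  shows "(\<integral>\<^sup>+x. f x \<partial>lborel) = ennreal (\<bar>c\<bar> ^ DIM('a)) * (\<integral>\<^sup>+x. f (t + c *\<^sub>R x) \<partial>lborel)"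
  by (subst lborel_affine[OF c, of t])
     (simp add: nn_integral_density nn_integral_distr nn_integral_cmult)

lemma distr_lborel_shift: "distr lborel borel (\<lambda>x. t + x) = (lborel :: 'a::euclidean_space measure)"
  by (metis (no_types) lborel_distr_plus)

lemma distr_lborel_reflect: "distr lborel borel (\<lambda>x. t - x) = (lborel :: 'a::euclidean_space measure)"
proof -
  have "(lborel :: 'a measure) = density (distr lborel borel (\<lambda>x. t + (-1) *\<^sub>R x)) (\<lambda>_. \<bar>- 1 :: real\<bar> ^ DIM('a))"
    by (rule lborel_affine) simp
  also have "\<dots> = distr lborel borel (\<lambda>x. t - x)"
    by (simp add: density_1)
  finally show ?thesis by simp
qed

lemma nn_integral_lborel_shift:
  fixes f :: "'a::euclidean_space \<Rightarrow> ennreal"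
  assumes [measurable]: "f \<in> borel_measurable borel"
  shows "(\<integral>\<^sup>+x. f (t + x) \<partial>lborel) = (\<integral>\<^sup>+x. f x \<partial>lborel)"
  by (subst (2) distr_lborel_shift[of t, symmetric]) (simp add: nn_integral_distr)

lemma nn_integral_lborel_reflect:
  fixes f :: "'a::euclidean_space \<Rightarrow> ennreal"
  assumes [measurable]: "f \<in> borel_measurable borel"
  shows "(\<integral>\<^sup>+x. f (t - x) \<partial>lborel) = (\<integral>\<^sup>+x. f x \<partial>lborel)"
  by (subst (2) distr_lborel_reflect[of t, symmetric]) (simp add: nn_integral_distr)

lemma integral_lborel_shift:
  fixes f :: "'a::euclidean_space \<Rightarrow> 'b::{banach, second_countable_topology}"
  assumes [measurable]: "f \<in> borel_measurable borel"
  shows "(LINT x|lborel. f (t + x)) = (LINT x|lborel. f x)"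
  by (subst (2) distr_lborel_shift[of t, symmetric]) (simp add: integral_distr)

lemma integral_lborel_reflect:
  fixes f :: "'a::euclidean_space \<Rightarrow> 'b::{banach, second_countable_topology}"
  assumes [measurable]: "f \<in> borel_measurable borel"
  shows "(LINT x|lborel. f (t - x)) = (LINT x|lborel. f x)"
  by (subst (2) distr_lborel_reflect[of t, symmetric]) (simp add: integral_distr)

lemma integrable_lborel_shift:
  fixes f :: "'a::euclidean_space \<Rightarrow> 'b::{banach, second_countable_topology}"
  assumes [measurable]: "f \<in> borel_measurable borel"
  shows "integrable lborel (\<lambda>x. f (t + x)) \<longleftrightarrow> integrable lborel f"
  by (subst (2) distr_lborel_shift[of t, symmetric]) (simp add: integrable_distr_eq)

lemma integrable_lborel_reflect:
  fixes f :: "'a::euclidean_space \<Rightarrow> 'b::{banach, second_countable_topology}"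
  assumes [measurable]: "f \<in> borel_measurable borel"
  shows "integrable lborel (\<lambda>x. f (t - x)) \<longleftrightarrow> integrable lborel f"
  by (subst (2) distr_lborel_reflect[of t, symmetric]) (simp add: integrable_distr_eq)

lemma AE_lborel_shift:
  fixes P :: "'a::euclidean_space \<Rightarrow> bool"
  assumes "AE x in lborel. P x"
  shows "AE x in lborel. P (t + x)"
proof -
  have "AE x in distr lborel borel (\<lambda>x. t + x). P x"
    unfolding distr_lborel_shift by (rule assms)
  thus ?thesis by (rule AE_distrD[rotated]) simp
qed

text \<open>The bridge from one to several dimensions for the Gaussian: \<open>lborel\<close> is the
  image of the product measure on coordinate functions, where Fubini for finite products applies.
  Values in a normed field admit complex characters as factors.\<close>

lemma product_integral_lborel:
  fixes g :: "'a::euclidean_space \<Rightarrow> real \<Rightarrow> 'c::{real_normed_field,banach,second_countable_topology}"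
  assumes g: "\<And>b. b \<in> Basis \<Longrightarrow> integrable lborel (g b)"
  shows "integrable lborel (\<lambda>x. \<Prod>b\<in>Basis. g b (x \<bullet> b))"
    and "(LINT x|lborel. (\<Prod>b\<in>Basis. g b (x \<bullet> b))) = (\<Prod>b\<in>Basis. LINT t|lborel. g b t)"
proof -
  interpret product_sigma_finite "\<lambda>_::'a. lborel :: real measure" ..
  have [measurable]: "b \<in> Basis \<Longrightarrow> g b \<in> borel_measurable borel" for b using g[of b] by auto
  have m: "(\<lambda>f. \<Sum>b\<in>Basis. f b *\<^sub>R b) \<in> (\<Pi>\<^sub>M b\<in>(Basis::'a set). lborel) \<rightarrow>\<^sub>M (borel :: 'a measure)" by simp
  have m2: "(\<lambda>x::'a. \<Prod>b\<in>Basis. g b (x \<bullet> b)) \<in> borel_measurable borel" by measurable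
  have e: "(\<Prod>b\<in>Basis. g b ((\<Sum>c\<in>Basis. f c *\<^sub>R c) \<bullet> b)) = (\<Prod>b\<in>Basis. g b (f b))" for f :: "'a \<Rightarrow> real"
    by (intro prod.cong) (auto simp: inner_sum_left inner_Basis if_distrib cong: if_cong)
  show "integrable lborel (\<lambda>x. \<Prod>b\<in>Basis. g b (x \<bullet> b))"
    by (subst lborel_eq, subst integrable_distr_eq[OF m m2])
       (simp only: e, rule product_integrable_prod, auto intro: g)
  show "(LINT x|lborel. (\<Prod>b\<in>Basis. g b (x \<bullet> b))) = (\<Prod>b\<in>Basis. LINT t|lborel. g b t)"
    by (subst lborel_eq, subst integral_distr[OF m m2])
       (simp only: e, rule product_integral_prod, auto intro: g)
qed

section \<open>The Gaussian and its Fourier transform\<close>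

definition gauss :: "'a::euclidean_space \<Rightarrow> real" where
  "gauss x = exp (- (norm x)\<^sup>2 / 2)"

lemma gauss_pos[simp]: "gauss x > 0" and gauss_nonneg[simp]: "gauss x \<ge> 0" and gauss_le_1: "gauss x \<le> 1"
  and gauss_0[simp]: "gauss 0 = 1" and gauss_minus[simp]: "gauss (- x) = gauss x"
  by (auto simp: gauss_def)

lemma gauss_neq_0[simp]: "gauss x \<noteq> 0"
  using gauss_pos[of x] by linarith

lemma gauss_measurable[measurable]: "gauss \<in> borel_measurable borel"
  unfolding gauss_def[abs_def] by measurable

lemma gauss_prod: "gauss (x::'a::euclidean_space) = (\<Prod>b\<in>Basis. exp (- (x \<bullet> b)\<^sup>2 / 2))"
proof -
  have "(norm x)\<^sup>2 = (\<Sum>b\<in>Basis. (x \<bullet> b)\<^sup>2)"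
    unfolding power2_norm_eq_inner by (subst euclidean_inner) (simp add: power2_eq_square)
  thus ?thesis
    unfolding gauss_def by (simp add: exp_sum[symmetric] sum_negf sum_divide_distrib)
qed

text \<open>Read off from the characteristic function of the standard normal distribution; the
  factor \<open>sqrt (2 * pi)\<close> is what the probability density normalises away.\<close>

lemma gauss_fourier_1d:
  shows "integrable lborel (\<lambda>t. complex_of_real (exp (- t\<^sup>2 / 2)) * exp (\<i> * complex_of_real (s * t)))"
    and "(LINT t|lborel. complex_of_real (exp (- t\<^sup>2 / 2)) * exp (\<i> * complex_of_real (s * t)))
          = complex_of_real (sqrt (2 * pi)) * complex_of_real (exp (- s\<^sup>2 / 2))"
proof -
  have e: "complex_of_real (exp (- t\<^sup>2 / 2)) = complex_of_real (sqrt (2 * pi)) * complex_of_real (std_normal_density t)" for t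
    by (simp add: std_normal_density_def)
  have i: "integrable lborel (\<lambda>t. std_normal_density t)" by (simp add: integrable_normal_density)
  have i1: "integrable lborel (\<lambda>t. complex_of_real (std_normal_density t) * exp (\<i> * complex_of_real (s * t)))"
    by (rule Bochner_Integration.integrable_bound[OF i]) (auto simp: norm_mult)
  show "integrable lborel (\<lambda>t. complex_of_real (exp (- t\<^sup>2 / 2)) * exp (\<i> * complex_of_real (s * t)))"
    unfolding e mult.assoc by (intro integrable_mult_right i1)
  have "(LINT t|lborel. complex_of_real (std_normal_density t) * exp (\<i> * complex_of_real (s * t))) = char std_normal_distribution s"
    unfolding char_def
    by (subst integral_density) (auto simp: scaleR_conv_of_real)
  thus "(LINT t|lborel. complex_of_real (exp (- t\<^sup>2 / 2)) * exp (\<i> * complex_of_real (s * t)))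
          = complex_of_real (sqrt (2 * pi)) * complex_of_real (exp (- s\<^sup>2 / 2))"
    unfolding e mult.assoc integral_mult_right_zero by (simp only: char_std_normal_distribution e)
qed

lemma gauss_fourier_aux:
  fixes y :: "'a::euclidean_space"
  shows "integrable lborel (\<lambda>x. complex_of_real (gauss x) * exp (\<i> * complex_of_real (x \<bullet> y)))"
    and "(LINT x|lborel. complex_of_real (gauss x) * exp (\<i> * complex_of_real (x \<bullet> y)))
          = complex_of_real (sqrt (2 * pi) ^ DIM('a) * gauss y)"
proof -
  have e: "complex_of_real (gauss x) * exp (\<i> * complex_of_real (x \<bullet> y))
      = (\<Prod>b\<in>Basis. complex_of_real (exp (- (x \<bullet> b)\<^sup>2 / 2)) * exp (\<i> * complex_of_real ((y \<bullet> b) * (x \<bullet> b))))" for x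
  proof -
    have "exp (\<i> * complex_of_real (x \<bullet> y)) = exp (\<Sum>b\<in>Basis. \<i> * complex_of_real ((y \<bullet> b) * (x \<bullet> b)))"
      by (subst euclidean_inner) (simp add: sum_distrib_left mult.commute)
    thus ?thesis by (simp add: gauss_prod prod.distrib of_real_prod exp_sum)
  qed
  note g = product_integral_lborel[where 'a='a and 'c=complex,
     of "\<lambda>b t. complex_of_real (exp (- t\<^sup>2 / 2)) * exp (\<i> * complex_of_real ((y \<bullet> b) * t))"]
  show "integrable lborel (\<lambda>x. complex_of_real (gauss x) * exp (\<i> * complex_of_real (x \<bullet> y)))"
    unfolding e by (rule g(1)) (rule gauss_fourier_1d)
  show "(LINT x|lborel. complex_of_real (gauss x) * exp (\<i> * complex_of_real (x \<bullet> y)))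
          = complex_of_real (sqrt (2 * pi) ^ DIM('a) * gauss y)"
    unfolding e by (subst g(2), rule gauss_fourier_1d, subst gauss_fourier_1d(2))
      (simp add: prod.distrib gauss_prod of_real_prod)
qed

lemma gauss_integrable: "integrable lborel (gauss :: 'a::euclidean_space \<Rightarrow> real)"
  using gauss_fourier_aux(1)[of 0] by (simp add: complex_of_real_integrable_eq)

lemma gauss_integral: "(LINT x|lborel. gauss (x::'a::euclidean_space)) = sqrt (2 * pi) ^ DIM('a)"
  using gauss_fourier_aux(2)[of "0::'a"] by (simp flip: of_real_power of_real_mult)

lemma nn_integral_gauss: "(\<integral>\<^sup>+x. ennreal (gauss (x::'a::euclidean_space)) \<partial>lborel) = ennreal (sqrt (2 * pi) ^ DIM('a))"
  by (subst nn_integral_eq_integral) (auto simp: gauss_integrable gauss_integral)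

lemma sqrt_2pi_power: "sqrt (2 * pi) ^ n * sqrt (2 * pi) ^ n = (2 * pi) ^ n"
  unfolding power_mult_distrib[symmetric] by simp

section \<open>Square integrable functions\<close>

lemma cnj_measurable[measurable]: "cnj \<in> borel_measurable borel"
  by (intro borel_measurable_continuous_onI continuous_intros)

text \<open>The square of the norm is the quantity in which Plancherel, polarisation and the
  parallelogram law are linear; working with it keeps square roots out.\<close>

definition nsq :: "('b::euclidean_space \<Rightarrow> complex) \<Rightarrow> real" where
  "nsq f = (LINT x|lborel. (cmod (f x))\<^sup>2)"

definition ip :: "('b::euclidean_space \<Rightarrow> complex) \<Rightarrow> ('b \<Rightarrow> complex) \<Rightarrow> complex" where
  "ip f g = (LINT x|lborel. f x * cnj (g x))"

lemma nsq_nonneg[simp]: "nsq f \<ge> 0"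
  by (simp add: nsq_def)

lemma L2_norm_power2: "(L2_norm f)\<^sup>2 = nsq f"
  by (simp add: L2_norm_def nsq_def)

lemma L2_measurable[measurable_dest]: "f \<in> L2 \<Longrightarrow> f \<in> borel_measurable borel"
  by (simp add: L2_def)

lemma L2_integrable: "f \<in> L2 \<Longrightarrow> integrable lborel (\<lambda>x. (cmod (f x))\<^sup>2)"
  by (simp add: L2_def)

lemma nn_integral_nsq: "f \<in> L2 \<Longrightarrow> (\<integral>\<^sup>+x. ennreal ((cmod (f x))\<^sup>2) \<partial>lborel) = ennreal (nsq f)"
  unfolding nsq_def by (rule nn_integral_eq_integral) (auto simp: L2_integrable)

lemma L2_iff_nn:
  "f \<in> L2 \<longleftrightarrow> f \<in> borel_measurable borel \<and> (\<integral>\<^sup>+x. ennreal ((cmod (f x))\<^sup>2) \<partial>lborel) < \<infinity>"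
  by (auto simp: L2_def integrable_iff_bounded)

lemma L2_cong_AE:
  assumes "f \<in> L2" "g \<in> borel_measurable borel" "AE x in lborel. f x = g x"
  shows "g \<in> L2"
proof -
  have "(\<integral>\<^sup>+x. ennreal ((cmod (g x))\<^sup>2) \<partial>lborel) = (\<integral>\<^sup>+x. ennreal ((cmod (f x))\<^sup>2) \<partial>lborel)"
    using assms(3) by (intro nn_integral_cong_AE) auto
  thus ?thesis using assms by (simp add: L2_iff_nn)
qed

lemma nsq_cong_AE:
  assumes "f \<in> borel_measurable borel" "g \<in> borel_measurable borel" "AE x in lborel. f x = g x"
  shows "nsq f = nsq g"
  unfolding nsq_def using assms by (intro integral_cong_AE) auto

lemma L2_bound:
  assumes "f \<in> L2" "g \<in> borel_measurable borel" "\<And>x. cmod (g x) \<le> cmod (f x)"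
  shows "g \<in> L2"
  unfolding L2_def using assms
  by (auto intro!: Bochner_Integration.integrable_bound[OF L2_integrable[OF assms(1)]] power_mono)

text \<open>The factor \<open>c\<close> serves several purposes: \<open>c = 1\<close> and
  \<open>c = \<i>\<close> give polarisation, \<open>c = -1\<close> gives differences.\<close>

lemma cmod_add_sq: "(cmod (a + c * b))\<^sup>2 = (cmod a)\<^sup>2 + 2 * Re (cnj c * (a * cnj b)) + (cmod c)\<^sup>2 * (cmod b)\<^sup>2"
proof -
  have "complex_of_real ((cmod (a + c * b))\<^sup>2) = (a + c * b) * cnj (a + c * b)"
    by (rule complex_norm_square)
  also have "\<dots> = a * cnj a + (cnj c * (a * cnj b) + cnj (cnj c * (a * cnj b))) + (c * cnj c) * (b * cnj b)"
    by (simp add: algebra_simps)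
  also have "\<dots> = complex_of_real ((cmod a)\<^sup>2 + 2 * Re (cnj c * (a * cnj b)) + (cmod c)\<^sup>2 * (cmod b)\<^sup>2)"
    unfolding complex_add_cnj complex_norm_square[symmetric] by simp
  finally show ?thesis using of_real_eq_iff by blast
qed

lemma L2_mult_integrable:
  assumes f: "f \<in> L2" and g: "g \<in> L2"
  shows "integrable lborel (\<lambda>x. f x * cnj (g x))"
proof -
  have i: "integrable lborel (\<lambda>x. (cmod (f x))\<^sup>2 + (cmod (g x))\<^sup>2)"
    using f g by (intro Bochner_Integration.integrable_add L2_integrable)
  show ?thesis
  proof (rule Bochner_Integration.integrable_bound[OF i])
    show "(\<lambda>x. f x * cnj (g x)) \<in> borel_measurable lborel" using f g by measurable
    have "cmod a * cmod b \<le> (cmod a)\<^sup>2 + (cmod b)\<^sup>2" for a b :: complex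
      using sum_squares_bound[of "cmod a" "cmod b"]
        mult_nonneg_nonneg[OF norm_ge_zero norm_ge_zero, of a b] by linarith
    thus "AE x in lborel. norm (f x * cnj (g x)) \<le> norm ((cmod (f x))\<^sup>2 + (cmod (g x))\<^sup>2)"
      by (auto simp: norm_mult)
  qed
qed

lemma L2_add_cmult:
  assumes f: "f \<in> L2" and g: "g \<in> L2"
  shows "(\<lambda>x. f x + c * g x) \<in> L2"
    and "nsq (\<lambda>x. f x + c * g x) = nsq f + 2 * Re (cnj c * ip f g) + (cmod c)\<^sup>2 * nsq g"
proof -
  note i = L2_mult_integrable[OF f g]
  have i': "integrable lborel (\<lambda>x. Re (cnj c * (f x * cnj (g x))))"
    by (intro integrable_Re integrable_mult_right i)
  have e: "(\<lambda>x. (cmod (f x + c * g x))\<^sup>2)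
     = (\<lambda>x. ((cmod (f x))\<^sup>2 + 2 * Re (cnj c * (f x * cnj (g x)))) + (cmod c)\<^sup>2 * (cmod (g x))\<^sup>2)"
    by (rule ext) (rule cmod_add_sq)
  have "integrable lborel (\<lambda>x. (cmod (f x + c * g x))\<^sup>2)"
    unfolding e using f g i'
    by (intro Bochner_Integration.integrable_add integrable_mult_right L2_integrable)
  moreover have "(\<lambda>x. f x + c * g x) \<in> borel_measurable lborel" using f g by measurable
  ultimately show "(\<lambda>x. f x + c * g x) \<in> L2" by (simp add: L2_def)
  have "nsq (\<lambda>x. f x + c * g x) = nsq f + (LINT x|lborel. 2 * Re (cnj c * (f x * cnj (g x)))) + (cmod c)\<^sup>2 * nsq g"
    unfolding nsq_def e
      Bochner_Integration.integral_add[OF Bochner_Integration.integrable_add[OF L2_integrable[OF f]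
        integrable_mult_right[OF i', of 2]] integrable_mult_right[OF L2_integrable[OF g]]]
      Bochner_Integration.integral_add[OF L2_integrable[OF f] integrable_mult_right[OF i', of 2]]
    by simp
  also have "(LINT x|lborel. 2 * Re (cnj c * (f x * cnj (g x)))) = 2 * Re (cnj c * ip f g)"
    unfolding ip_def
    by (subst integral_mult_right_zero, subst integral_mult_right_zero[symmetric], subst integral_Re[symmetric])
       (auto intro: i)
  finally show "nsq (\<lambda>x. f x + c * g x) = nsq f + 2 * Re (cnj c * ip f g) + (cmod c)\<^sup>2 * nsq g" .
qed

lemma L2_diff: "f \<in> L2 \<Longrightarrow> g \<in> L2 \<Longrightarrow> (\<lambda>x. f x - g x) \<in> L2"
  using L2_add_cmult(1)[of f g "-1"] by simp

lemma L2_cmult: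
  assumes "g \<in> L2"
  shows "(\<lambda>x. c * g x) \<in> L2" and "nsq (\<lambda>x. c * g x) = (cmod c)\<^sup>2 * nsq g"
  using assms by (auto simp: L2_def nsq_def norm_mult power_mult_distrib)

lemma ip_polarize:
  assumes f: "f \<in> L2" and g: "g \<in> L2"
  shows "Re (ip f g) = (nsq (\<lambda>x. f x + 1 * g x) - nsq f - nsq g) / 2"
    and "Im (ip f g) = (nsq (\<lambda>x. f x + \<i> * g x) - nsq f - nsq g) / 2"
  using L2_add_cmult(2)[OF f g, of 1] L2_add_cmult(2)[OF f g, of \<i>] by auto

text \<open>From \<open>\<bar>|a|^2 - |b|^2\<bar> \<le> |a - b| * (2 * |b| + |a - b|)\<close> and
  Young's inequality with a free parameter \<open>\<delta>\<close>. The parameter does the work of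
  the triangle inequality for the norm: the term with \<open>nsq g\<close> can be made small
  first.\<close>

lemma nsq_diff_le:
  assumes f: "f \<in> L2" and g: "g \<in> L2" and d: "\<delta> > 0"
  shows "\<bar>nsq f - nsq g\<bar> \<le> (1 + 1 / \<delta>) * nsq (\<lambda>x. f x - g x) + \<delta> * nsq g"
proof -
  have *: "\<bar>(cmod a)\<^sup>2 - (cmod b)\<^sup>2\<bar> \<le> (1 + 1/\<delta>) * (cmod (a - b))\<^sup>2 + \<delta> * (cmod b)\<^sup>2" for a b
  proof -
    have t: "cmod a \<le> cmod b + cmod (a - b)" "cmod b \<le> cmod a + cmod (a - b)"
      using norm_triangle_sub[of a b] norm_triangle_sub[of b a] by (auto simp: norm_minus_commute)
    define p q r where "p = cmod a" "q = cmod b" "r = cmod (a - b)"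
    have pos: "p \<ge> 0" "q \<ge> 0" "r \<ge> 0" by (auto simp: p_q_r_def)
    have t': "\<bar>p - q\<bar> \<le> r" using t by (auto simp: p_q_r_def)
    have "\<bar>p\<^sup>2 - q\<^sup>2\<bar> = \<bar>p - q\<bar> * (p + q)" using pos
      by (simp add: power2_eq_square square_diff_square_factored abs_mult)
    also have "\<dots> \<le> r * (p + q)" using t' pos by (intro mult_right_mono) auto
    also have "\<dots> \<le> r * (2 * q + r)" using t' pos by (intro mult_left_mono) auto
    also have "\<dots> \<le> (1 + 1/\<delta>) * r\<^sup>2 + \<delta> * q\<^sup>2"
    proof -
      have "0 \<le> (r - \<delta> * q)\<^sup>2 / \<delta>" using d by simp
      also have "\<dots> = r\<^sup>2 / \<delta> - 2 * r * q + \<delta> * q\<^sup>2"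
        using d by (simp add: power2_eq_square field_simps)
      finally show ?thesis by (simp add: power2_eq_square algebra_simps)
    qed
    finally show ?thesis by (simp add: p_q_r_def)
  qed
  have i: "integrable lborel (\<lambda>x. (cmod (f x))\<^sup>2)" "integrable lborel (\<lambda>x. (cmod (g x))\<^sup>2)"
    "integrable lborel (\<lambda>x. (cmod (f x - g x))\<^sup>2)"
    using f g L2_diff[OF f g] by (auto simp: L2_integrable)
  have "\<bar>nsq f - nsq g\<bar> = \<bar>LINT x|lborel. (cmod (f x))\<^sup>2 - (cmod (g x))\<^sup>2\<bar>"
    unfolding nsq_def using i by simp
  also have "\<dots> \<le> (LINT x|lborel. \<bar>(cmod (f x))\<^sup>2 - (cmod (g x))\<^sup>2\<bar>)" by (rule integral_abs_bound)
  also have "\<dots> \<le> (LINT x|lborel. (1 + 1/\<delta>) * (cmod (f x - g x))\<^sup>2 + \<delta> * (cmod (g x))\<^sup>2)"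
    using i by (intro integral_mono * integrable_abs Bochner_Integration.integrable_diff
       Bochner_Integration.integrable_add integrable_mult_right) auto
  also have "\<dots> = (1 + 1 / \<delta>) * nsq (\<lambda>x. f x - g x) + \<delta> * nsq g"
    unfolding nsq_def using i by simp
  finally show ?thesis .
qed

lemma nsq_tendsto:
  assumes f: "\<And>i. f i \<in> L2" and g: "g \<in> L2" and l: "((\<lambda>i. nsq (\<lambda>x. f i x - g x)) \<longlongrightarrow> 0) F"
  shows "((\<lambda>i. nsq (f i)) \<longlongrightarrow> nsq g) F"
proof (rule tendstoI)
  fix e :: real assume e: "e > 0"
  \<comment> \<open>Adding 1 keeps the denominator positive when \<open>nsq g = 0\<close>; still
    \<open>\<delta> * nsq g \<le> e / 2\<close>.\<close>
  define \<delta> where "\<delta> = e / (2 * (nsq g + 1))"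
  have d: "\<delta> > 0" using e by (auto simp: \<delta>_def intro!: divide_pos_pos add_nonneg_pos)
  have "\<delta> * nsq g \<le> e / 2"
  proof -
    have "\<delta> * nsq g \<le> \<delta> * (nsq g + 1)" using d by simp
    also have "\<dots> = e / 2"
    proof -
      have "nsq g + 1 > 0" using nsq_nonneg[of g] by linarith
      thus ?thesis unfolding \<delta>_def by (metis less_irrefl mult.commute nonzero_mult_divide_mult_cancel_right times_divide_eq_right)
    qed
    finally show ?thesis .
  qed
  moreover have "((\<lambda>i. (1 + 1 / \<delta>) * nsq (\<lambda>x. f i x - g x)) \<longlongrightarrow> (1 + 1/\<delta>) * 0) F"
    by (intro tendsto_intros l)
  hence "eventually (\<lambda>i. (1 + 1 / \<delta>) * nsq (\<lambda>x. f i x - g x) < e / 2) F"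
    using e by (intro order_tendstoD(2)) auto
  ultimately show "eventually (\<lambda>i. dist (nsq (f i)) (nsq g) < e) F"
  proof (elim eventually_mono)
    fix i assume "(1 + 1 / \<delta>) * nsq (\<lambda>x. f i x - g x) < e / 2"
    with \<open>\<delta> * nsq g \<le> e / 2\<close> nsq_diff_le[OF f g d, of i] show "dist (nsq (f i)) (nsq g) < e"
      unfolding dist_real_def by linarith
  qed
qed

text \<open>The parallelogram law with the norm of the difference dropped.\<close>

lemma nsq_add_le:
  assumes f: "f \<in> L2" and g: "g \<in> L2"
  shows "nsq (\<lambda>x. f x + g x) \<le> 2 * nsq f + 2 * nsq g"
proof -
  have "nsq (\<lambda>x. f x + 1 * g x) + nsq (\<lambda>x. f x + (-1) * g x) = 2 * nsq f + 2 * nsq g"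
    unfolding L2_add_cmult(2)[OF f g] by simp
  thus ?thesis using nsq_nonneg[of "\<lambda>x. f x + (-1) * g x"] by (simp del: nsq_nonneg)
qed

lemma nsq_eq_0_AE:
  assumes "f \<in> L2" "nsq f = 0" shows "AE x in lborel. f x = 0"
proof -
  have "AE x in lborel. (cmod (f x))\<^sup>2 = 0"
    using assms unfolding nsq_def by (subst (asm) integral_nonneg_eq_0_iff_AE) (auto simp: L2_integrable)
  thus ?thesis by simp
qed

lemma L2_shift:
  assumes f: "f \<in> L2" shows "(\<lambda>x. f (t + x)) \<in> L2" and "nsq (\<lambda>x. f (t + x)) = nsq f"
proof -
  have [measurable]: "f \<in> borel_measurable borel" using f by measurable
  show "(\<lambda>x. f (t + x)) \<in> L2"
    using f integrable_lborel_shift[of "\<lambda>x. (cmod (f x))\<^sup>2" t] by (simp add: L2_def)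
  show "nsq (\<lambda>x. f (t + x)) = nsq f"
    unfolding nsq_def by (rule integral_lborel_shift[of "\<lambda>x. (cmod (f x))\<^sup>2" t]) simp
qed

section \<open>The Plancherel theorem\<close>

lemma cmod_expi[simp]: "cmod (exp (- \<i> * complex_of_real a)) = 1" "cmod (exp (\<i> * complex_of_real a)) = 1"
  "cmod (exp (- (\<i> * complex_of_real a))) = 1"
  by (auto simp: norm_exp_eq_Re)

lemma fourier_integral_measurable[measurable]:
  fixes f :: "'a::euclidean_space \<Rightarrow> complex"
  assumes [measurable]: "f \<in> borel_measurable borel"
  shows "fourier_integral f \<in> borel_measurable borel"
  unfolding fourier_integral_def[abs_def] by measurable

lemma fourier_integrand_integrable:
  fixes f :: "'a::euclidean_space \<Rightarrow> complex"
  assumes "integrable lborel f"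
  shows "integrable lborel (\<lambda>x. f x * exp (- \<i> * complex_of_real (x \<bullet> \<xi>)))"
  by (rule Bochner_Integration.integrable_bound[OF assms]) (use assms in \<open>auto simp: norm_mult\<close>)

lemma fourier_integral_bound:
  fixes f :: "'a::euclidean_space \<Rightarrow> complex"
  assumes "integrable lborel f"
  shows "cmod (fourier_integral f \<xi>) \<le> (LINT x|lborel. cmod (f x))"
  unfolding fourier_integral_def
  by (rule order_trans[OF integral_norm_bound]) (simp add: norm_mult)

lemma fourier_integral_add_cmult:
  fixes f :: "'a::euclidean_space \<Rightarrow> complex"
  assumes f: "integrable lborel f" and g: "integrable lborel g"
  shows "fourier_integral (\<lambda>x. f x + c * g x) \<xi> = fourier_integral f \<xi> + c * fourier_integral g \<xi>"
  unfolding fourier_integral_def distrib_right mult.assoc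
  by (subst Bochner_Integration.integral_add)
     (auto intro!: integrable_mult_right fourier_integrand_integrable[of _ \<xi>, simplified] f g)

lemma fourier_integral_diff:
  fixes f :: "'a::euclidean_space \<Rightarrow> complex"
  assumes f: "integrable lborel f" and g: "integrable lborel g"
  shows "fourier_integral (\<lambda>x. f x - g x) \<xi> = fourier_integral f \<xi> - fourier_integral g \<xi>"
  using fourier_integral_add_cmult[OF f g, of "-1" \<xi>] by simp

lemma fourier_integral_cnj:
  "fourier_integral (\<lambda>x. cnj (f x)) \<xi> = cnj (fourier_integral f (- \<xi>))"
  unfolding fourier_integral_def by (subst Bochner_Integration.integral_cnj[symmetric]) (simp add: exp_cnj)

lemma fourier_integral_reflect:
  assumes [measurable]: "f \<in> borel_measurable borel"
  shows "fourier_integral (\<lambda>x. f (- x)) \<xi> = fourier_integral f (- \<xi>)"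
  unfolding fourier_integral_def
  by (subst integral_lborel_reflect[of _ 0, symmetric]) auto

lemma continuous_on_fourier_integral:
  fixes f :: "'a::euclidean_space \<Rightarrow> complex"
  assumes f: "integrable lborel f"
  shows "continuous_on UNIV (fourier_integral f)"
  unfolding fourier_integral_def[abs_def]
  by (intro continuous_on_sequentially[THEN iffD2] ballI allI impI)
    (unfold o_def, rule integral_dominated_convergence[where w="\<lambda>x. cmod (f x)"],
     use f in \<open>auto intro!: tendsto_intros simp: norm_mult\<close>)

lemma integrable_pair_mult:
  fixes f :: "'a::euclidean_space \<Rightarrow> complex" and g :: "'b::euclidean_space \<Rightarrow> complex"
  assumes f: "integrable lborel f" and g: "integrable lborel g"
    and u[measurable]: "u \<in> borel_measurable (borel \<Otimes>\<^sub>M borel)" and u1: "\<And>z. cmod (u z) \<le> 1"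
  shows "integrable (lborel \<Otimes>\<^sub>M lborel) (\<lambda>z. f (fst z) * g (snd z) * u z)"
proof (rule lborel_pair.Fubini_integrable)
  have [measurable]: "f \<in> borel_measurable borel" "g \<in> borel_measurable borel" using f g by auto
  show "(\<lambda>z. f (fst z) * g (snd z) * u z) \<in> borel_measurable (lborel \<Otimes>\<^sub>M lborel)" by measurable
  have *: "integrable lborel (\<lambda>y. f (fst (x, y)) * g (snd (x, y)) * u (x, y))" for x
    by (rule Bochner_Integration.integrable_bound[OF integrable_mult_right[OF g, of "f x"]])
       (use u1 in \<open>auto simp: norm_mult mult_left_le\<close>)
  show "AE x in lborel. integrable lborel (\<lambda>y. f (fst (x, y)) * g (snd (x, y)) * u (x, y))"
    using * by simp
  have "(LINT y|lborel. norm (f (fst (x, y)) * g (snd (x, y)) * u (x, y))) \<le> cmod (f x) * (LINT y|lborel. cmod (g y))" for x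
    unfolding integral_mult_right_zero[symmetric] using u1
    by (intro integral_mono integrable_norm *) (auto simp: norm_mult mult_left_le g)
  thus "integrable lborel (\<lambda>x. LINT y|lborel. norm (f (fst (x, y)) * g (snd (x, y)) * u (x, y)))"
    by (intro Bochner_Integration.integrable_bound[OF integrable_mult_left[OF integrable_norm[OF f], of "LINT y|lborel. cmod (g y)"]])
       (auto simp: abs_mult)
qed

text \<open>Fubini for \<open>f x * g \<xi> * exp (- \<i> * (x \<bullet> \<xi>))\<close>, which is
  integrable on the product because \<open>f\<close> and \<open>g\<close> are. It moves the
  transform from one factor to the other and is the only analytic source of Plancherel here.\<close>

lemma fourier_integral_multiplication:
  fixes f g :: "'a::euclidean_space \<Rightarrow> complex"
  assumes f: "integrable lborel f" and g: "integrable lborel g"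
  shows "(LINT \<xi>|lborel. fourier_integral f \<xi> * g \<xi>) = (LINT x|lborel. f x * fourier_integral g x)"
proof -
  define h where "h x \<xi> = f x * g \<xi> * exp (- \<i> * complex_of_real (x \<bullet> \<xi>))" for x \<xi>
  have i: "integrable (lborel \<Otimes>\<^sub>M lborel) (case_prod h)"
    unfolding h_def case_prod_unfold by (rule integrable_pair_mult[OF f g]) auto
  have "(LINT \<xi>|lborel. fourier_integral f \<xi> * g \<xi>) = (LINT \<xi>|lborel. LINT x|lborel. h x \<xi>)"
    unfolding fourier_integral_def h_def
    by (subst integral_mult_left_zero[symmetric]) (simp add: mult_ac)
  also have "\<dots> = (LINT x|lborel. LINT \<xi>|lborel. h x \<xi>)"
    by (rule lborel_pair.Fubini_integral[OF i])
  also have "\<dots> = (LINT x|lborel. f x * fourier_integral g x)"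
    unfolding fourier_integral_def h_def
    by (subst integral_mult_right_zero[symmetric]) (simp add: mult_ac inner_commute)
  finally show ?thesis .
qed

text \<open>Holds for every \<open>f\<close> because the Bochner integral of a non-integrable
  function is 0 by convention.\<close>

lemma integral_norm_bound_ennreal':
  fixes f :: "'a \<Rightarrow> 'b::{banach, second_countable_topology}"
  shows "ennreal (norm (integral\<^sup>L M f)) \<le> (\<integral>\<^sup>+x. ennreal (norm (f x)) \<partial>M)"
  by (cases "integrable M f") (auto simp: integral_norm_bound_ennreal not_integrable_integral_eq)

lemma fourier_integral_gauss_scaled:
  fixes w :: "'a::euclidean_space"
  assumes e: "\<epsilon> > 0"
  shows "integrable lborel (\<lambda>\<xi>::'a. complex_of_real (gauss (\<epsilon> *\<^sub>R \<xi>)))"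
    and "fourier_integral (\<lambda>\<xi>. complex_of_real (gauss (\<epsilon> *\<^sub>R \<xi>))) w
      = complex_of_real ((sqrt (2 * pi) / \<epsilon>) ^ DIM('a) * gauss (w /\<^sub>R \<epsilon>))"
proof -
  have L: "(lborel :: 'a measure) = density (distr lborel borel (\<lambda>x. 0 + inverse \<epsilon> *\<^sub>R x)) (\<lambda>_. \<bar>inverse \<epsilon>\<bar>^DIM('a))"
    by (rule lborel_affine) (use e in simp)
  show "integrable lborel (\<lambda>\<xi>::'a. complex_of_real (gauss (\<epsilon> *\<^sub>R \<xi>)))"
    by (subst L, subst integrable_density, measurable, subst integrable_distr_eq)
       (use e gauss_integrable[where 'a='a] in \<open>auto simp: complex_of_real_integrable_eq\<close>)
  have "fourier_integral (\<lambda>\<xi>. complex_of_real (gauss (\<epsilon> *\<^sub>R \<xi>))) w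
     = (LINT \<xi>|lborel. (\<bar>inverse \<epsilon>\<bar>^DIM('a)) *\<^sub>R (complex_of_real (gauss \<xi>) * exp (- \<i> * complex_of_real ((inverse \<epsilon> *\<^sub>R \<xi>) \<bullet> w))))"
    unfolding fourier_integral_def
    by (subst L, subst integral_density, measurable, subst integral_distr) (use e in auto)
  also have "\<dots> = (\<bar>inverse \<epsilon>\<bar>^DIM('a)) *\<^sub>R (LINT \<xi>|lborel. complex_of_real (gauss \<xi>) * exp (\<i> * complex_of_real (\<xi> \<bullet> (- (w /\<^sub>R \<epsilon>)))))"
    by (subst integral_scaleR_right) (simp add: field_simps)
  also have "\<dots> = complex_of_real ((sqrt (2 * pi) / \<epsilon>) ^ DIM('a) * gauss (w /\<^sub>R \<epsilon>))"
    unfolding gauss_fourier_aux(2) using e by (simp add: scaleR_conv_of_real power_divide field_simps)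
  finally show "fourier_integral (\<lambda>\<xi>. complex_of_real (gauss (\<epsilon> *\<^sub>R \<xi>))) w
      = complex_of_real ((sqrt (2 * pi) / \<epsilon>) ^ DIM('a) * gauss (w /\<^sub>R \<epsilon>))" .
qed

lemma fourier_integral_modulate:
  "fourier_integral (\<lambda>\<xi>. g \<xi> * exp (- \<i> * complex_of_real (x \<bullet> \<xi>))) y = fourier_integral g (x + y)"
  unfolding fourier_integral_def
  by (intro Bochner_Integration.integral_cong refl)
     (simp add: mult.assoc exp_add[symmetric] inner_add_right inner_commute distrib_left add_ac)

text \<open>The transform of an integrable \<open>f\<close> is merely bounded, so its energy is
  damped by a Gaussian of width \<open>1 / \<epsilon>\<close>. Two uses of the multiplication
  formula turn the damped energy into the pairing of \<open>f\<close> with its Gaussian averages at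
  scale \<open>\<epsilon>\<close>.\<close>

lemma plancherel_gauss:
  fixes f :: "'a::euclidean_space \<Rightarrow> complex"
  assumes f: "integrable lborel f" and e: "\<epsilon> > 0"
  shows "integrable lborel (\<lambda>\<xi>. complex_of_real (gauss (\<epsilon> *\<^sub>R \<xi>)) * cnj (fourier_integral f \<xi>))"
    and "(LINT \<xi>|lborel. fourier_integral f \<xi> * (complex_of_real (gauss (\<epsilon> *\<^sub>R \<xi>)) * cnj (fourier_integral f \<xi>)))
     = complex_of_real (sqrt (2 * pi) ^ DIM('a)) *
       (LINT x|lborel. f x * (LINT z|lborel. cnj (f (x - \<epsilon> *\<^sub>R z)) * complex_of_real (gauss z)))"
proof -
  have [measurable]: "f \<in> borel_measurable borel" using f by auto
  let ?G = "\<lambda>\<xi>::'a. complex_of_real (gauss (\<epsilon> *\<^sub>R \<xi>))"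
  have iG: "integrable lborel ?G" by (rule fourier_integral_gauss_scaled[OF e])
  show i1: "integrable lborel (\<lambda>\<xi>. ?G \<xi> * cnj (fourier_integral f \<xi>))"
    by (rule Bochner_Integration.integrable_bound[OF integrable_mult_left[OF iG, of "LINT x|lborel. cmod (f x)"]])
       (auto simp: norm_mult intro!: mult_left_mono order_trans[OF fourier_integral_bound[OF f]])
  \<comment> \<open>Its transform is the conjugate of that of \<open>f\<close>, which makes the
    second use of the multiplication formula possible.\<close>
  let ?fr = "\<lambda>y. cnj (f (- y))"
  have ifr: "integrable lborel ?fr"
    using integrable_lborel_reflect[of f 0] f by simp
  have r: "cnj (fourier_integral f \<xi>) = fourier_integral ?fr \<xi>" for \<xi>
    using fourier_integral_cnj[of "\<lambda>y. f (- y)" \<xi>] fourier_integral_reflect[of f "-\<xi>"] by simp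
  have "(LINT \<xi>|lborel. fourier_integral f \<xi> * (?G \<xi> * cnj (fourier_integral f \<xi>)))
     = (LINT x|lborel. f x * fourier_integral (\<lambda>\<xi>. ?G \<xi> * cnj (fourier_integral f \<xi>)) x)"
    by (rule fourier_integral_multiplication[OF f i1])
  also have "\<dots> = (LINT x|lborel. f x * (complex_of_real (sqrt (2 * pi) ^ DIM('a)) * (LINT z|lborel. cnj (f (x - \<epsilon> *\<^sub>R z)) * complex_of_real (gauss z))))"
  proof (intro Bochner_Integration.integral_cong refl arg_cong2[where f="(*)"])
    fix x
    let ?Gx = "\<lambda>\<xi>. ?G \<xi> * exp (- \<i> * complex_of_real (x \<bullet> \<xi>))"
    have iGx: "integrable lborel ?Gx"
      by (rule Bochner_Integration.integrable_bound[OF iG]) (auto simp: norm_mult)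
    have "fourier_integral (\<lambda>\<xi>. ?G \<xi> * cnj (fourier_integral f \<xi>)) x = (LINT \<xi>|lborel. fourier_integral ?fr \<xi> * ?Gx \<xi>)"
      unfolding r unfolding fourier_integral_def[of "\<lambda>\<xi>. ?G \<xi> * fourier_integral ?fr \<xi>"] by (simp add: mult_ac inner_commute)
    also have "\<dots> = (LINT y|lborel. ?fr y * fourier_integral ?Gx y)"
      by (rule fourier_integral_multiplication[OF ifr iGx])
    also have "\<dots> = (LINT y|lborel. ?fr y * complex_of_real ((sqrt (2 * pi) / \<epsilon>) ^ DIM('a) * gauss ((x + y) /\<^sub>R \<epsilon>)))"
      unfolding fourier_integral_modulate fourier_integral_gauss_scaled(2)[OF e] ..
    also have "\<dots> = complex_of_real ((sqrt (2 * pi) / \<epsilon>) ^ DIM('a)) * (LINT y|lborel. cnj (f (- y)) * complex_of_real (gauss ((x + y) /\<^sub>R \<epsilon>)))"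
      by (subst integral_mult_right_zero[symmetric]) (simp add: mult_ac)
    also have "(LINT y|lborel. cnj (f (- y)) * complex_of_real (gauss ((x + y) /\<^sub>R \<epsilon>)))
      = complex_of_real (\<epsilon> ^ DIM('a)) * (LINT z|lborel. cnj (f (x - \<epsilon> *\<^sub>R z)) * complex_of_real (gauss z))"
    proof -
      have L: "(lborel :: 'a measure) = density (distr lborel borel (\<lambda>z. - x + \<epsilon> *\<^sub>R z)) (\<lambda>_. \<bar>\<epsilon>\<bar>^DIM('a))"
        by (rule lborel_affine) (use e in simp)
      have "(LINT y|lborel. cnj (f (- y)) * complex_of_real (gauss ((x + y) /\<^sub>R \<epsilon>)))
        = (LINT z|lborel. (\<bar>\<epsilon>\<bar>^DIM('a)) *\<^sub>R (cnj (f (- (- x + \<epsilon> *\<^sub>R z))) * complex_of_real (gauss ((x + (- x + \<epsilon> *\<^sub>R z)) /\<^sub>R \<epsilon>))))"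
        by (subst L, subst integral_density, measurable, subst integral_distr) (use e in auto)
      also have "\<dots> = (\<bar>\<epsilon>\<bar>^DIM('a)) *\<^sub>R (LINT z|lborel. cnj (f (x - \<epsilon> *\<^sub>R z)) * complex_of_real (gauss z))"
        using e by (subst integral_scaleR_right) simp
      finally show ?thesis using e by (simp add: scaleR_conv_of_real)
    qed
    finally show "fourier_integral (\<lambda>\<xi>. ?G \<xi> * cnj (fourier_integral f \<xi>)) x
      = complex_of_real (sqrt (2 * pi) ^ DIM('a)) * (LINT z|lborel. cnj (f (x - \<epsilon> *\<^sub>R z)) * complex_of_real (gauss z))"
      using e by (simp add: power_divide)
  qed
  finally show "(LINT \<xi>|lborel. fourier_integral f \<xi> * (?G \<xi> * cnj (fourier_integral f \<xi>)))
     = complex_of_real (sqrt (2 * pi) ^ DIM('a)) *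
       (LINT x|lborel. f x * (LINT z|lborel. cnj (f (x - \<epsilon> *\<^sub>R z)) * complex_of_real (gauss z)))"
    by (simp only: mult.left_commute[of _ "complex_of_real (sqrt (2 * pi) ^ DIM('a))"] integral_mult_right_zero)
qed

lemma plancherel_gauss_nn:
  fixes f :: "'a::euclidean_space \<Rightarrow> complex"
  assumes f: "integrable lborel f" and e: "\<epsilon> > 0"
  shows "(\<integral>\<^sup>+\<xi>. ennreal (gauss (\<epsilon> *\<^sub>R \<xi>) * (cmod (fourier_integral f \<xi>))\<^sup>2) \<partial>lborel)
    = ennreal (cmod (complex_of_real (sqrt (2 * pi) ^ DIM('a)) *
       (LINT x|lborel. f x * (LINT z|lborel. cnj (f (x - \<epsilon> *\<^sub>R z)) * complex_of_real (gauss z)))))"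
proof -
  have [measurable]: "f \<in> borel_measurable borel" using f by auto
  let ?F = "fourier_integral f"
  have e1: "?F \<xi> * (complex_of_real (gauss (\<epsilon> *\<^sub>R \<xi>)) * cnj (?F \<xi>)) = complex_of_real (gauss (\<epsilon> *\<^sub>R \<xi>) * (cmod (?F \<xi>))\<^sup>2)" for \<xi>
    using complex_norm_square[of "?F \<xi>"] by (simp add: mult_ac)
  have "integrable lborel (\<lambda>\<xi>. ?F \<xi> * (complex_of_real (gauss (\<epsilon> *\<^sub>R \<xi>)) * cnj (?F \<xi>)))"
    by (rule Bochner_Integration.integrable_bound[OF integrable_mult_right[OF plancherel_gauss(1)[OF f e], of "LINT x|lborel. cmod (f x)"]])
       (auto simp: norm_mult intro!: mult_right_mono order_trans[OF fourier_integral_bound[OF f]])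
  hence i: "integrable lborel (\<lambda>\<xi>. gauss (\<epsilon> *\<^sub>R \<xi>) * (cmod (?F \<xi>))\<^sup>2)"
    unfolding e1 complex_of_real_integrable_eq .
  have "(\<integral>\<^sup>+\<xi>. ennreal (gauss (\<epsilon> *\<^sub>R \<xi>) * (cmod (?F \<xi>))\<^sup>2) \<partial>lborel)
     = ennreal (LINT \<xi>|lborel. gauss (\<epsilon> *\<^sub>R \<xi>) * (cmod (?F \<xi>))\<^sup>2)"
    by (rule nn_integral_eq_integral[OF i]) auto
  also have "(LINT \<xi>|lborel. gauss (\<epsilon> *\<^sub>R \<xi>) * (cmod (?F \<xi>))\<^sup>2) = cmod (LINT \<xi>|lborel. complex_of_real (gauss (\<epsilon> *\<^sub>R \<xi>) * (cmod (?F \<xi>))\<^sup>2))"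
    unfolding integral_complex_of_real by (simp only: norm_of_real, rule sym, rule abs_of_nonneg) auto
  finally show ?thesis unfolding e1[symmetric] plancherel_gauss(2)[OF f e] .
qed

text \<open>In the damped identity \<open>|f x| * |f (x - \<epsilon> z)|\<close> is bounded by the
  mean of the two squares, uniformly in \<open>\<epsilon>\<close>; Fatou's lemma then removes the
  damping. This half already makes the transform continuous in \<open>L2\<close>, which is what the
  approximations below rest on.\<close>

lemma plancherel_le:
  fixes f :: "'a::euclidean_space \<Rightarrow> complex"
  assumes f: "integrable lborel f" and f2: "f \<in> L2"
  shows "fourier_integral f \<in> L2" and "nsq (fourier_integral f) \<le> (2 * pi) ^ DIM('a) * nsq f"
proof -
  have [measurable]: "f \<in> borel_measurable borel" using f by auto
  let ?F = "fourier_integral f"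
  define B where "B = (2 * pi) ^ DIM('a) * nsq f"
  have B0: "B \<ge> 0" by (simp add: B_def)
  have *: "(\<integral>\<^sup>+\<xi>. ennreal (gauss (\<epsilon> *\<^sub>R \<xi>) * (cmod (?F \<xi>))\<^sup>2) \<partial>lborel) \<le> ennreal B" if e: "\<epsilon> > 0" for \<epsilon>
  proof -
    have "ennreal (cmod (LINT x|lborel. f x * (LINT z|lborel. cnj (f (x - \<epsilon> *\<^sub>R z)) * complex_of_real (gauss z))))
       \<le> (\<integral>\<^sup>+x. ennreal (cmod (f x * (LINT z|lborel. cnj (f (x - \<epsilon> *\<^sub>R z)) * complex_of_real (gauss z)))) \<partial>lborel)"
      by (rule integral_norm_bound_ennreal')
    also have "\<dots> \<le> (\<integral>\<^sup>+x. (\<integral>\<^sup>+z. ennreal (cmod (f x) * (cmod (f (x - \<epsilon> *\<^sub>R z)) * gauss z)) \<partial>lborel) \<partial>lborel)"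
    proof (rule nn_integral_mono)
      fix x
      have "ennreal (cmod (LINT z|lborel. cnj (f (x - \<epsilon> *\<^sub>R z)) * complex_of_real (gauss z)))
         \<le> (\<integral>\<^sup>+z. ennreal (cmod (f (x - \<epsilon> *\<^sub>R z)) * gauss z) \<partial>lborel)"
        by (rule order_trans[OF integral_norm_bound_ennreal']) (simp add: norm_mult)
      hence "ennreal (cmod (f x)) * ennreal (cmod (LINT z|lborel. cnj (f (x - \<epsilon> *\<^sub>R z)) * complex_of_real (gauss z)))
         \<le> ennreal (cmod (f x)) * (\<integral>\<^sup>+z. ennreal (cmod (f (x - \<epsilon> *\<^sub>R z)) * gauss z) \<partial>lborel)"
        by (rule mult_left_mono) simp
      thus "ennreal (cmod (f x * (LINT z|lborel. cnj (f (x - \<epsilon> *\<^sub>R z)) * complex_of_real (gauss z))))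
         \<le> (\<integral>\<^sup>+z. ennreal (cmod (f x) * (cmod (f (x - \<epsilon> *\<^sub>R z)) * gauss z)) \<partial>lborel)"
        by (subst (asm) nn_integral_cmult[symmetric]) (auto simp: norm_mult ennreal_mult)
    qed
    also have "\<dots> = (\<integral>\<^sup>+z. (\<integral>\<^sup>+x. ennreal (cmod (f x) * (cmod (f (x - \<epsilon> *\<^sub>R z)) * gauss z)) \<partial>lborel) \<partial>lborel)"
      by (rule lborel_pair.Fubini') measurable
    also have "\<dots> \<le> (\<integral>\<^sup>+z. ennreal (gauss (z::'a)) * ennreal (nsq f) \<partial>lborel)"
    proof (rule nn_integral_mono)
      fix z
      have "(\<integral>\<^sup>+x. ennreal (cmod (f x) * (cmod (f (x - \<epsilon> *\<^sub>R z)) * gauss z)) \<partial>lborel)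
         \<le> (\<integral>\<^sup>+x. ennreal (gauss z / 2) * (ennreal ((cmod (f x))\<^sup>2) + ennreal ((cmod (f (- (\<epsilon> *\<^sub>R z) + x)))\<^sup>2)) \<partial>lborel)"
      proof (rule nn_integral_mono)
        fix x
        have "cmod (f x) * cmod (f (x - \<epsilon> *\<^sub>R z)) \<le> ((cmod (f x))\<^sup>2 + (cmod (f (x - \<epsilon> *\<^sub>R z)))\<^sup>2) / 2"
          using sum_squares_bound[of "cmod (f x)" "cmod (f (x - \<epsilon> *\<^sub>R z))"] by simp
        hence "gauss z * (cmod (f x) * cmod (f (x - \<epsilon> *\<^sub>R z))) \<le> gauss z * (((cmod (f x))\<^sup>2 + (cmod (f (x - \<epsilon> *\<^sub>R z)))\<^sup>2) / 2)"
          by (rule mult_left_mono) simp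
        thus "ennreal (cmod (f x) * (cmod (f (x - \<epsilon> *\<^sub>R z)) * gauss z))
            \<le> ennreal (gauss z / 2) * (ennreal ((cmod (f x))\<^sup>2) + ennreal ((cmod (f (- (\<epsilon> *\<^sub>R z) + x)))\<^sup>2))"
          by (subst ennreal_plus[symmetric], simp, simp, subst ennreal_mult[symmetric]) (auto intro!: ennreal_leI simp: mult_ac)
      qed
      also have "\<dots> = ennreal (gauss z / 2) * (ennreal (nsq f) + ennreal (nsq f))"
        by (subst nn_integral_cmult, measurable, subst nn_integral_add, measurable)
           (simp only: nn_integral_nsq[OF f2] nn_integral_nsq[OF L2_shift(1)[OF f2]] L2_shift(2)[OF f2])
      also have "\<dots> = ennreal (gauss z) * ennreal (nsq f)"
        by (subst ennreal_plus[symmetric]) (auto simp: ennreal_mult[symmetric])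
      finally show "(\<integral>\<^sup>+x. ennreal (cmod (f x) * (cmod (f (x - \<epsilon> *\<^sub>R z)) * gauss z)) \<partial>lborel) \<le> ennreal (gauss z) * ennreal (nsq f)" .
    qed
    also have "\<dots> = ennreal (sqrt (2 * pi) ^ DIM('a) * nsq f)"
      by (subst nn_integral_multc, measurable) (simp add: nn_integral_gauss[where 'a='a] ennreal_mult)
    finally have "cmod (LINT x|lborel. f x * (LINT z|lborel. cnj (f (x - \<epsilon> *\<^sub>R z)) * complex_of_real (gauss z))) \<le> sqrt (2 * pi) ^ DIM('a) * nsq f"
      by (simp add: ennreal_le_iff)
    hence "sqrt (2 * pi) ^ DIM('a) * cmod (LINT x|lborel. f x * (LINT z|lborel. cnj (f (x - \<epsilon> *\<^sub>R z)) * complex_of_real (gauss z)))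
       \<le> sqrt (2 * pi) ^ DIM('a) * (sqrt (2 * pi) ^ DIM('a) * nsq f)"
      by (rule mult_left_mono) simp
    also have "\<dots> = B" unfolding B_def by (simp only: mult.assoc[symmetric] sqrt_2pi_power)
    finally show ?thesis
      unfolding plancherel_gauss_nn[OF f e] by (intro ennreal_leI) (simp add: norm_mult norm_power)
  qed
  have "(\<integral>\<^sup>+\<xi>. ennreal ((cmod (?F \<xi>))\<^sup>2) \<partial>lborel)
     = (\<integral>\<^sup>+\<xi>. liminf (\<lambda>n. ennreal (gauss ((1 / real (Suc n)) *\<^sub>R \<xi>) * (cmod (?F \<xi>))\<^sup>2)) \<partial>lborel)"
  proof (rule nn_integral_cong)
    fix \<xi> :: 'a
    have "(\<lambda>n. gauss ((1 / real (Suc n)) *\<^sub>R \<xi>)) \<longlonglongrightarrow> gauss (0 *\<^sub>R \<xi>)"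
      unfolding gauss_def by (intro tendsto_intros LIMSEQ_Suc[OF lim_1_over_n]) auto
    hence "(\<lambda>n. ennreal (gauss ((1 / real (Suc n)) *\<^sub>R \<xi>) * (cmod (?F \<xi>))\<^sup>2)) \<longlonglongrightarrow> ennreal (gauss (0 *\<^sub>R \<xi>) * (cmod (?F \<xi>))\<^sup>2)"
      by (intro tendsto_ennrealI tendsto_intros)
    from lim_imp_Liminf[OF _ this] show "ennreal ((cmod (?F \<xi>))\<^sup>2) = liminf (\<lambda>n. ennreal (gauss ((1 / real (Suc n)) *\<^sub>R \<xi>) * (cmod (?F \<xi>))\<^sup>2))"
      by simp
  qed
  also have "\<dots> \<le> liminf (\<lambda>n. \<integral>\<^sup>+\<xi>. ennreal (gauss ((1 / real (Suc n)) *\<^sub>R \<xi>) * (cmod (?F \<xi>))\<^sup>2) \<partial>lborel)"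
    by (rule nn_integral_liminf) measurable
  also have "\<dots> \<le> limsup (\<lambda>n. \<integral>\<^sup>+\<xi>. ennreal (gauss ((1 / real (Suc n)) *\<^sub>R \<xi>) * (cmod (?F \<xi>))\<^sup>2) \<partial>lborel)"
    by (rule Liminf_le_Limsup) simp
  also have "\<dots> \<le> ennreal B"
    by (rule Limsup_bounded) (use * in auto)
  finally have le: "(\<integral>\<^sup>+\<xi>. ennreal ((cmod (?F \<xi>))\<^sup>2) \<partial>lborel) \<le> ennreal B" .
  show L: "?F \<in> L2" using le unfolding L2_iff_nn by (auto intro: le_less_trans)
  show "nsq ?F \<le> (2 * pi) ^ DIM('a) * nsq f"
    using le B0 unfolding nn_integral_nsq[OF L] B_def[symmetric] by (simp add: ennreal_le_iff)
qed

text \<open>Both sides are continuous for \<open>L2\<close> convergence, the left one by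
  \<open>plancherel_le\<close> applied to the differences \<open>g n - f\<close>.\<close>

lemma plancherel_closed:
  fixes f :: "'a::euclidean_space \<Rightarrow> complex"
  assumes f: "integrable lborel f" "f \<in> L2" and g: "\<And>n. integrable lborel (g n)" "\<And>n. g n \<in> L2"
    and lim: "(\<lambda>n. nsq (\<lambda>x. g n x - f x)) \<longlonglongrightarrow> 0"
    and eq: "\<And>n. nsq (fourier_integral (g n)) = (2 * pi) ^ DIM('a) * nsq (g n)"
  shows "nsq (fourier_integral f) = (2 * pi) ^ DIM('a) * nsq f"
proof -
  have b: "nsq (\<lambda>\<xi>. fourier_integral (g n) \<xi> - fourier_integral f \<xi>) \<le> (2 * pi) ^ DIM('a) * nsq (\<lambda>x. g n x - f x)" for n
    using plancherel_le(2)[OF Bochner_Integration.integrable_diff[OF g(1)[of n] f(1)] L2_diff[OF g(2)[of n] f(2)]]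
    by (subst fourier_integral_diff[OF g(1) f(1), symmetric])
  have "(\<lambda>n. (2 * pi) ^ DIM('a) * nsq (\<lambda>x. g n x - f x)) \<longlonglongrightarrow> (2 * pi) ^ DIM('a) * 0"
    by (intro tendsto_intros lim)
  hence "(\<lambda>n. nsq (\<lambda>\<xi>. fourier_integral (g n) \<xi> - fourier_integral f \<xi>)) \<longlonglongrightarrow> 0"
    unfolding mult_zero_right
    by (rule Lim_null_comparison[rotated]) (intro always_eventually allI, simp only: real_norm_def abs_of_nonneg[OF nsq_nonneg] b)
  hence "(\<lambda>n. nsq (fourier_integral (g n))) \<longlonglongrightarrow> nsq (fourier_integral f)"
    by (intro nsq_tendsto plancherel_le f g)
  moreover have "(\<lambda>n. (2 * pi) ^ DIM('a) * nsq (g n)) \<longlonglongrightarrow> (2 * pi) ^ DIM('a) * nsq f"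
    by (intro tendsto_intros nsq_tendsto f g lim)
  ultimately show ?thesis unfolding eq by (rule LIMSEQ_unique)
qed

text \<open>Only the lower bound is missing. For bounded continuous \<open>f\<close> the Gaussian
  averages converge pointwise to \<open>f\<close> times the mass of the Gaussian, and they are
  dominated, so the limit of the damped energies can be computed; each of them is at most the full
  energy.\<close>

lemma plancherel_continuous:
  fixes f :: "'a::euclidean_space \<Rightarrow> complex"
  assumes f: "integrable lborel f" "f \<in> L2" and c: "continuous_on UNIV f" and B: "\<And>x. cmod (f x) \<le> B"
  shows "nsq (fourier_integral f) = (2 * pi) ^ DIM('a) * nsq f"
proof (rule antisym)
  show "nsq (fourier_integral f) \<le> (2 * pi) ^ DIM('a) * nsq f" by (rule plancherel_le[OF f])
  have [measurable]: "f \<in> borel_measurable borel" using f by auto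
  have B0: "B \<ge> 0" using B[of 0] norm_ge_zero order_trans by blast
  have F: "fourier_integral f \<in> L2" by (rule plancherel_le[OF f])
  \<comment> \<open>The mass of \<open>gauss\<close>; its square is the constant
    \<open>(2 * pi) ^ d\<close> of Plancherel.\<close>
  define c where "c = sqrt (2 * pi) ^ DIM('a)"
  have c0: "c > 0" by (simp add: c_def)
  define \<epsilon> where "\<epsilon> n = 1 / real (Suc n)" for n
  have e0: "\<epsilon> n > 0" for n by (simp add: \<epsilon>_def)
  have elim: "\<epsilon> \<longlonglongrightarrow> 0" unfolding \<epsilon>_def by (rule LIMSEQ_Suc[OF lim_1_over_n])
  define J where "J n x = (LINT z|lborel. cnj (f (x - \<epsilon> n *\<^sub>R z)) * complex_of_real (gauss z))" for n x
  have Jm[measurable]: "J n \<in> borel_measurable borel" for n unfolding J_def[abs_def] by measurable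
  have ig: "integrable lborel (\<lambda>z::'a. B * gauss z)" by (intro integrable_mult_right gauss_integrable)
  have J1: "(\<lambda>n. J n x) \<longlonglongrightarrow> (LINT z|lborel. cnj (f x) * complex_of_real (gauss (z::'a)))" for x
    unfolding J_def
  proof (rule integral_dominated_convergence[OF _ _ ig])
    show "AE z in lborel. (\<lambda>n. cnj (f (x - \<epsilon> n *\<^sub>R z)) * complex_of_real (gauss z)) \<longlonglongrightarrow> cnj (f x) * complex_of_real (gauss z)"
    proof (rule AE_I2)
      fix z :: 'a
      have "(\<lambda>n. x - \<epsilon> n *\<^sub>R z) \<longlonglongrightarrow> x - 0 *\<^sub>R z" by (intro tendsto_intros elim)
      hence "(\<lambda>n. f (x - \<epsilon> n *\<^sub>R z)) \<longlonglongrightarrow> f (x - 0 *\<^sub>R z)"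
        by (rule continuous_on_tendsto_compose[OF c]) auto
      thus "(\<lambda>n. cnj (f (x - \<epsilon> n *\<^sub>R z)) * complex_of_real (gauss z)) \<longlonglongrightarrow> cnj (f x) * complex_of_real (gauss z)"
        by (intro tendsto_intros) simp
    qed
    show "AE z in lborel. norm (cnj (f (x - \<epsilon> n *\<^sub>R z)) * complex_of_real (gauss z)) \<le> B * gauss z" for n
      using B by (auto simp: norm_mult intro!: mult_right_mono)
  qed auto
  have g: "(LINT z|lborel. w * complex_of_real (gauss (z::'a))) = w * complex_of_real c" for w
    by (simp add: gauss_integral c_def)
  have Jb: "cmod (J n x) \<le> B * c" for n x
  proof -
    have "cmod (J n x) \<le> (LINT z|lborel. B * gauss (z::'a))" unfolding J_def
    proof (rule Bochner_Integration.integral_norm_bound_integral[OF _ ig])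
      show "integrable lborel (\<lambda>z. cnj (f (x - \<epsilon> n *\<^sub>R z)) * complex_of_real (gauss z))"
        by (rule Bochner_Integration.integrable_bound[OF ig]) (use B B0 in \<open>auto simp: norm_mult intro!: mult_right_mono\<close>)
    qed (use B in \<open>auto simp: norm_mult intro!: mult_right_mono\<close>)
    thus ?thesis by (simp add: gauss_integral c_def)
  qed
  have "(\<lambda>n. LINT x|lborel. f x * J n x) \<longlonglongrightarrow> (LINT x|lborel. f x * (cnj (f x) * complex_of_real c))"
  proof (rule integral_dominated_convergence[where w="\<lambda>x. cmod (f x) * (B * c)"])
    show "integrable lborel (\<lambda>x. cmod (f x) * (B * c))" using f by (intro integrable_mult_left integrable_norm)
    show "AE x in lborel. (\<lambda>n. f x * J n x) \<longlonglongrightarrow> f x * (cnj (f x) * complex_of_real c)"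
      using J1 unfolding g by (auto intro!: tendsto_intros)
    show "AE x in lborel. norm (f x * J n x) \<le> cmod (f x) * (B * c)" for n
      using Jb by (auto simp: norm_mult intro!: mult_left_mono)
  qed auto
  hence "(\<lambda>n. cmod (complex_of_real c * (LINT x|lborel. f x * J n x))) \<longlonglongrightarrow> cmod (complex_of_real c * (LINT x|lborel. f x * (cnj (f x) * complex_of_real c)))"
    by (intro tendsto_intros)
  moreover have "(LINT x|lborel. f x * (cnj (f x) * complex_of_real c)) = complex_of_real (c * nsq f)"
  proof -
    have "(LINT x|lborel. f x * (cnj (f x) * complex_of_real c)) = (LINT x|lborel. complex_of_real ((cmod (f x))\<^sup>2 * c))"
      by (intro Bochner_Integration.integral_cong refl) (simp only: of_real_mult complex_norm_square mult.assoc)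
    thus ?thesis unfolding integral_complex_of_real by (simp add: nsq_def)
  qed
  ultimately have l: "(\<lambda>n. cmod (complex_of_real c * (LINT x|lborel. f x * J n x))) \<longlonglongrightarrow> c * (c * nsq f)"
    using c0 by (simp add: norm_mult)
  have "c * (c * nsq f) \<le> nsq (fourier_integral f)"
  proof (rule LIMSEQ_le_const2[OF l], intro exI allI impI)
    fix n
    have "ennreal (cmod (complex_of_real c * (LINT x|lborel. f x * J n x)))
      = (\<integral>\<^sup>+\<xi>. ennreal (gauss (\<epsilon> n *\<^sub>R \<xi>) * (cmod (fourier_integral f \<xi>))\<^sup>2) \<partial>lborel)"
      unfolding plancherel_gauss_nn[OF f(1) e0] c_def J_def ..
    also have "\<dots> \<le> (\<integral>\<^sup>+\<xi>. ennreal ((cmod (fourier_integral f \<xi>))\<^sup>2) \<partial>lborel)"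
      by (intro nn_integral_mono ennreal_leI mult_left_le_one_le) (auto simp: gauss_le_1)
    also have "\<dots> = ennreal (nsq (fourier_integral f))" by (rule nn_integral_nsq[OF F])
    finally show "cmod (complex_of_real c * (LINT x|lborel. f x * J n x)) \<le> nsq (fourier_integral f)"
      by (simp add: ennreal_le_iff)
  qed
  thus "(2 * pi) ^ DIM('a) * nsq f \<le> nsq (fourier_integral f)"
    unfolding mult.assoc[symmetric] c_def sqrt_2pi_power .
qed

text \<open>A measurable function is almost everywhere a limit of continuous ones. Clamping their
  values and cutting them off in space gives continuous approximants with a common bound and a
  common compact support, so that convergence also holds in \<open>L2\<close>.\<close>

lemma plancherel_bounded:
  fixes f :: "'a::euclidean_space \<Rightarrow> complex"
  assumes f: "integrable lborel f" "f \<in> L2" and B: "\<And>x. cmod (f x) \<le> B" and s: "\<And>x. norm x > R \<Longrightarrow> f x = 0"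
  shows "nsq (fourier_integral f) = (2 * pi) ^ DIM('a) * nsq f"
proof -
  have fm[measurable]: "f \<in> borel_measurable borel" using f by auto
  have "f measurable_on UNIV"
    by (rule lebesgue_measurable_imp_measurable_on) (auto intro: measurable_completion)
  then obtain N g where N: "negligible N" and gc: "\<And>n. continuous_on UNIV (g n)" and gl: "\<And>x. x \<notin> N \<Longrightarrow> (\<lambda>n. g n x) \<longlonglongrightarrow> f x"
    unfolding measurable_on_def by auto
  define B' where "B' = max B 1"
  have B': "B' > 0" "\<And>x. cmod (f x) \<le> B'" using B by (auto simp: B'_def le_max_iff_disj)
  define cut where "cut x = max 0 (min 1 (\<bar>R\<bar> + 1 - norm x))" for x :: 'a
  have cut: "0 \<le> cut x" "cut x \<le> 1" "norm x \<le> \<bar>R\<bar> \<Longrightarrow> cut x = 1" "norm x \<ge> \<bar>R\<bar> + 1 \<Longrightarrow> cut x = 0" for x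
    by (auto simp: cut_def)
  have cutc: "continuous_on UNIV cut" unfolding cut_def by (intro continuous_intros)
  \<comment> \<open>Radial clamping: values outside the disc of radius \<open>B'\<close> are pulled
    back to its boundary, values inside are kept. \<open>B' \<ge> 1\<close> makes the denominator
    positive.\<close>
  define h where "h w = w * complex_of_real (B' / max B' (cmod w))" for w
  have mpos: "max B' (cmod w) > 0" for w using B' by (simp add: less_max_iff_disj)
  have hc: "continuous_on UNIV h" unfolding h_def by (intro continuous_intros ballI) (use mpos in \<open>metis less_irrefl\<close>)
  have hb: "cmod (h w) \<le> B'" for w
  proof -
    have "cmod (h w) = cmod w * B' / max B' (cmod w)"
      using B' mpos[of w] by (simp add: h_def norm_mult norm_divide)
    also have "\<dots> \<le> B'" using B' mpos[of w] by (simp add: divide_le_eq mult_ac)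
    finally show ?thesis .
  qed
  have h_id: "cmod w \<le> B' \<Longrightarrow> h w = w" for w using B' by (simp add: h_def max_def)
  define k where "k n x = h (g n x) * complex_of_real (cut x)" for n x
  have kc: "continuous_on UNIV (k n)" for n
    unfolding k_def using gc cutc hc by (intro continuous_intros continuous_on_compose2[OF hc]) auto
  have [measurable]: "k n \<in> borel_measurable borel" for n
    by (rule borel_measurable_continuous_onI[OF kc])
  define Z where "Z = cball (0::'a) (\<bar>R\<bar> + 1)"
  have Zi: "integrable lborel (\<lambda>x. C * indicator Z x :: real)" for C
    unfolding Z_def using emeasure_lborel_cball_finite[of "0::'a" "\<bar>R\<bar> + 1"]
    by (intro integrable_mult_right) (simp add: integrable_indicator_iff)
  have kb: "cmod (k n x) \<le> B' * indicator Z x" for n x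
    using hb[of "g n x"] cut[of x] B'
    by (cases "norm x \<le> \<bar>R\<bar> + 1") (auto simp: k_def Z_def norm_mult indicator_def intro!: mult_le_one mult_mono[of _ B' _ 1, simplified])
  have kb2: "(cmod (k n x))\<^sup>2 \<le> B'\<^sup>2 * indicator Z x" for n x
    using power_mono[OF kb[of n x], of 2] by (cases "x \<in> Z") (auto simp: power_mult_distrib)
  have ki: "integrable lborel (k n)" for n
    by (rule Bochner_Integration.integrable_bound[OF Zi[of B']]) (use kb B' in \<open>auto simp: abs_mult\<close>)
  have kL: "k n \<in> L2" for n
    unfolding L2_def using kb2
    by (auto intro!: Bochner_Integration.integrable_bound[OF Zi[of "B'\<^sup>2"]])
  have kl: "(\<lambda>n. k n x) \<longlonglongrightarrow> f x" if "x \<notin> N" for x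
  proof -
    have "(\<lambda>n. h (g n x) * complex_of_real (cut x)) \<longlonglongrightarrow> h (f x) * complex_of_real (cut x)"
      by (intro tendsto_intros continuous_on_tendsto_compose[OF hc gl[OF that]]) auto
    moreover have "h (f x) * complex_of_real (cut x) = f x"
    proof (cases "norm x \<le> \<bar>R\<bar>")
      case True thus ?thesis by (simp only: cut(3) h_id[OF B'(2)]) simp
    next
      case False
      hence "f x = 0" by (intro s) auto
      thus ?thesis by (simp add: h_def)
    qed
    ultimately show ?thesis by (simp add: k_def)
  qed
  have fb: "cmod (f x) \<le> B' * indicator Z x" for x
    using B'(2)[of x] s[of x] by (cases "norm x \<le> \<bar>R\<bar>") (auto simp: Z_def indicator_def)
  have "AE x in lborel. x \<notin> N"
    using AE_not_in[OF N[unfolded negligible_iff_null_sets]] by (simp only: AE_completion_iff)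
  hence AEl: "AE x in lborel. (\<lambda>n. (cmod (k n x - f x))\<^sup>2) \<longlonglongrightarrow> 0"
  proof (rule AE_mp, intro AE_I2 impI)
    fix x assume "x \<notin> N"
    have "(\<lambda>n. (cmod (k n x - f x))\<^sup>2) \<longlonglongrightarrow> (cmod (f x - f x))\<^sup>2"
      by (intro tendsto_intros kl[OF \<open>x \<notin> N\<close>])
    thus "(\<lambda>n. (cmod (k n x - f x))\<^sup>2) \<longlonglongrightarrow> 0" by simp
  qed
  have "(\<lambda>n. nsq (\<lambda>x. k n x - f x)) \<longlonglongrightarrow> (LINT x|(lborel::'a measure). 0)"
    unfolding nsq_def
  proof (rule integral_dominated_convergence[OF _ _ Zi[of "(2 * B')\<^sup>2"]])
    show "AE x in lborel. norm ((cmod (k n x - f x))\<^sup>2) \<le> (2 * B')\<^sup>2 * indicator Z x" for n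
    proof (rule AE_I2)
      fix x
      have "cmod (k n x - f x) \<le> 2 * B' * indicator Z x"
        using norm_triangle_ineq4[of "k n x" "f x"] kb[of n x] fb[of x] by simp
      from power_mono[OF this, of 2] show "norm ((cmod (k n x - f x))\<^sup>2) \<le> (2 * B')\<^sup>2 * indicator Z x"
        by (cases "x \<in> Z") (auto simp: power_mult_distrib)
    qed
  qed (use AEl in auto)
  hence lim: "(\<lambda>n. nsq (\<lambda>x. k n x - f x)) \<longlonglongrightarrow> 0" by simp
  have kB: "cmod (k n x) \<le> B'" for n x
    using kb[of n x] B'(1) by (cases "x \<in> Z") auto
  show ?thesis
    by (rule plancherel_closed[OF f ki kL lim plancherel_continuous[OF ki kL kc kB]])
qed

theorem plancherel:
  fixes f :: "'a::euclidean_space \<Rightarrow> complex"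
  assumes f: "integrable lborel f" "f \<in> L2"
  shows "nsq (fourier_integral f) = (2 * pi) ^ DIM('a) * nsq f"
proof -
  have [measurable]: "f \<in> borel_measurable borel" using f by auto
  \<comment> \<open>Cuts off both large values and distant points, the two conditions of
    \<open>plancherel_bounded\<close>; at each point the sequence is eventually equal to
    \<open>f\<close>.\<close>
  define g where "g n x = (if cmod (f x) \<le> real n \<and> norm x \<le> real n then f x else 0)" for n x
  have [measurable]: "g n \<in> borel_measurable borel" for n unfolding g_def[abs_def] by measurable
  have gb: "cmod (g n x) \<le> cmod (f x)" for n x by (simp add: g_def)
  have gi: "integrable lborel (g n)" for n
    by (rule Bochner_Integration.integrable_bound[OF f(1)]) (use gb in auto)
  have gL: "g n \<in> L2" for n
    by (rule L2_bound[OF f(2) _ gb]) simp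
  have "(\<lambda>n. nsq (\<lambda>x. g n x - f x)) \<longlonglongrightarrow> (LINT x|(lborel::'a measure). 0)"
    unfolding nsq_def
  proof (rule integral_dominated_convergence[OF _ _ L2_integrable[OF f(2)]])
    show "AE x in lborel. (\<lambda>n. (cmod (g n x - f x))\<^sup>2) \<longlonglongrightarrow> 0"
    proof (rule AE_I2, rule tendsto_eventually)
      fix x
      obtain m where "max (cmod (f x)) (norm x) \<le> real m" using real_arch_simple by blast
      thus "eventually (\<lambda>n. (cmod (g n x - f x))\<^sup>2 = 0) sequentially"
        by (intro eventually_sequentiallyI[of m]) (auto simp: g_def)
    qed
    show "AE x in lborel. norm ((cmod (g n x - f x))\<^sup>2) \<le> (cmod (f x))\<^sup>2" for n
      by (auto simp: g_def)
  qed auto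
  hence lim: "(\<lambda>n. nsq (\<lambda>x. g n x - f x)) \<longlonglongrightarrow> 0" by simp
  show ?thesis
  proof (rule plancherel_closed[OF f gi gL lim])
    fix n show "nsq (fourier_integral (g n)) = (2 * pi) ^ DIM('a) * nsq (g n)"
      by (rule plancherel_bounded[OF gi gL, of _ "real n" "real n"]) (auto simp: g_def)
  qed
qed


section \<open>The Fourier transform on \<open>L\<^sup>2\<close>\<close>

definition trunc :: "real \<Rightarrow> ('a::euclidean_space \<Rightarrow> complex) \<Rightarrow> 'a \<Rightarrow> complex" where
  "trunc R f = (\<lambda>x. indicator (ball 0 R) x * f x)"

lemma trunc_measurable[measurable]: "f \<in> borel_measurable borel \<Longrightarrow> trunc R f \<in> borel_measurable borel"
  unfolding trunc_def by (intro borel_measurable_times borel_measurable_indicator) auto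

lemma trunc_bound: "cmod (trunc R f x) \<le> cmod (f x)"
  by (auto simp: trunc_def indicator_def)

lemma trunc_L2: "f \<in> L2 \<Longrightarrow> trunc R f \<in> L2"
  by (rule L2_bound[of f]) (auto simp: trunc_bound)

lemma trunc_integrable:
  fixes f :: "'a::euclidean_space \<Rightarrow> complex"
  assumes "f \<in> L2" shows "integrable lborel (trunc R f)"
proof (rule Bochner_Integration.integrable_bound)
  show "integrable lborel (\<lambda>x. indicator (ball (0::'a) R) x + (cmod (f x))\<^sup>2)"
    by (intro Bochner_Integration.integrable_add L2_integrable[OF assms])
       (use emeasure_lborel_ball_finite[of "0::'a" R] in \<open>simp add: integrable_indicator_iff\<close>)
  show "trunc R f \<in> borel_measurable lborel" using assms by measurable
  have "a \<le> 1 + a\<^sup>2" for a :: real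
  proof -
    have "(a - 1/2)\<^sup>2 \<ge> 0" by simp
    thus ?thesis by (simp add: power2_eq_square algebra_simps)
  qed
  thus "AE x in lborel. norm (trunc R f x) \<le> norm (indicator (ball (0::'a) R) x + (cmod (f x))\<^sup>2)"
    by (auto simp: trunc_def indicator_def)
qed

lemma trunc_tendsto:
  fixes f :: "'a::euclidean_space \<Rightarrow> complex"
  assumes f: "f \<in> L2"
  shows "((\<lambda>R. nsq (\<lambda>x. trunc R f x - f x)) \<longlongrightarrow> 0) at_top"
proof -
  have [measurable]: "f \<in> borel_measurable borel" using f by measurable
  have "((\<lambda>R. nsq (\<lambda>x. trunc R f x - f x)) \<longlongrightarrow> (LINT x|(lborel::'a measure). 0)) at_top"
    unfolding nsq_def
  proof (rule integral_dominated_convergence_at_top[OF _ _ L2_integrable[OF f]])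
    show "AE x in lborel. ((\<lambda>R. (cmod (trunc R f x - f x))\<^sup>2) \<longlongrightarrow> 0) at_top"
    proof (rule AE_I2, rule tendsto_eventually)
      fix x show "eventually (\<lambda>R. (cmod (trunc R f x - f x))\<^sup>2 = 0) at_top"
        using eventually_gt_at_top[of "norm x"] by eventually_elim (auto simp: trunc_def indicator_def)
    qed
    show "\<forall>\<^sub>F R in at_top. AE x in lborel. norm ((cmod (trunc R f x - f x))\<^sup>2) \<le> (cmod (f x))\<^sup>2"
      by (intro always_eventually allI AE_I2) (auto simp: trunc_def indicator_def)
  qed auto
  thus ?thesis by simp
qed

text \<open>The \<open>L2\<close> clause of \<open>has_fourier\<close> with the extended integral
  replaced by the real one. The two agree for square integrable functions, and limits are easier to
  compute with real numbers.\<close>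

definition L2_fourier :: "('a::euclidean_space \<Rightarrow> complex) \<Rightarrow> ('a \<Rightarrow> complex) \<Rightarrow> bool" where
  "L2_fourier f h \<longleftrightarrow> f \<in> L2 \<and> h \<in> L2 \<and>
     ((\<lambda>R. nsq (\<lambda>\<xi>. fourier_integral (trunc R f) \<xi> - h \<xi>)) \<longlongrightarrow> 0) at_top"

lemma L2_fourierD:
  assumes "L2_fourier f h" shows "f \<in> L2" "h \<in> L2"
  using assms by (auto simp: L2_fourier_def)

lemma fourier_trunc_L2: "f \<in> L2 \<Longrightarrow> fourier_integral (trunc R f) \<in> L2"
  by (intro plancherel_le trunc_integrable trunc_L2)

lemma L2_fourier_integrable:
  fixes f :: "'a::euclidean_space \<Rightarrow> complex"
  assumes f: "integrable lborel f" "f \<in> L2"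
    and h: "h \<in> borel_measurable borel" "AE \<xi> in lborel. h \<xi> = fourier_integral f \<xi>"
  shows "L2_fourier f h"
proof -
  have hL: "h \<in> L2"
    by (rule L2_cong_AE[OF plancherel_le(1)[OF f] h(1)]) (use h(2) in auto)
  have e: "nsq (\<lambda>\<xi>. fourier_integral (trunc R f) \<xi> - h \<xi>) = (2 * pi) ^ DIM('a) * nsq (\<lambda>x. trunc R f x - f x)" for R
  proof -
    have "nsq (\<lambda>\<xi>. fourier_integral (trunc R f) \<xi> - h \<xi>) = nsq (\<lambda>\<xi>. fourier_integral (trunc R f) \<xi> - fourier_integral f \<xi>)"
      by (rule nsq_cong_AE) (use h f in auto)
    also have "\<dots> = nsq (fourier_integral (\<lambda>x. trunc R f x - f x))"
      by (subst fourier_integral_diff[OF trunc_integrable[OF f(2)] f(1), symmetric]) rule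
    also have "\<dots> = (2 * pi) ^ DIM('a) * nsq (\<lambda>x. trunc R f x - f x)"
      by (intro plancherel Bochner_Integration.integrable_diff L2_diff trunc_integrable trunc_L2 f)
    finally show ?thesis .
  qed
  have "((\<lambda>R. (2 * pi) ^ DIM('a) * nsq (\<lambda>x. trunc R f x - f x)) \<longlongrightarrow> (2 * pi) ^ DIM('a) * 0) at_top"
    by (intro tendsto_intros trunc_tendsto f)
  thus ?thesis unfolding L2_fourier_def e using f hL by simp
qed

text \<open>The \<open>L1\<close> clause is absorbed by \<open>L2_fourier_integrable\<close>: by
  Plancherel the integrals over balls converge in \<open>L2\<close> to the full integral. From here
  on \<open>has_fourier\<close> is unfolded only for densities, which are integrable.\<close>

lemma has_fourier_L2_iff:
  fixes f :: "'a::euclidean_space \<Rightarrow> complex"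
  assumes f: "f \<in> L2"
  shows "has_fourier f h \<longleftrightarrow> L2_fourier f h"
proof -
  have *: "(\<integral>\<^sup>+\<xi>. ennreal ((cmod (fourier_integral (\<lambda>x. indicator (ball 0 R) x * f x) \<xi> - h \<xi>))\<^sup>2) \<partial>lborel)
      = ennreal (nsq (\<lambda>\<xi>. fourier_integral (trunc R f) \<xi> - h \<xi>))" if "h \<in> L2" for R
    unfolding trunc_def[symmetric] by (intro nn_integral_nsq L2_diff fourier_trunc_L2 f that)
  have "h \<in> L2 \<Longrightarrow> ((\<lambda>R. ennreal (nsq (\<lambda>\<xi>. fourier_integral (trunc R f) \<xi> - h \<xi>))) \<longlongrightarrow> 0) at_top
     \<longleftrightarrow> ((\<lambda>R. nsq (\<lambda>\<xi>. fourier_integral (trunc R f) \<xi> - h \<xi>)) \<longlongrightarrow> 0) at_top"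
    by (subst ennreal_0[symmetric], rule tendsto_ennreal_iff) auto
  thus ?thesis
    unfolding has_fourier_def L2_fourier_def
    using L2_fourier_integrable[of f h] f * by (auto simp: L2_fourier_def)
qed

lemma L2_fourier_nsq:
  fixes f :: "'a::euclidean_space \<Rightarrow> complex"
  assumes "L2_fourier f h" shows "nsq h = (2 * pi) ^ DIM('a) * nsq f"
proof -
  note L = L2_fourierD[OF assms]
  have "((\<lambda>R. nsq (fourier_integral (trunc R f))) \<longlongrightarrow> nsq h) at_top"
    using assms by (intro nsq_tendsto fourier_trunc_L2 L) (simp add: L2_fourier_def)
  moreover have "((\<lambda>R. (2 * pi) ^ DIM('a) * nsq (trunc R f)) \<longlongrightarrow> (2 * pi) ^ DIM('a) * nsq f) at_top"
    by (intro tendsto_intros nsq_tendsto trunc_L2 L trunc_tendsto)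
  hence "((\<lambda>R. nsq (fourier_integral (trunc R f))) \<longlongrightarrow> (2 * pi) ^ DIM('a) * nsq f) at_top"
    by (subst plancherel[OF trunc_integrable[OF L(1)] trunc_L2[OF L(1)]])
  ultimately show ?thesis by (rule tendsto_unique[rotated]) simp
qed

lemma L2_fourier_unique:
  fixes f :: "'a::euclidean_space \<Rightarrow> complex"
  assumes 1: "L2_fourier f h" and 2: "L2_fourier f k" shows "AE \<xi> in lborel. h \<xi> = k \<xi>"
proof -
  note L = L2_fourierD[OF 1] L2_fourierD[OF 2]
  let ?a = "\<lambda>R. fourier_integral (trunc R f)"
  have "((\<lambda>R. 2 * nsq (\<lambda>\<xi>. ?a R \<xi> - k \<xi>) + 2 * nsq (\<lambda>\<xi>. ?a R \<xi> - h \<xi>)) \<longlongrightarrow> 2 * 0 + 2 * 0) at_top"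
    using 1 2 by (intro tendsto_intros) (auto simp: L2_fourier_def)
  moreover have "nsq (\<lambda>\<xi>. h \<xi> - k \<xi>) \<le> 2 * nsq (\<lambda>\<xi>. ?a R \<xi> - k \<xi>) + 2 * nsq (\<lambda>\<xi>. ?a R \<xi> - h \<xi>)" for R
  proof -
    have "nsq (\<lambda>\<xi>. h \<xi> - k \<xi>) = nsq (\<lambda>\<xi>. (?a R \<xi> - k \<xi>) + (-1) * (?a R \<xi> - h \<xi>))" by simp
    also have "\<dots> \<le> 2 * nsq (\<lambda>\<xi>. ?a R \<xi> - k \<xi>) + 2 * nsq (\<lambda>\<xi>. (-1) * (?a R \<xi> - h \<xi>))"
      by (rule nsq_add_le) (intro L2_diff L2_cmult fourier_trunc_L2 L)+
    also have "nsq (\<lambda>\<xi>. (-1) * (?a R \<xi> - h \<xi>)) = nsq (\<lambda>\<xi>. ?a R \<xi> - h \<xi>)"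
      by (subst L2_cmult(2)) (intro L2_diff fourier_trunc_L2 L | simp)+
    finally show ?thesis .
  qed
  ultimately have "nsq (\<lambda>\<xi>. h \<xi> - k \<xi>) \<le> 2 * 0 + 2 * 0"
    by (intro tendsto_lowerbound[where F="at_top :: real filter"]) (auto intro!: always_eventually)
  hence "nsq (\<lambda>\<xi>. h \<xi> - k \<xi>) = 0" using nsq_nonneg[of "\<lambda>\<xi>. h \<xi> - k \<xi>"] by (simp del: nsq_nonneg)
  from nsq_eq_0_AE[OF L2_diff[OF L(2) L(4)] this] show ?thesis by simp
qed

lemma L2_fourier_add_cmult:
  fixes f g :: "'a::euclidean_space \<Rightarrow> complex"
  assumes 1: "L2_fourier f h" and 2: "L2_fourier g k"
  shows "L2_fourier (\<lambda>x. f x + c * g x) (\<lambda>x. h x + c * k x)"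
proof -
  note L = L2_fourierD[OF 1] L2_fourierD[OF 2]
  let ?a = "\<lambda>R. fourier_integral (trunc R f)" and ?b = "\<lambda>R. fourier_integral (trunc R g)"
  have e: "fourier_integral (trunc R (\<lambda>x. f x + c * g x)) \<xi> - (h \<xi> + c * k \<xi>) = (?a R \<xi> - h \<xi>) + c * (?b R \<xi> - k \<xi>)" for R \<xi>
  proof -
    have "trunc R (\<lambda>x. f x + c * g x) = (\<lambda>x. trunc R f x + c * trunc R g x)"
      by (auto simp: trunc_def algebra_simps)
    thus ?thesis
      using fourier_integral_add_cmult[OF trunc_integrable[OF L(1), of R] trunc_integrable[OF L(3), of R], of c \<xi>]
      by (simp add: algebra_simps)
  qed
  have b: "nsq (\<lambda>\<xi>. fourier_integral (trunc R (\<lambda>x. f x + c * g x)) \<xi> - (h \<xi> + c * k \<xi>))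
     \<le> 2 * nsq (\<lambda>\<xi>. ?a R \<xi> - h \<xi>) + 2 * ((cmod c)\<^sup>2 * nsq (\<lambda>\<xi>. ?b R \<xi> - k \<xi>))" for R
    unfolding e
    by (rule order_trans[OF nsq_add_le], (intro L2_diff L2_cmult fourier_trunc_L2 L)+)
       (subst L2_cmult(2), (intro L2_diff fourier_trunc_L2 L order_refl)+)
  have "((\<lambda>R. 2 * nsq (\<lambda>\<xi>. ?a R \<xi> - h \<xi>) + 2 * ((cmod c)\<^sup>2 * nsq (\<lambda>\<xi>. ?b R \<xi> - k \<xi>))) \<longlongrightarrow> 2 * 0 + 2 * ((cmod c)\<^sup>2 * 0)) at_top"
    using 1 2 by (intro tendsto_intros) (auto simp: L2_fourier_def)
  hence "((\<lambda>R. 2 * nsq (\<lambda>\<xi>. ?a R \<xi> - h \<xi>) + 2 * ((cmod c)\<^sup>2 * nsq (\<lambda>\<xi>. ?b R \<xi> - k \<xi>))) \<longlongrightarrow> 0) at_top"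
    by simp
  hence "((\<lambda>R. nsq (\<lambda>\<xi>. fourier_integral (trunc R (\<lambda>x. f x + c * g x)) \<xi> - (h \<xi> + c * k \<xi>))) \<longlongrightarrow> 0) at_top"
    by (rule Lim_null_comparison[rotated]) (intro always_eventually allI, simp only: real_norm_def abs_of_nonneg[OF nsq_nonneg] b)
  thus ?thesis unfolding L2_fourier_def using L by (auto intro: L2_add_cmult)
qed

text \<open>Polarisation of the norm identity, with \<open>c = 1\<close> for the real and
  \<open>c = \<i>\<close> for the imaginary part.\<close>

theorem parseval:
  fixes f g :: "'a::euclidean_space \<Rightarrow> complex"
  assumes 1: "L2_fourier f h" and 2: "L2_fourier g k"
  shows "ip h k = complex_of_real ((2 * pi) ^ DIM('a)) * ip f g"
proof (rule complex_eqI)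
  note L = L2_fourierD[OF 1] L2_fourierD[OF 2]
  have e: "nsq (\<lambda>x. h x + c * k x) = (2 * pi) ^ DIM('a) * nsq (\<lambda>x. f x + c * g x)" for c
    by (rule L2_fourier_nsq[OF L2_fourier_add_cmult[OF 1 2]])
  show "Re (ip h k) = Re (complex_of_real ((2 * pi) ^ DIM('a)) * ip f g)"
    "Im (ip h k) = Im (complex_of_real ((2 * pi) ^ DIM('a)) * ip f g)"
    unfolding ip_polarize[OF L(2) L(4)] Re_complex_of_real times_complex.sel Im_complex_of_real
      ip_polarize[OF L(1) L(3)] e L2_fourier_nsq[OF 1] L2_fourier_nsq[OF 2]
    by (simp_all add: algebra_simps)
qed

text \<open>Truncation commutes with modulation, so the shift in frequency is exact before the limit
  is taken. It expresses the transform of \<open>|v|^2\<close> at a frequency as an inner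
  product.\<close>

lemma L2_fourier_modulate:
  fixes f :: "'a::euclidean_space \<Rightarrow> complex"
  assumes 1: "L2_fourier f h"
  shows "L2_fourier (\<lambda>x. f x * exp (- \<i> * complex_of_real (y \<bullet> x))) (\<lambda>\<xi>. h (y + \<xi>))"
proof -
  note L = L2_fourierD[OF 1]
  have [measurable]: "f \<in> borel_measurable borel" using L by measurable
  have "fourier_integral (trunc R (\<lambda>x. f x * exp (- \<i> * complex_of_real (y \<bullet> x)))) \<xi> - h (y + \<xi>)
     = fourier_integral (trunc R f) (y + \<xi>) - h (y + \<xi>)" for R \<xi>
    using fourier_integral_modulate[of "trunc R f" y \<xi>] by (simp add: trunc_def mult.assoc)
  hence "nsq (\<lambda>\<xi>. fourier_integral (trunc R (\<lambda>x. f x * exp (- \<i> * complex_of_real (y \<bullet> x)))) \<xi> - h (y + \<xi>))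
    = nsq (\<lambda>\<xi>. fourier_integral (trunc R f) \<xi> - h \<xi>)" for R
    using L2_shift(2)[OF L2_diff[OF fourier_trunc_L2[OF L(1)] L(2)], of R y] by simp
  moreover have "(\<lambda>x. f x * exp (- \<i> * complex_of_real (y \<bullet> x))) \<in> L2"
    by (rule L2_bound[OF L(1)]) (auto simp: norm_mult)
  ultimately show ?thesis using 1 L2_shift(1)[OF L(2)] by (simp add: L2_fourier_def)
qed

text \<open>Given by an integral and hence meaningful at every point. It is applied to integrable
  \<open>H\<close>; general square integrable data are reached by truncation.\<close>

definition fourier_inverse :: "('a::euclidean_space \<Rightarrow> complex) \<Rightarrow> 'a \<Rightarrow> complex" where
  "fourier_inverse H x = fourier_integral H (- x) / complex_of_real ((2 * pi) ^ DIM('a))"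

lemma fourier_inverse_L2:
  fixes H :: "'a::euclidean_space \<Rightarrow> complex"
  assumes H: "integrable lborel H" "H \<in> L2"
  shows "fourier_inverse H \<in> L2" and "nsq H = (2 * pi) ^ DIM('a) * nsq (fourier_inverse H)"
proof -
  have [measurable]: "H \<in> borel_measurable borel" using H by auto
  have F: "fourier_integral H \<in> L2" by (rule plancherel_le[OF H])
  hence F': "(\<lambda>x. fourier_integral H (- x)) \<in> L2"
    using integrable_lborel_reflect[of "\<lambda>x. (cmod (fourier_integral H x))\<^sup>2" 0] by (simp add: L2_def)
  have n: "nsq (\<lambda>x. fourier_integral H (- x)) = nsq (fourier_integral H)"
    using integral_lborel_reflect[of "\<lambda>x. (cmod (fourier_integral H x))\<^sup>2" 0] F by (simp add: nsq_def L2_def)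
  have e: "fourier_inverse H = (\<lambda>x. (1 / complex_of_real ((2 * pi) ^ DIM('a))) * fourier_integral H (- x))"
    by (auto simp: fourier_inverse_def)
  show "fourier_inverse H \<in> L2" unfolding e by (rule L2_cmult[OF F'])
  have "nsq (fourier_inverse H) = (1 / (2 * pi) ^ DIM('a))\<^sup>2 * ((2 * pi) ^ DIM('a) * nsq H)"
    unfolding e L2_cmult(2)[OF F'] n plancherel[OF H] by (simp add: norm_divide norm_mult norm_power)
  thus "nsq H = (2 * pi) ^ DIM('a) * nsq (fourier_inverse H)" by (simp add: power2_eq_square)
qed

text \<open>Since \<open>H\<close> and \<open>fourier_inverse H\<close> have matching norms and the inner product of \<open>H\<close> with a truncated
  transform is known from the multiplication formula, no density argument is needed.\<close>

theorem L2_fourier_inverse: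
  fixes H :: "'a::euclidean_space \<Rightarrow> complex"
  assumes H: "integrable lborel H" "H \<in> L2"
  shows "L2_fourier (fourier_inverse H) H"
proof -
  let ?g = "fourier_inverse H" and ?c = "(2 * pi) ^ DIM('a)"
  note g = fourier_inverse_L2[OF H]
  let ?S = "\<lambda>R. fourier_integral (trunc R ?g)"
  have S: "nsq (?S R) = ?c * nsq (trunc R ?g)" for R
    by (intro plancherel trunc_integrable trunc_L2 g)
  have I: "ip (?S R) H = complex_of_real (?c * nsq (trunc R ?g))" for R
  proof -
    have "ip (?S R) H = (LINT x|lborel. trunc R ?g x * fourier_integral (\<lambda>x. cnj (H x)) x)"
      unfolding ip_def by (rule fourier_integral_multiplication) (auto intro: trunc_integrable g H)
    also have "\<dots> = (LINT x|lborel. complex_of_real (?c * (cmod (trunc R ?g x))\<^sup>2))"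
    proof (intro Bochner_Integration.integral_cong refl)
      fix x
      have "fourier_integral (\<lambda>x. cnj (H x)) x = complex_of_real ?c * cnj (?g x)"
        unfolding fourier_integral_cnj by (simp add: fourier_inverse_def)
      hence "trunc R ?g x * fourier_integral (\<lambda>x. cnj (H x)) x = complex_of_real ?c * (trunc R ?g x * cnj (trunc R ?g x))"
        by (simp add: trunc_def indicator_def)
      thus "trunc R ?g x * fourier_integral (\<lambda>x. cnj (H x)) x = complex_of_real (?c * (cmod (trunc R ?g x))\<^sup>2)"
        unfolding of_real_mult complex_norm_square .
    qed
    also have "\<dots> = complex_of_real (?c * nsq (trunc R ?g))"
      unfolding integral_complex_of_real nsq_def integral_mult_right_zero ..
    finally show ?thesis .
  qed
  have "nsq (\<lambda>\<xi>. ?S R \<xi> - H \<xi>) = nsq H - ?c * nsq (trunc R ?g)" for R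
    using L2_add_cmult(2)[OF fourier_trunc_L2[OF g(1)] H(2), of R "-1"] by (simp add: S I)
  moreover have "((\<lambda>R. nsq H - ?c * nsq (trunc R ?g)) \<longlongrightarrow> nsq H - ?c * nsq ?g) at_top"
    by (intro tendsto_intros nsq_tendsto trunc_L2 g trunc_tendsto)
  ultimately show ?thesis using g H by (simp add: L2_fourier_def)
qed

section \<open>Rotations, hyperplanes and rays\<close>

lemma cball_measurable[measurable]: "cball (c :: 'a::euclidean_space) r \<in> sets borel"
  by simp

lemma distr_lborel_orthogonal:
  fixes f :: "'a::euclidean_space \<Rightarrow> 'a"
  assumes f: "orthogonal_transformation f"
  shows "distr lborel borel f = lborel"
proof (rule measure_eqI)
  have lin: "linear f" by (rule orthogonal_transformation_linear[OF f])
  hence [measurable]: "f \<in> borel_measurable borel"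
    by (intro borel_measurable_continuous_onI linear_continuous_on linear_conv_bounded_linear[THEN iffD1])
  have g: "surj f" by (rule orthogonal_transformation_surj[OF f])
  define B where "B = cball (0::'a) 1"
  have fB: "f -` B = B" by (auto simp: B_def orthogonal_transformation_norm[OF f])
  have [measurable]: "B \<in> sets borel" by (simp add: B_def)
  show "sets (distr lborel borel f) = sets lborel" by simp
  fix A assume "A \<in> sets (distr lborel borel f)"
  hence [measurable]: "A \<in> sets borel" by simp
  have fA[measurable]: "f -` A \<in> sets borel" using measurable_sets_borel[of f borel A] by simp
  have "emeasure lborel (f -` A) * emeasure lborel B
     = (\<integral>\<^sup>+x. (\<integral>\<^sup>+y. indicator A (f x) * indicator B (f x + y) \<partial>lborel) \<partial>lborel)"
  proof -
    have "(\<integral>\<^sup>+y. indicator A (f x) * indicator B (f x + y) \<partial>lborel) = indicator A (f x) * emeasure lborel B" for x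
      by (subst nn_integral_cmult, measurable, subst nn_integral_lborel_shift[of "indicator B"]) auto
    thus ?thesis by (simp add: nn_integral_multc indicator_vimage[of f A, symmetric] o_def nn_integral_indicator fA)
  qed
  also have "\<dots> = (\<integral>\<^sup>+y. (\<integral>\<^sup>+x. indicator A (f x) * indicator B (f x + y) \<partial>lborel) \<partial>lborel)"
    by (rule lborel_pair.Fubini'[symmetric]) measurable
  also have "\<dots> = (\<integral>\<^sup>+y. (\<integral>\<^sup>+x. indicator A (f x - y) * indicator B (f x) \<partial>lborel) \<partial>lborel)"
  proof (rule nn_integral_cong)
    fix y :: 'a
    \<comment> \<open>Surjectivity writes the translation by \<open>y\<close> after \<open>f\<close>
      as a translation by \<open>s\<close> before \<open>f\<close>, which Lebesgue measure does not
      see.\<close>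
    obtain s where s: "y = f s" using g by auto
    have "(\<integral>\<^sup>+x. indicator A (f x - y) * indicator B (f x) \<partial>lborel)
       = (\<integral>\<^sup>+x. indicator A (f (s + x) - y) * indicator B (f (s + x)) \<partial>lborel)"
      by (rule nn_integral_lborel_shift[symmetric, of "\<lambda>x. indicator A (f x - y) * indicator B (f x)"]) measurable
    also have "\<dots> = (\<integral>\<^sup>+x. indicator A (f x) * indicator B (f x + y) \<partial>lborel)"
      by (simp add: s linear_add[OF lin] add.commute)
    finally show "(\<integral>\<^sup>+x. indicator A (f x) * indicator B (f x + y) \<partial>lborel)
       = (\<integral>\<^sup>+x. indicator A (f x - y) * indicator B (f x) \<partial>lborel)" by (rule sym)
  qed
  also have "\<dots> = (\<integral>\<^sup>+x. (\<integral>\<^sup>+y. indicator A (f x - y) * indicator B (f x) \<partial>lborel) \<partial>lborel)"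
    by (rule lborel_pair.Fubini') measurable
  also have "\<dots> = emeasure lborel A * emeasure lborel B"
  proof -
    have "(\<integral>\<^sup>+y. indicator A (f x - y) * indicator B (f x) \<partial>lborel) = emeasure lborel A * indicator (f -` B) x" for x
      by (subst nn_integral_multc, measurable, subst nn_integral_lborel_reflect[of "indicator A"]) (auto simp: indicator_def)
    thus ?thesis by (simp add: nn_integral_cmult fB)
  qed
  finally have "emeasure lborel (f -` A) * emeasure lborel B = emeasure lborel A * emeasure lborel B" .
  moreover obtain \<beta> where \<beta>: "emeasure lborel B = ennreal \<beta>" "\<beta> > 0"
    unfolding B_def by (auto simp: emeasure_cball)
  ultimately have "emeasure lborel (f -` A) * (ennreal \<beta> * ennreal (1 / \<beta>)) = emeasure lborel A * (ennreal \<beta> * ennreal (1 / \<beta>))"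
    by (simp only: mult.assoc[symmetric])
  hence "emeasure lborel (f -` A) = emeasure lborel A"
    using \<beta>(2) by (simp add: ennreal_mult[symmetric])
  thus "emeasure (distr lborel borel f) A = emeasure lborel A"
    by (simp add: emeasure_distr)
qed

lemma orthogonal_transformation_measurable[measurable_dest]:
  fixes f :: "'a::euclidean_space \<Rightarrow> 'a"
  assumes f: "orthogonal_transformation f"
  shows "f \<in> borel_measurable borel"
  by (intro borel_measurable_continuous_onI linear_continuous_on linear_conv_bounded_linear[THEN iffD1]
      orthogonal_transformation_linear f)

lemma orthogonal_reflection:
  fixes u :: "'a::euclidean_space"
  shows "orthogonal_transformation (\<lambda>x. x - (2 * (x \<bullet> u) / (u \<bullet> u)) *\<^sub>R u)"
proof (cases "u = 0")
  case False
  hence "u \<bullet> u \<noteq> 0" by simp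
  moreover have "linear (\<lambda>x. x - (2 * (x \<bullet> u) / (u \<bullet> u)) *\<^sub>R u)"
    by (rule linearI) (simp_all add: algebra_simps add_divide_distrib)
  ultimately show ?thesis
    unfolding orthogonal_transformation_def
    by (auto simp: inner_diff_left inner_diff_right inner_commute field_simps)
qed simp

text \<open>The reflection in the hyperplane bisecting \<open>a\<close> and
  \<open>b\<close>.\<close>

lemma orthogonal_transformation_exists:
  fixes a b :: "'a::euclidean_space"
  assumes "norm a = norm b"
  obtains f where "orthogonal_transformation f" "f a = b"
proof (cases "a = b")
  case True thus ?thesis using that[of "\<lambda>x. x"] by simp
next
  case False
  let ?u = "a - b"
  have 0: "?u \<bullet> ?u \<noteq> 0" using False by simp
  have "a \<bullet> a = b \<bullet> b" using assms by (simp add: norm_eq_sqrt_inner)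
  hence "2 * (a \<bullet> ?u) = ?u \<bullet> ?u" by (simp add: inner_diff_left inner_diff_right inner_commute)
  hence "a - (2 * (a \<bullet> ?u) / (?u \<bullet> ?u)) *\<^sub>R ?u = b" using 0 by simp
  thus ?thesis using that[OF orthogonal_reflection[of ?u]] by simp
qed

text \<open>A basis vector \<open>b\<close> is rotated to \<open>\<omega>\<close> and the coordinate
  along \<open>b\<close> is split off. \<open>N\<close> is the product measure of the other
  coordinates and \<open>\<psi>\<close> the rotated embedding, so the hyperplane is parametrised by
  coordinate functions and needs no type of its own.\<close>

lemma hyperplane_decomposition:
  fixes \<omega> :: "'a::euclidean_space"
  assumes w: "norm \<omega> = 1"
  obtains N :: "('a \<Rightarrow> real) measure" and \<psi> :: "('a \<Rightarrow> real) \<Rightarrow> 'a"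
  where "sigma_finite_measure N" "\<psi> \<in> N \<rightarrow>\<^sub>M borel" "\<And>z. \<omega> \<bullet> \<psi> z = 0"
    "distr (lborel \<Otimes>\<^sub>M N) borel (\<lambda>(r, z). r *\<^sub>R \<omega> + \<psi> z) = lborel"
proof -
  obtain b :: 'a where b: "b \<in> Basis" using nonempty_Basis by blast
  obtain f :: "'a \<Rightarrow> 'a" where f: "orthogonal_transformation f" "f b = \<omega>"
    using orthogonal_transformation_exists[of b \<omega>] b w by auto
  have lin: "linear f" by (rule orthogonal_transformation_linear[OF f(1)])
  have [measurable]: "f \<in> borel_measurable borel" using f by measurable
  interpret product_sigma_finite "\<lambda>_::'a. lborel :: real measure" ..
  define I where "I = Basis - {b}"
  have I: "finite I" "b \<notin> I" "insert b I = Basis" using b by (auto simp: I_def)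
  define N :: "('a \<Rightarrow> real) measure" where "N = PiM I (\<lambda>_. lborel)"
  define \<psi> where "\<psi> z = f (\<Sum>c\<in>I. z c *\<^sub>R c)" for z
  interpret F: finite_product_sigma_finite "\<lambda>_::'a. lborel :: real measure" I by standard fact
  have N: "sigma_finite_measure N" unfolding N_def ..
  interpret N: sigma_finite_measure N by fact
  interpret P: pair_sigma_finite "lborel :: real measure" N ..
  have m1: "(\<lambda>z. \<Sum>c\<in>I. z c *\<^sub>R c) \<in> N \<rightarrow>\<^sub>M borel"
    unfolding N_def by (intro borel_measurable_sum borel_measurable_scaleR borel_measurable_const)
      (metis measurable_component_singleton measurable_lborel1)
  have m[measurable]: "\<psi> \<in> N \<rightarrow>\<^sub>M borel" unfolding \<psi>_def using m1 by measurable
  have perp: "\<omega> \<bullet> \<psi> z = 0" for z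
  proof -
    have "\<omega> \<bullet> \<psi> z = b \<bullet> (\<Sum>c\<in>I. z c *\<^sub>R c)"
      using f by (simp add: \<psi>_def f(2)[symmetric] orthogonal_transformation_def del: f(2))
    also have "\<dots> = 0" using b by (auto simp: inner_sum_right I_def inner_Basis intro!: sum.neutral split: if_splits)
    finally show ?thesis .
  qed
  have "distr (lborel \<Otimes>\<^sub>M N) borel (\<lambda>(r, z). r *\<^sub>R \<omega> + \<psi> z) = lborel"
  proof (rule measure_eqI)
    fix A :: "'a set" assume "A \<in> sets (distr (lborel \<Otimes>\<^sub>M N) borel (\<lambda>(r, z). r *\<^sub>R \<omega> + \<psi> z))"
    hence [measurable]: "A \<in> sets borel" by simp
    have "emeasure lborel A = (\<integral>\<^sup>+x. indicator A x \<partial>lborel)" by simp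
    also have "\<dots> = (\<integral>\<^sup>+x. indicator A (f x) \<partial>lborel)"
      by (subst distr_lborel_orthogonal[OF f(1), symmetric], subst nn_integral_distr) auto
    also have "\<dots> = (\<integral>\<^sup>+g. indicator A (f (\<Sum>c\<in>Basis. g c *\<^sub>R c)) \<partial>(PiM Basis (\<lambda>_. lborel)))"
      by (subst lborel_eq, subst nn_integral_distr) auto
    also have "\<dots> = (\<integral>\<^sup>+g. (\<integral>\<^sup>+r. indicator A (f (\<Sum>c\<in>Basis. (g(b := r)) c *\<^sub>R c)) \<partial>lborel) \<partial>N)"
      unfolding I(3)[symmetric] N_def by (rule product_nn_integral_insert[OF I(1,2)]) (simp add: I(3))
    also have "\<dots> = (\<integral>\<^sup>+z. (\<integral>\<^sup>+r. indicator A (r *\<^sub>R \<omega> + \<psi> z) \<partial>lborel) \<partial>N)"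
    proof (intro nn_integral_cong arg_cong[where f="indicator A"])
      fix g :: "'a \<Rightarrow> real" and r :: real
      have "(\<Sum>c\<in>Basis. (g(b := r)) c *\<^sub>R c) = r *\<^sub>R b + (\<Sum>c\<in>I. (g(b := r)) c *\<^sub>R c)"
        unfolding I(3)[symmetric] using I by (subst sum.insert) auto
      also have "(\<Sum>c\<in>I. (g(b := r)) c *\<^sub>R c) = (\<Sum>c\<in>I. g c *\<^sub>R c)"
        using I(2) by (intro sum.cong) auto
      finally show "f (\<Sum>c\<in>Basis. (g(b := r)) c *\<^sub>R c) = r *\<^sub>R \<omega> + \<psi> g"
        by (simp add: \<psi>_def linear_add[OF lin] linear_scale[OF lin] f(2))
    qed
    also have "\<dots> = (\<integral>\<^sup>+p. indicator A (fst p *\<^sub>R \<omega> + \<psi> (snd p)) \<partial>(lborel \<Otimes>\<^sub>M N))"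
      by (subst P.nn_integral_snd[symmetric]) auto
    also have "\<dots> = emeasure (distr (lborel \<Otimes>\<^sub>M N) borel (\<lambda>(r, z). r *\<^sub>R \<omega> + \<psi> z)) A"
      by (subst nn_integral_indicator[symmetric], simp, subst nn_integral_distr) (auto simp: case_prod_unfold)
    finally show "emeasure (distr (lborel \<Otimes>\<^sub>M N) borel (\<lambda>(r, z). r *\<^sub>R \<omega> + \<psi> z)) A = emeasure lborel A" by (rule sym)
  qed simp
  with N m perp show ?thesis by (rule that)
qed

text \<open>Used in polar coordinates with \<open>a = norm x\<close>; its factor
  \<open>1 / d\<close> is the reason for the factor \<open>d\<close> there.\<close>

lemma nn_integral_powr_tail:
  assumes a: "a > 0" and d: "d > (0::nat)"
  shows "(\<integral>\<^sup>+l. ennreal (1 / l ^ Suc d) * indicator {a..} l \<partial>lborel) = ennreal (1 / (real d * a ^ d))"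
proof -
  have "(\<integral>\<^sup>+l. ennreal (1 / l ^ Suc d) * indicator {a..} l \<partial>lborel) = 0 - (- 1 / (real d * a ^ d))"
  proof (rule nn_integral_FTC_atLeast)
    show "((\<lambda>l. - 1 / (real d * l ^ d)) has_real_derivative 1 / x ^ Suc d) (at x)" if "a \<le> x" for x
    proof -
      have x: "x \<noteq> 0" using that a by simp
      have "x ^ d = x * x ^ (d - 1)" using d by (cases d) auto
      thus ?thesis using x d
        by (auto intro!: derivative_eq_intros simp: field_simps power2_eq_square)
    qed
    show "0 \<le> 1 / x ^ Suc d" if "a \<le> x" for x using that a by simp
    have "filterlim (\<lambda>l::real. real d * l ^ d) at_top at_top"
      using d by (intro filterlim_tendsto_pos_mult_at_top[OF tendsto_const] filterlim_pow_at_top filterlim_ident) auto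
    thus "((\<lambda>l. - 1 / (real d * l ^ d)) \<longlongrightarrow> 0) at_top"
      by (intro tendsto_divide_0[OF tendsto_const] filterlim_at_top_imp_at_infinity)
  qed simp
  thus ?thesis by simp
qed

text \<open>Polar coordinates without a measure on the sphere: the direction is taken from a uniformly
  distributed point \<open>v\<close> of the unit ball.\<close>

lemma nn_integral_polar:
  fixes g :: "'a::euclidean_space \<Rightarrow> ennreal"
  assumes g[measurable]: "g \<in> borel_measurable borel"
  shows "(\<integral>\<^sup>+x. g x \<partial>lborel) = ennreal (real DIM('a)) *
    (\<integral>\<^sup>+v. indicator (cball 0 1) v * (\<integral>\<^sup>+\<rho>. indicator {0<..} \<rho> * (ennreal (\<rho> ^ (DIM('a) - 1)) * g (\<rho> *\<^sub>R (v /\<^sub>R norm v))) \<partial>lborel) \<partial>lborel)"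
proof -
  let ?d = "DIM('a)"
  have d: "?d > 0" by simp
  \<comment> \<open>The radial integral after \<open>\<rho> = l * norm v\<close>. Substituting
    \<open>x = l v\<close> at fixed \<open>l\<close> leaves the weight
    \<open>norm x ^ d / l ^ (d + 1)\<close> on \<open>l \<ge> norm x\<close>, whose integral over
    \<open>l\<close> is \<open>1 / d\<close>.\<close>
  define W where "W v l = indicator (cball (0::'a) 1) v * (indicator {0<..} l * (ennreal (norm v ^ ?d * l ^ (?d - 1)) * g (l *\<^sub>R v)))" for v and l :: real
  have Wm[measurable]: "case_prod W \<in> borel_measurable (borel \<Otimes>\<^sub>M borel)"
    unfolding W_def case_prod_unfold by measurable
  have "(\<integral>\<^sup>+v. indicator (cball 0 1) v * (\<integral>\<^sup>+\<rho>. indicator {0<..} \<rho> * (ennreal (\<rho> ^ (?d - 1)) * g (\<rho> *\<^sub>R (v /\<^sub>R norm v))) \<partial>lborel) \<partial>lborel)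
     = (\<integral>\<^sup>+v. (\<integral>\<^sup>+l. W v l \<partial>lborel) \<partial>lborel)"
  proof (rule nn_integral_cong_AE, rule AE_mp[OF AE_lborel_singleton[of 0]], intro AE_I2 impI)
    fix v :: 'a assume "v \<noteq> 0"
    hence v: "norm v > 0" by simp
    have "(\<integral>\<^sup>+\<rho>. indicator {0<..} \<rho> * (ennreal (\<rho> ^ (?d - 1)) * g (\<rho> *\<^sub>R (v /\<^sub>R norm v))) \<partial>lborel)
      = ennreal \<bar>norm v\<bar> * (\<integral>\<^sup>+l. indicator {0<..} (0 + norm v * l) * (ennreal ((0 + norm v * l) ^ (?d - 1)) * g ((0 + norm v * l) *\<^sub>R (v /\<^sub>R norm v))) \<partial>lborel)"
      using v by (intro nn_integral_real_affine) auto
    also have "\<dots> = (\<integral>\<^sup>+l. ennreal \<bar>norm v\<bar> * (indicator {0<..} (0 + norm v * l) * (ennreal ((0 + norm v * l) ^ (?d - 1)) * g ((0 + norm v * l) *\<^sub>R (v /\<^sub>R norm v)))) \<partial>lborel)"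
      by (rule nn_integral_cmult[symmetric]) measurable
    also have "\<dots> = (\<integral>\<^sup>+l. indicator {0<..} l * (ennreal (norm v ^ ?d * l ^ (?d - 1)) * g (l *\<^sub>R v)) \<partial>lborel)"
    proof (rule nn_integral_cong)
      fix l :: real
      have "norm v ^ ?d = norm v * norm v ^ (?d - 1)" using d by (metis power_minus_mult mult.commute)
      thus "ennreal \<bar>norm v\<bar> * (indicator {0<..} (0 + norm v * l) * (ennreal ((0 + norm v * l) ^ (?d - 1)) * g ((0 + norm v * l) *\<^sub>R (v /\<^sub>R norm v))))
         = indicator {0<..} l * (ennreal (norm v ^ ?d * l ^ (?d - 1)) * g (l *\<^sub>R v))"
        using v by (auto simp: indicator_def zero_less_mult_iff power_mult_distrib ennreal_mult mult_ac)
    qed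
    finally have *: "(\<integral>\<^sup>+\<rho>. indicator {0<..} \<rho> * (ennreal (\<rho> ^ (?d - 1)) * g (\<rho> *\<^sub>R (v /\<^sub>R norm v))) \<partial>lborel) = \<dots>" .
    show "indicator (cball 0 1) v * (\<integral>\<^sup>+\<rho>. indicator {0<..} \<rho> * (ennreal (\<rho> ^ (?d - 1)) * g (\<rho> *\<^sub>R (v /\<^sub>R norm v))) \<partial>lborel)
       = (\<integral>\<^sup>+l. W v l \<partial>lborel)"
      unfolding * W_def by (rule nn_integral_cmult[symmetric]) measurable
  qed
  also have "\<dots> = (\<integral>\<^sup>+l. (\<integral>\<^sup>+v. W v l \<partial>lborel) \<partial>lborel)"
    by (rule lborel_pair.Fubini'[symmetric]) simp
  also have "\<dots> = (\<integral>\<^sup>+l. (\<integral>\<^sup>+x. (ennreal (1 / l ^ Suc ?d) * indicator {norm x..} l) * (indicator {0<..} l * (ennreal (norm x ^ ?d) * g x)) \<partial>lborel) \<partial>lborel)"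
  proof (rule nn_integral_cong)
    fix l :: real
    show "(\<integral>\<^sup>+v. W v l \<partial>lborel) = (\<integral>\<^sup>+x. (ennreal (1 / l ^ Suc ?d) * indicator {norm x..} l) * (indicator {0<..} l * (ennreal (norm x ^ ?d) * g x)) \<partial>lborel)"
    proof (cases "l > 0")
      case True
      have "(\<integral>\<^sup>+v. W v l \<partial>lborel) = ennreal (\<bar>1 / l\<bar> ^ ?d) * (\<integral>\<^sup>+x. W (0 + (1 / l) *\<^sub>R x) l \<partial>lborel)"
        using True by (intro nn_integral_lborel_affine) auto
      also have "\<dots> = (\<integral>\<^sup>+x. ennreal (\<bar>1 / l\<bar> ^ ?d) * W (0 + (1 / l) *\<^sub>R x) l \<partial>lborel)"
        by (rule nn_integral_cmult[symmetric]) measurable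
      also have "\<dots> = (\<integral>\<^sup>+x. (ennreal (1 / l ^ Suc ?d) * indicator {norm x..} l) * (indicator {0<..} l * (ennreal (norm x ^ ?d) * g x)) \<partial>lborel)"
      proof (rule nn_integral_cong)
        fix x :: 'a
        have i: "indicator (cball (0::'a) 1) (0 + (1 / l) *\<^sub>R x) = (indicator {norm x..} l :: ennreal)"
          using True by (auto simp: indicator_def divide_le_eq)
        have "l ^ ?d = l * l ^ (?d - 1)" using d by (metis power_minus_mult mult.commute)
        hence "\<bar>1 / l\<bar> ^ ?d * (norm ((1 / l) *\<^sub>R x) ^ ?d * l ^ (?d - 1)) = 1 / l ^ Suc ?d * norm x ^ ?d"
          using True by (simp add: power_mult_distrib power_divide field_simps)
        hence "ennreal (\<bar>1 / l\<bar> ^ ?d) * ennreal (norm ((1 / l) *\<^sub>R x) ^ ?d * l ^ (?d - 1)) = ennreal (1 / l ^ Suc ?d) * ennreal (norm x ^ ?d)"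
          using True by (simp add: ennreal_mult[symmetric])
        thus "ennreal (\<bar>1 / l\<bar> ^ ?d) * W (0 + (1 / l) *\<^sub>R x) l = (ennreal (1 / l ^ Suc ?d) * indicator {norm x..} l) * (indicator {0<..} l * (ennreal (norm x ^ ?d) * g x))"
          unfolding W_def i using True by (simp add: mult_ac)
      qed
      finally show ?thesis .
    qed (simp add: W_def)
  qed
  also have "\<dots> = (\<integral>\<^sup>+x. (\<integral>\<^sup>+l. (ennreal (1 / l ^ Suc ?d) * indicator {norm x..} l) * (indicator {0<..} l * (ennreal (norm x ^ ?d) * g x)) \<partial>lborel) \<partial>lborel)"
  proof (rule lborel_pair.Fubini')
    have "(\<lambda>p::'a \<times> real. (ennreal (1 / snd p ^ Suc ?d) * (if norm (fst p) \<le> snd p then 1 else 0)) * (indicator {0<..} (snd p) * (ennreal (norm (fst p) ^ ?d) * g (fst p)))) \<in> borel_measurable (lborel \<Otimes>\<^sub>M lborel)"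
      by measurable
    moreover have "indicator {norm x..} l = (if norm x \<le> l then 1 else 0 :: ennreal)" for x :: 'a and l
      by (simp add: indicator_def)
    ultimately show "(\<lambda>(x, l). (ennreal (1 / l ^ Suc ?d) * indicator {norm x..} l) * (indicator {0<..} l * (ennreal (norm x ^ ?d) * g x))) \<in> borel_measurable (lborel \<Otimes>\<^sub>M lborel)"
      by (simp add: case_prod_unfold)
  qed
  also have "\<dots> = (\<integral>\<^sup>+x. ennreal (1 / real ?d) * g x \<partial>lborel)"
  proof (rule nn_integral_cong_AE, rule AE_mp[OF AE_lborel_singleton[of 0]], intro AE_I2 impI)
    fix x :: 'a assume "x \<noteq> 0"
    hence x: "norm x > 0" by simp
    have "(\<integral>\<^sup>+l. (ennreal (1 / l ^ Suc ?d) * indicator {norm x..} l) * (indicator {0<..} l * (ennreal (norm x ^ ?d) * g x)) \<partial>lborel)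
      = (\<integral>\<^sup>+l. (ennreal (1 / l ^ Suc ?d) * indicator {norm x..} l) * (ennreal (norm x ^ ?d) * g x) \<partial>lborel)"
    proof (rule nn_integral_cong)
      fix l
      have "\<not> norm x \<le> l \<or> l > 0" using x by linarith
      thus "(ennreal (1 / l ^ Suc ?d) * indicator {norm x..} l) * (indicator {0<..} l * (ennreal (norm x ^ ?d) * g x))
        = (ennreal (1 / l ^ Suc ?d) * indicator {norm x..} l) * (ennreal (norm x ^ ?d) * g x)"
        by auto
    qed
    also have "\<dots> = ennreal (1 / (real ?d * norm x ^ ?d)) * (ennreal (norm x ^ ?d) * g x)"
      by (subst nn_integral_multc, measurable, subst nn_integral_powr_tail[OF x d]) simp
    also have "\<dots> = ennreal (1 / real ?d) * g x"
      using x by (simp add: mult.assoc[symmetric] ennreal_mult[symmetric])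
    finally show "(\<integral>\<^sup>+l. (ennreal (1 / l ^ Suc ?d) * indicator {norm x..} l) * (indicator {0<..} l * (ennreal (norm x ^ ?d) * g x)) \<partial>lborel)
      = ennreal (1 / real ?d) * g x" .
  qed
  also have "\<dots> = ennreal (1 / real ?d) * (\<integral>\<^sup>+x. g x \<partial>lborel)" by (rule nn_integral_cmult) simp
  finally have *: "(\<integral>\<^sup>+v. indicator (cball 0 1) v * (\<integral>\<^sup>+\<rho>. indicator {0<..} \<rho> * (ennreal (\<rho> ^ (?d - 1)) * g (\<rho> *\<^sub>R (v /\<^sub>R norm v))) \<partial>lborel) \<partial>lborel)
     = ennreal (1 / real ?d) * (\<integral>\<^sup>+x. g x \<partial>lborel)" .
  have "ennreal (real ?d) * (ennreal (1 / real ?d) * (\<integral>\<^sup>+x. g x \<partial>lborel)) = (\<integral>\<^sup>+x. g x \<partial>lborel)"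
    unfolding mult.assoc[symmetric] by (subst ennreal_mult[symmetric]) (use d in simp_all)
  thus ?thesis unfolding * by simp
qed

text \<open>As a function of \<open>w\<close> the integral is invariant under rotations and
  homogeneous of degree 2, hence a multiple of \<open>(norm w)^2\<close>. Summing over an
  orthonormal basis fixes the multiple, as the squared coordinates of a unit vector add up to
  1.\<close>

lemma direction_second_moment:
  fixes w :: "'a::euclidean_space"
  shows "(\<integral>\<^sup>+v. indicator (cball 0 1) v * ennreal (((v /\<^sub>R norm v) \<bullet> w)\<^sup>2) \<partial>lborel)
    = ennreal ((norm w)\<^sup>2 * unit_ball_vol (DIM('a)) / DIM('a))"
proof -
  define \<Phi> where "\<Phi> w = (\<integral>\<^sup>+v. indicator (cball 0 1) v * ennreal (((v /\<^sub>R norm v) \<bullet> w)\<^sup>2) \<partial>lborel)" for w :: 'a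
  have orth: "\<Phi> (f w) = \<Phi> w" if f: "orthogonal_transformation f" for f w
  proof -
    have [measurable]: "f \<in> borel_measurable borel" using f by measurable
    have "\<Phi> (f w) = (\<integral>\<^sup>+v. indicator (cball 0 1) (f v) * ennreal (((f v /\<^sub>R norm (f v)) \<bullet> f w)\<^sup>2) \<partial>lborel)"
      unfolding \<Phi>_def by (subst distr_lborel_orthogonal[OF f, symmetric], subst nn_integral_distr) auto
    also have "\<dots> = \<Phi> w"
      unfolding \<Phi>_def using f by (simp add: orthogonal_transformation_norm[OF f] indicator_def orthogonal_transformation_def)
    finally show ?thesis .
  qed
  have scale: "\<Phi> (c *\<^sub>R w) = ennreal (c\<^sup>2) * \<Phi> w" for c w
    unfolding \<Phi>_def by (subst nn_integral_cmult[symmetric]) (auto intro!: nn_integral_cong simp: power_mult_distrib ennreal_mult mult_ac)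
  obtain b :: 'a where b: "b \<in> Basis" using nonempty_Basis by blast
  have eq: "\<Phi> c = \<Phi> b" if "c \<in> Basis" for c
    using orthogonal_transformation_exists[of b c] b that orth by (metis norm_Basis)
  have "(\<Sum>c\<in>Basis. \<Phi> c) = (\<integral>\<^sup>+v. (\<Sum>c\<in>Basis. indicator (cball (0::'a) 1) v * ennreal (((v /\<^sub>R norm v) \<bullet> c)\<^sup>2)) \<partial>lborel)"
    by (subst nn_integral_sum) (auto simp: \<Phi>_def)
  also have "\<dots> = (\<integral>\<^sup>+v. indicator (cball (0::'a) 1) v \<partial>lborel)"
  proof (rule nn_integral_cong_AE, rule AE_mp[OF AE_lborel_singleton[of 0]], intro AE_I2 impI)
    fix v :: 'a assume v: "v \<noteq> 0"
    have "(\<Sum>c\<in>Basis. ennreal (((v /\<^sub>R norm v) \<bullet> c)\<^sup>2)) = ennreal (\<Sum>c\<in>Basis. ((v /\<^sub>R norm v) \<bullet> c)\<^sup>2)"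
      by (rule sum_ennreal) simp
    also have "(\<Sum>c\<in>Basis. ((v /\<^sub>R norm v) \<bullet> c)\<^sup>2) = (v /\<^sub>R norm v) \<bullet> (v /\<^sub>R norm v)"
      by (subst euclidean_inner) (simp add: power2_eq_square)
    also have "\<dots> = 1" using v by (simp add: power2_norm_eq_inner[symmetric] power2_eq_square)
    finally show "(\<Sum>c\<in>Basis. indicator (cball 0 1) v * ennreal (((v /\<^sub>R norm v) \<bullet> c)\<^sup>2)) = indicator (cball 0 1) v"
      by (simp add: sum_distrib_left[symmetric])
  qed
  also have "\<dots> = ennreal (unit_ball_vol (DIM('a)))" by (simp add: emeasure_cball)
  finally have "of_nat DIM('a) * \<Phi> b = ennreal (unit_ball_vol (DIM('a)))" using eq by simp
  hence "ennreal (1 / DIM('a)) * (ennreal (DIM('a)) * \<Phi> b) = ennreal (1 / DIM('a)) * ennreal (unit_ball_vol (DIM('a)))"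
    by (simp add: ennreal_of_nat_eq_real_of_nat)
  hence pb: "\<Phi> b = ennreal (unit_ball_vol (DIM('a)) / DIM('a))"
    unfolding mult.assoc[symmetric] by (simp add: ennreal_mult[symmetric])
  obtain f where f: "orthogonal_transformation f" "f (norm w *\<^sub>R b) = w"
    using orthogonal_transformation_exists[of "norm w *\<^sub>R b" w] b by auto
  have "\<Phi> w = \<Phi> (norm w *\<^sub>R b)" using orth[OF f(1), of "norm w *\<^sub>R b"] f(2) by simp
  also have "\<dots> = ennreal ((norm w)\<^sup>2 * unit_ball_vol (DIM('a)) / DIM('a))"
    unfolding scale pb by (subst ennreal_mult[symmetric]) auto
  finally show ?thesis unfolding \<Phi>_def .
qed

section \<open>The deficit along a direction\<close>

lemma square_integrable_mult:
  fixes u v :: "'c \<Rightarrow> complex"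
  assumes [measurable]: "u \<in> borel_measurable N" "v \<in> borel_measurable N"
    and iu: "integrable N (\<lambda>z. (cmod (u z))\<^sup>2)" and iv: "integrable N (\<lambda>z. (cmod (v z))\<^sup>2)"
  shows "integrable N (\<lambda>z. u z * cnj (v z))"
proof (rule Bochner_Integration.integrable_bound[OF Bochner_Integration.integrable_add[OF iu iv]])
  have "cmod a * cmod b \<le> (cmod a)\<^sup>2 + (cmod b)\<^sup>2" for a b :: complex
    using sum_squares_bound[of "cmod a" "cmod b"]
      mult_nonneg_nonneg[OF norm_ge_zero norm_ge_zero, of a b] by linarith
  thus "AE z in N. norm (u z * cnj (v z)) \<le> norm ((cmod (u z))\<^sup>2 + (cmod (v z))\<^sup>2)"
    by (auto simp: norm_mult)
qed measurable

text \<open>Expanding the square, the cross term factorises into the pairing of \<open>u\<close> and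
  \<open>v\<close> times its conjugate. The defect of Cauchy-Schwarz stands on the left as a
  summand, so that the identity survives multiplication by weights and integration in
  \<open>ennreal\<close>.\<close>

lemma lagrange_identity:
  fixes u v :: "'c \<Rightarrow> complex"
  assumes m[measurable]: "u \<in> borel_measurable N" "v \<in> borel_measurable N"
    and iu: "integrable N (\<lambda>z. (cmod (u z))\<^sup>2)" and iv: "integrable N (\<lambda>z. (cmod (v z))\<^sup>2)"
  shows "ennreal ((cmod (LINT z|N. u z * cnj (v z)))\<^sup>2)
      + ennreal (1 / 2) * (\<integral>\<^sup>+z. (\<integral>\<^sup>+z'. ennreal ((cmod (u z * v z' - v z * u z'))\<^sup>2) \<partial>N) \<partial>N)
    = (\<integral>\<^sup>+z. ennreal ((cmod (u z))\<^sup>2) \<partial>N) * (\<integral>\<^sup>+z. ennreal ((cmod (v z))\<^sup>2) \<partial>N)"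
proof -
  define p where "p z = u z * cnj (v z)" for z
  define U where "U = (LINT z|N. (cmod (u z))\<^sup>2)"
  define V where "V = (LINT z|N. (cmod (v z))\<^sup>2)"
  define P where "P = (LINT z|N. p z)"
  have U0: "U \<ge> 0" and V0: "V \<ge> 0" by (auto simp: U_def V_def)
  have ip: "integrable N p" unfolding p_def by (rule square_integrable_mult[OF m iu iv])
  have ip': "integrable N (\<lambda>z. Re (c * cnj (p z)))" for c
    by (intro integrable_Re integrable_mult_right Bochner_Integration.integrable_cnj ip)
  have lp': "(LINT z|N. Re (c * cnj (p z))) = Re (c * cnj P)" for c
    by (subst integral_Re) (auto simp: P_def ip intro!: integrable_mult_right)
  have e: "(cmod (u z * v z' - v z * u z'))\<^sup>2
     = (cmod (u z))\<^sup>2 * (cmod (v z'))\<^sup>2 + (cmod (v z))\<^sup>2 * (cmod (u z'))\<^sup>2 - 2 * Re (p z * cnj (p z'))" for z z'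
    using cmod_add_sq[of "u z * v z'" "-1" "v z * u z'"]
    by (simp add: norm_mult power_mult_distrib p_def mult_ac)
  have i: "integrable N (\<lambda>z'. (cmod (u z * v z' - v z * u z'))\<^sup>2)" for z
    unfolding e by (intro Bochner_Integration.integrable_diff Bochner_Integration.integrable_add integrable_mult_right iu iv ip')
  have l: "(LINT z'|N. (cmod (u z * v z' - v z * u z'))\<^sup>2) = (cmod (u z))\<^sup>2 * V + (cmod (v z))\<^sup>2 * U - 2 * Re (cnj P * p z)" for z
    unfolding e mult.commute[of "cnj P"]
    by (subst Bochner_Integration.integral_diff, intro Bochner_Integration.integrable_add integrable_mult_right iu iv,
        intro integrable_mult_right ip',
        subst Bochner_Integration.integral_add, (intro integrable_mult_right iu iv)+)
       (simp only: integral_mult_right_zero lp' U_def V_def)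
  have inner: "(\<integral>\<^sup>+z'. ennreal ((cmod (u z * v z' - v z * u z'))\<^sup>2) \<partial>N)
     = ennreal ((cmod (u z))\<^sup>2 * V + (cmod (v z))\<^sup>2 * U - 2 * Re (cnj P * p z))" for z
    unfolding l[symmetric] by (rule nn_integral_eq_integral[OF i]) auto
  have n: "(cmod (u z))\<^sup>2 * V + (cmod (v z))\<^sup>2 * U - 2 * Re (cnj P * p z) \<ge> 0" for z
    unfolding l[symmetric] by (rule Bochner_Integration.integral_nonneg) simp
  have ic: "integrable N (\<lambda>z. Re (cnj P * p z))" by (intro integrable_Re integrable_mult_right ip)
  have lc: "(LINT z|N. Re (cnj P * p z)) = (cmod P)\<^sup>2"
  proof -
    have "(LINT z|N. Re (cnj P * p z)) = Re (cnj P * P)"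
      by (subst integral_Re) (auto simp: P_def ip intro!: integrable_mult_right)
    also have "\<dots> = (cmod P)\<^sup>2" by (simp only: cmod_power2) (simp add: power2_eq_square)
    finally show ?thesis .
  qed
  have "(\<integral>\<^sup>+z. (\<integral>\<^sup>+z'. ennreal ((cmod (u z * v z' - v z * u z'))\<^sup>2) \<partial>N) \<partial>N)
     = ennreal (LINT z|N. (cmod (u z))\<^sup>2 * V + (cmod (v z))\<^sup>2 * U - 2 * Re (cnj P * p z))"
    unfolding inner using n
    by (intro nn_integral_eq_integral Bochner_Integration.integrable_diff Bochner_Integration.integrable_add
        integrable_mult_right integrable_mult_left iu iv ic) auto
  also have "(LINT z|N. (cmod (u z))\<^sup>2 * V + (cmod (v z))\<^sup>2 * U - 2 * Re (cnj P * p z)) = U * V + V * U - 2 * (cmod P)\<^sup>2"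
    by (subst Bochner_Integration.integral_diff, intro Bochner_Integration.integrable_add integrable_mult_left iu iv,
        intro integrable_mult_right ic,
        subst Bochner_Integration.integral_add, (intro integrable_mult_left iu iv)+)
       (simp only: integral_mult_right_zero integral_mult_left_zero lc U_def V_def)
  finally have D: "(\<integral>\<^sup>+z. (\<integral>\<^sup>+z'. ennreal ((cmod (u z * v z' - v z * u z'))\<^sup>2) \<partial>N) \<partial>N) = ennreal (2 * (U * V - (cmod P)\<^sup>2))"
    by (simp add: algebra_simps)
  have "(LINT z|N. (cmod (u z))\<^sup>2 * V + (cmod (v z))\<^sup>2 * U - 2 * Re (cnj P * p z)) \<ge> 0"
    by (intro Bochner_Integration.integral_nonneg n)
  hence C: "U * V - (cmod P)\<^sup>2 \<ge> 0"
    unfolding \<open>(LINT z|N. (cmod (u z))\<^sup>2 * V + (cmod (v z))\<^sup>2 * U - 2 * Re (cnj P * p z)) = U * V + V * U - 2 * (cmod P)\<^sup>2\<close>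
    by (simp add: algebra_simps)
  have uv: "(\<integral>\<^sup>+z. ennreal ((cmod (u z))\<^sup>2) \<partial>N) = ennreal U" "(\<integral>\<^sup>+z. ennreal ((cmod (v z))\<^sup>2) \<partial>N) = ennreal V"
    unfolding U_def V_def by (auto intro!: nn_integral_eq_integral iu iv)
  have "ennreal (1 / 2) * ennreal (2 * (U * V - (cmod P)\<^sup>2)) = ennreal (U * V - (cmod P)\<^sup>2)"
    using C by (subst ennreal_mult[symmetric]) auto
  thus ?thesis
    unfolding D uv using C U0 V0
    by (simp add: p_def[symmetric] P_def[symmetric] ennreal_plus[symmetric] ennreal_mult[symmetric] del: ennreal_plus)
qed

text \<open>Lagrange's identity for the slices at heights \<open>s\<close> and \<open>r\<close>
  along \<open>\<omega>\<close>, integrated against \<open>(s - r)^2\<close>. Since \<open>f\<close>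
  is only square integrable, the right-hand side may be infinite.\<close>

theorem directional_identity:
  fixes f :: "'a::euclidean_space \<Rightarrow> complex"
  assumes w: "norm \<omega> = 1" and f: "f \<in> L2"
  shows "(\<integral>\<^sup>+\<rho>. indicator {0<..} \<rho> * (ennreal (\<rho>\<^sup>2) * (\<integral>\<^sup>+\<tau>. ennreal ((cmod (LINT \<eta>|lborel.
        exp (- \<i> * complex_of_real (\<tau> * (\<omega> \<bullet> \<eta>))) * (f (\<rho> *\<^sub>R \<omega> + \<eta>) * cnj (f \<eta>))))\<^sup>2) \<partial>lborel)) \<partial>lborel)
    + ennreal (pi / 2) * (\<integral>\<^sup>+x. (\<integral>\<^sup>+y. ennreal ((\<omega> \<bullet> (x - y))\<^sup>2 *
        (cmod (f x * f y - f (x - (\<omega> \<bullet> (x - y)) *\<^sub>R \<omega>) * f (y + (\<omega> \<bullet> (x - y)) *\<^sub>R \<omega>)))\<^sup>2) \<partial>lborel) \<partial>lborel)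
    = ennreal pi * (\<integral>\<^sup>+x. (\<integral>\<^sup>+y. ennreal ((\<omega> \<bullet> (x - y))\<^sup>2 * ((cmod (f x))\<^sup>2 * (cmod (f y))\<^sup>2)) \<partial>lborel) \<partial>lborel)"
proof -
  have fm[measurable]: "f \<in> borel_measurable borel" using f by measurable
  have ww: "\<omega> \<bullet> \<omega> = 1" using w by (simp add: norm_eq_sqrt_inner)
  obtain N :: "('a \<Rightarrow> real) measure" and \<psi> where sf: "sigma_finite_measure N"
    and \<psi>[measurable]: "\<psi> \<in> N \<rightarrow>\<^sub>M borel" and perp: "\<And>z. \<omega> \<bullet> \<psi> z = 0"
    and D: "distr (lborel \<Otimes>\<^sub>M N) borel (\<lambda>(r, z). r *\<^sub>R \<omega> + \<psi> z) = lborel"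
    using hyperplane_decomposition[OF w] by metis
  interpret N: sigma_finite_measure N by fact
  interpret P: pair_sigma_finite "lborel :: real measure" N ..
  interpret P': pair_sigma_finite N "lborel :: real measure" ..
  have Em[measurable]: "(\<lambda>(r, z). r *\<^sub>R \<omega> + \<psi> z) \<in> (lborel \<Otimes>\<^sub>M N) \<rightarrow>\<^sub>M borel"
    by (simp add: case_prod_unfold)
  have dec: "(\<integral>\<^sup>+x. g x \<partial>lborel) = (\<integral>\<^sup>+r. (\<integral>\<^sup>+z. g (r *\<^sub>R \<omega> + \<psi> z) \<partial>N) \<partial>lborel)"
    if [measurable]: "g \<in> borel_measurable borel" for g :: "'a \<Rightarrow> ennreal"
  proof -
    have "(\<integral>\<^sup>+x. g x \<partial>lborel) = (\<integral>\<^sup>+p. g (case p of (r, z) \<Rightarrow> r *\<^sub>R \<omega> + \<psi> z) \<partial>(lborel \<Otimes>\<^sub>M N))"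
      by (subst D[symmetric], subst nn_integral_distr) auto
    also have "\<dots> = (\<integral>\<^sup>+r. (\<integral>\<^sup>+z. g (r *\<^sub>R \<omega> + \<psi> z) \<partial>N) \<partial>lborel)"
      by (subst N.nn_integral_fst[symmetric]) auto
    finally show ?thesis .
  qed
  \<comment> \<open>The two heights are moved outside and the two hyperplane variables inside, the
    order in which Lagrange's identity is applied.\<close>
  have dec2: "(\<integral>\<^sup>+x. (\<integral>\<^sup>+y. G x y \<partial>lborel) \<partial>lborel)
      = (\<integral>\<^sup>+s. (\<integral>\<^sup>+r. (\<integral>\<^sup>+z. (\<integral>\<^sup>+z'. G (s *\<^sub>R \<omega> + \<psi> z) (r *\<^sub>R \<omega> + \<psi> z') \<partial>N) \<partial>N) \<partial>lborel) \<partial>lborel)"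
    if Gm[measurable]: "(\<lambda>p. G (fst p) (snd p)) \<in> borel_measurable (borel \<Otimes>\<^sub>M borel)" for G :: "'a \<Rightarrow> 'a \<Rightarrow> ennreal"
  proof -

    have "(\<integral>\<^sup>+x. (\<integral>\<^sup>+y. G x y \<partial>lborel) \<partial>lborel) = (\<integral>\<^sup>+s. (\<integral>\<^sup>+z. (\<integral>\<^sup>+y. G (s *\<^sub>R \<omega> + \<psi> z) y \<partial>lborel) \<partial>N) \<partial>lborel)"
    proof (rule dec)
      have "(\<lambda>(x, y). G x y) \<in> borel_measurable (borel \<Otimes>\<^sub>M lborel)" using Gm by (simp add: case_prod_unfold cong: measurable_cong_sets)
      thus "(\<lambda>x. \<integral>\<^sup>+y. G x y \<partial>lborel) \<in> borel_measurable borel" by (rule lborel.borel_measurable_nn_integral)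
    qed
    also have "\<dots> = (\<integral>\<^sup>+s. (\<integral>\<^sup>+z. (\<integral>\<^sup>+r. (\<integral>\<^sup>+z'. G (s *\<^sub>R \<omega> + \<psi> z) (r *\<^sub>R \<omega> + \<psi> z') \<partial>N) \<partial>lborel) \<partial>N) \<partial>lborel)"
    proof (rule nn_integral_cong, rule nn_integral_cong)
      fix s z
      have "(\<lambda>y. (s *\<^sub>R \<omega> + \<psi> z, y)) \<in> borel \<rightarrow>\<^sub>M (borel \<Otimes>\<^sub>M borel)" by measurable
      from measurable_compose[OF this Gm]
      have "G (s *\<^sub>R \<omega> + \<psi> z) \<in> borel_measurable borel" by simp
      from dec[OF this]
      show "(\<integral>\<^sup>+y. G (s *\<^sub>R \<omega> + \<psi> z) y \<partial>lborel) = (\<integral>\<^sup>+r. (\<integral>\<^sup>+z'. G (s *\<^sub>R \<omega> + \<psi> z) (r *\<^sub>R \<omega> + \<psi> z') \<partial>N) \<partial>lborel)" .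
    qed
    also have "\<dots> = (\<integral>\<^sup>+s. (\<integral>\<^sup>+r. (\<integral>\<^sup>+z. (\<integral>\<^sup>+z'. G (s *\<^sub>R \<omega> + \<psi> z) (r *\<^sub>R \<omega> + \<psi> z') \<partial>N) \<partial>N) \<partial>lborel) \<partial>lborel)"
    proof (rule nn_integral_cong, rule P.Fubini')
      fix s
      have "(\<lambda>q. (s *\<^sub>R \<omega> + \<psi> (snd (fst q)), fst (fst q) *\<^sub>R \<omega> + \<psi> (snd q))) \<in> ((lborel \<Otimes>\<^sub>M N) \<Otimes>\<^sub>M N) \<rightarrow>\<^sub>M (borel \<Otimes>\<^sub>M borel)"
        by measurable
      from measurable_compose[OF this Gm]
      have "(\<lambda>(x, z'). case x of (r, z) \<Rightarrow> G (s *\<^sub>R \<omega> + \<psi> z) (r *\<^sub>R \<omega> + \<psi> z')) \<in> borel_measurable ((lborel \<Otimes>\<^sub>M N) \<Otimes>\<^sub>M N)"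
        by (simp add: case_prod_unfold)
      from N.borel_measurable_nn_integral[OF this]
      show "(\<lambda>(r, z). \<integral>\<^sup>+z'. G (s *\<^sub>R \<omega> + \<psi> z) (r *\<^sub>R \<omega> + \<psi> z') \<partial>N) \<in> borel_measurable (lborel \<Otimes>\<^sub>M N)"
        by (simp add: case_prod_unfold)
    qed
    finally show ?thesis .
  qed
  define \<phi> where "\<phi> r z = f (r *\<^sub>R \<omega> + \<psi> z)" for r z
  have \<phi>m[measurable]: "case_prod \<phi> \<in> borel_measurable (borel \<Otimes>\<^sub>M N)"
    unfolding \<phi>_def case_prod_unfold by measurable
  have \<phi>m1[measurable]: "\<phi> r \<in> borel_measurable N" for r unfolding \<phi>_def by measurable
  define m where "m r = (\<integral>\<^sup>+z. ennreal ((cmod (\<phi> r z))\<^sup>2) \<partial>N)" for r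
  have mm[measurable]: "m \<in> borel_measurable borel" unfolding m_def[abs_def] by measurable
  have intm: "(\<integral>\<^sup>+r. m r \<partial>lborel) = ennreal (nsq f)"
    unfolding m_def \<phi>_def nn_integral_nsq[OF f, symmetric] by (rule dec[symmetric]) measurable
  have mfin: "AE r in lborel. m r < \<infinity>"
    using nn_integral_PInf_AE[of m lborel] intm by (auto simp: less_top)
  have iphi: "integrable N (\<lambda>z. (cmod (\<phi> r z))\<^sup>2)" if "m r < \<infinity>" for r
    using that by (auto simp: integrable_iff_bounded m_def)
  define M where "M s r = (LINT z|N. \<phi> s z * cnj (\<phi> r z))" for s r
  have Mm[measurable]: "case_prod M \<in> borel_measurable (borel \<Otimes>\<^sub>M borel)"
    unfolding M_def case_prod_unfold by measurable
  define L where "L s r = (\<integral>\<^sup>+z. (\<integral>\<^sup>+z'. ennreal ((cmod (\<phi> s z * \<phi> r z' - \<phi> r z * \<phi> s z'))\<^sup>2) \<partial>N) \<partial>N)" for s r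
  have Lm[measurable]: "case_prod L \<in> borel_measurable (borel \<Otimes>\<^sub>M borel)"
    unfolding L_def case_prod_unfold by measurable
  define K where "K s r = ennreal ((cmod (M s r))\<^sup>2)" for s r
  have Km[measurable]: "case_prod K \<in> borel_measurable (borel \<Otimes>\<^sub>M borel)"
    unfolding K_def case_prod_unfold by measurable
  have Ksym: "K s r = K r s" for s r
  proof -
    have "M s r = cnj (M r s)" unfolding M_def by (subst Bochner_Integration.integral_cnj[symmetric]) (simp add: mult.commute)
    thus ?thesis by (simp add: K_def)
  qed
  have lag: "K s r + ennreal (1 / 2) * L s r = m s * m r" if "m s < \<infinity>" "m r < \<infinity>" for s r
    unfolding K_def M_def L_def m_def by (intro lagrange_identity iphi that) measurable
  \<comment> \<open>A slice of a square integrable function is square integrable only at almost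
    every height, so Lagrange's identity is available off a null set of pairs.\<close>
  have AE2: "AE s in lborel. AE r in lborel. m s < \<infinity> \<and> m r < \<infinity>"
    using mfin by (auto elim!: AE_mp)

  define h where "h \<rho> = (\<integral>\<^sup>+r. K (\<rho> + r) r \<partial>lborel)" for \<rho>
  have hm[measurable]: "h \<in> borel_measurable borel" unfolding h_def[abs_def] by measurable
  have hint: "(\<integral>\<^sup>+\<rho>. c \<rho> * h \<rho> \<partial>lborel) = (\<integral>\<^sup>+s. (\<integral>\<^sup>+r. c (s - r) * K s r \<partial>lborel) \<partial>lborel)"
    if [measurable]: "c \<in> borel_measurable borel" for c :: "real \<Rightarrow> ennreal"
  proof -
    have "(\<integral>\<^sup>+\<rho>. c \<rho> * h \<rho> \<partial>lborel) = (\<integral>\<^sup>+\<rho>. (\<integral>\<^sup>+r. c \<rho> * K (\<rho> + r) r \<partial>lborel) \<partial>lborel)"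
      unfolding h_def by (intro nn_integral_cong nn_integral_cmult[symmetric]) measurable
    also have "\<dots> = (\<integral>\<^sup>+r. (\<integral>\<^sup>+\<rho>. c \<rho> * K (\<rho> + r) r \<partial>lborel) \<partial>lborel)"
      by (rule lborel_pair.Fubini'[symmetric]) measurable
    also have "\<dots> = (\<integral>\<^sup>+r. (\<integral>\<^sup>+s. c (s - r) * K s r \<partial>lborel) \<partial>lborel)"
    proof (rule nn_integral_cong)
      fix r
      show "(\<integral>\<^sup>+\<rho>. c \<rho> * K (\<rho> + r) r \<partial>lborel) = (\<integral>\<^sup>+s. c (s - r) * K s r \<partial>lborel)"
        using nn_integral_lborel_shift[of "\<lambda>s. c (s - r) * K s r" r] by (simp add: add.commute)
    qed
    also have "\<dots> = (\<integral>\<^sup>+s. (\<integral>\<^sup>+r. c (s - r) * K s r \<partial>lborel) \<partial>lborel)"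
      by (rule lborel_pair.Fubini') measurable
    finally show ?thesis .
  qed
  have hsym: "h (- \<rho>) = h \<rho>" for \<rho>
  proof -
    have "h (- \<rho>) = (\<integral>\<^sup>+r. K (- \<rho> + (\<rho> + r)) (\<rho> + r) \<partial>lborel)"
      unfolding h_def by (rule nn_integral_lborel_shift[symmetric, of "\<lambda>r. K (- \<rho> + r) r"]) measurable
    also have "\<dots> = h \<rho>" unfolding h_def by (simp add: Ksym[of _ "\<rho> + _"])
    finally show ?thesis .
  qed
  \<comment> \<open>Finiteness puts the correlations \<open>M (\<rho> + r) r\<close> in
    \<open>L2\<close> as functions of \<open>r\<close> for almost every \<open>\<rho>\<close>, which
    Plancherel in time requires.\<close>
  have hfin: "(\<integral>\<^sup>+\<rho>. h \<rho> \<partial>lborel) < \<infinity>"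
  proof -
    have "(\<integral>\<^sup>+\<rho>. h \<rho> \<partial>lborel) = (\<integral>\<^sup>+s. (\<integral>\<^sup>+r. K s r \<partial>lborel) \<partial>lborel)"
      using hint[of "\<lambda>_. 1"] by simp
    also have "\<dots> \<le> (\<integral>\<^sup>+s. (\<integral>\<^sup>+r. m s * m r \<partial>lborel) \<partial>lborel)"
    proof (rule nn_integral_mono_AE, rule AE_mp[OF AE2], intro AE_I2 impI, rule nn_integral_mono_AE)
      fix s assume "AE r in lborel. m s < \<infinity> \<and> m r < \<infinity>"
      thus "AE r in lborel. K s r \<le> m s * m r"
      proof (rule AE_mp, intro AE_I2 impI)
        fix r assume "m s < \<infinity> \<and> m r < \<infinity>"
        thus "K s r \<le> m s * m r" by (subst lag[symmetric]) auto
      qed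
    qed
    also have "\<dots> = ennreal (nsq f) * ennreal (nsq f)"
      by (simp add: nn_integral_cmult nn_integral_multc intm)
    also have "\<dots> < \<infinity>" by (simp add: ennreal_mult_less_top)
    finally show ?thesis .
  qed

  let ?J = "\<lambda>\<rho>. (\<integral>\<^sup>+\<tau>. ennreal ((cmod (LINT \<eta>|lborel.
        exp (- \<i> * complex_of_real (\<tau> * (\<omega> \<bullet> \<eta>))) * (f (\<rho> *\<^sub>R \<omega> + \<eta>) * cnj (f \<eta>))))\<^sup>2) \<partial>lborel)"
  have J: "AE \<rho> in lborel. ?J \<rho> = ennreal (2 * pi) * h \<rho>"
  proof -
    have "AE \<rho> in lborel. h \<rho> \<noteq> \<infinity>" using hfin by (intro nn_integral_PInf_AE) auto
    thus ?thesis
    proof (rule AE_mp, intro AE_I2 impI)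
      fix \<rho> assume hr: "h \<rho> \<noteq> \<infinity>"
      define M' where "M' r = M (\<rho> + r) r" for r
      have M'm[measurable]: "M' \<in> borel_measurable borel" unfolding M'_def[abs_def] by measurable
      have i0: "integrable lborel (\<lambda>\<eta>. f (\<rho> *\<^sub>R \<omega> + \<eta>) * cnj (f \<eta>))"
        by (rule L2_mult_integrable[OF L2_shift(1)[OF f] f])
      have e: "f (\<rho> *\<^sub>R \<omega> + (r *\<^sub>R \<omega> + \<psi> z)) = \<phi> (\<rho> + r) z" for r z
        by (simp add: \<phi>_def algebra_simps)
      have i1: "integrable (lborel \<Otimes>\<^sub>M N) (\<lambda>(r, z). \<phi> (\<rho> + r) z * cnj (\<phi> r z))"
      proof -
        have "integrable (distr (lborel \<Otimes>\<^sub>M N) borel (\<lambda>(r, z). r *\<^sub>R \<omega> + \<psi> z)) (\<lambda>\<eta>. f (\<rho> *\<^sub>R \<omega> + \<eta>) * cnj (f \<eta>))"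
          unfolding D by (rule i0)
        from integrable_distr[OF Em this] show ?thesis by (simp add: case_prod_unfold e \<phi>_def[symmetric])
      qed
      have iM: "integrable lborel M'"
        using P.integrable_fst'[OF i1] by (simp add: M'_def[abs_def] M_def)
      have M'L: "M' \<in> L2"
        unfolding L2_iff_nn using hr by (simp add: h_def K_def M'_def less_top)
      \<comment> \<open>The phase sees only the height \<open>r\<close>, since \<open>\<psi>\<close>
        is orthogonal to \<open>\<omega>\<close>; integrating over the hyperplane first leaves a
        one-dimensional transform.\<close>
      have F: "(LINT \<eta>|lborel. exp (- \<i> * complex_of_real (\<tau> * (\<omega> \<bullet> \<eta>))) * (f (\<rho> *\<^sub>R \<omega> + \<eta>) * cnj (f \<eta>)))
          = fourier_integral M' \<tau>" for \<tau>
      proof -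
        let ?g = "\<lambda>\<eta>. exp (- \<i> * complex_of_real (\<tau> * (\<omega> \<bullet> \<eta>))) * (f (\<rho> *\<^sub>R \<omega> + \<eta>) * cnj (f \<eta>))"
        have [measurable]: "?g \<in> borel_measurable borel" by measurable
        have i2: "integrable (lborel \<Otimes>\<^sub>M N) (\<lambda>p. exp (- \<i> * complex_of_real (\<tau> * fst p)) * (case p of (r, z) \<Rightarrow> \<phi> (\<rho> + r) z * cnj (\<phi> r z)))"
          by (rule Bochner_Integration.integrable_bound[OF i1]) (auto simp: norm_mult)
        have "(LINT \<eta>|lborel. ?g \<eta>) = (LINT p|(lborel \<Otimes>\<^sub>M N). ?g (case p of (r, z) \<Rightarrow> r *\<^sub>R \<omega> + \<psi> z))"
          by (subst D[symmetric], subst integral_distr) auto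
        also have "\<dots> = (LINT p|(lborel \<Otimes>\<^sub>M N). exp (- \<i> * complex_of_real (\<tau> * fst p)) * (case p of (r, z) \<Rightarrow> \<phi> (\<rho> + r) z * cnj (\<phi> r z)))"
          by (intro Bochner_Integration.integral_cong refl)
             (simp add: case_prod_unfold e \<phi>_def[symmetric] inner_add_right perp ww)
        also have "\<dots> = (LINT r|lborel. LINT z|N. exp (- \<i> * complex_of_real (\<tau> * r)) * (\<phi> (\<rho> + r) z * cnj (\<phi> r z)))"
          by (subst P.integral_fst'[symmetric, OF i2]) simp
        also have "\<dots> = fourier_integral M' \<tau>"
          unfolding fourier_integral_def M'_def M_def
          by (simp add: mult.commute[of "exp _"] mult.commute[of \<tau>])
        finally show ?thesis .
      qed
      have "?J \<rho> = ennreal (nsq (fourier_integral M'))"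
        unfolding F by (rule nn_integral_nsq[OF plancherel_le(1)[OF iM M'L]])
      also have "\<dots> = ennreal (2 * pi) * ennreal (nsq M')"
        unfolding plancherel[OF iM M'L] by (simp add: ennreal_mult)
      also have "ennreal (nsq M') = h \<rho>"
        unfolding nn_integral_nsq[OF M'L, symmetric] h_def K_def M'_def ..
      finally show "?J \<rho> = ennreal (2 * pi) * h \<rho>" .
    qed
  qed

  define k where "k \<rho> = ennreal (\<rho>\<^sup>2) * h \<rho>" for \<rho>
  have km[measurable]: "k \<in> borel_measurable borel" unfolding k_def[abs_def] by measurable
  \<comment> \<open>The integrand is even in \<open>\<rho>\<close> because exchanging two slices
    conjugates their pairing. The half-line is thus half of the plane of pairs
    \<open>(s, r)\<close>, and the \<open>2 * pi\<close> of Plancherel becomes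
    \<open>pi\<close>.\<close>
  have half: "(\<integral>\<^sup>+\<rho>. k \<rho> \<partial>lborel) = 2 * (\<integral>\<^sup>+\<rho>. indicator {0<..} \<rho> * k \<rho> \<partial>lborel)"
  proof -
    have "(\<integral>\<^sup>+\<rho>. k \<rho> \<partial>lborel) = (\<integral>\<^sup>+\<rho>. indicator {0<..} \<rho> * k \<rho> + indicator {0<..} (0 - \<rho>) * k (0 - \<rho>) \<partial>lborel)"
    proof (rule nn_integral_cong_AE, rule AE_mp[OF AE_lborel_singleton[of 0]], intro AE_I2 impI)
      fix \<rho> :: real assume "\<rho> \<noteq> 0"
      thus "k \<rho> = indicator {0<..} \<rho> * k \<rho> + indicator {0<..} (0 - \<rho>) * k (0 - \<rho>)"
        by (cases "\<rho> > 0") (auto simp: k_def hsym)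
    qed
    also have "\<dots> = (\<integral>\<^sup>+\<rho>. indicator {0<..} \<rho> * k \<rho> \<partial>lborel) + (\<integral>\<^sup>+\<rho>. indicator {0<..} \<rho> * k \<rho> \<partial>lborel)"
      by (subst nn_integral_add, measurable, subst nn_integral_lborel_reflect[of "\<lambda>\<rho>. indicator {0<..} \<rho> * k \<rho>" 0]) auto
    finally show ?thesis by (simp add: mult_2)
  qed
  have S1: "(\<integral>\<^sup>+\<rho>. indicator {0<..} \<rho> * (ennreal (\<rho>\<^sup>2) * ?J \<rho>) \<partial>lborel)
     = ennreal pi * (\<integral>\<^sup>+s. (\<integral>\<^sup>+r. ennreal ((s - r)\<^sup>2) * K s r \<partial>lborel) \<partial>lborel)"
  proof -
    have "(\<integral>\<^sup>+\<rho>. indicator {0<..} \<rho> * (ennreal (\<rho>\<^sup>2) * ?J \<rho>) \<partial>lborel)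
       = (\<integral>\<^sup>+\<rho>. ennreal (2 * pi) * (indicator {0<..} \<rho> * k \<rho>) \<partial>lborel)"
      by (rule nn_integral_cong_AE, rule AE_mp[OF J], intro AE_I2 impI) (simp only: k_def mult_ac)
    also have "\<dots> = ennreal (2 * pi) * (\<integral>\<^sup>+\<rho>. indicator {0<..} \<rho> * k \<rho> \<partial>lborel)"
      by (rule nn_integral_cmult) measurable
    also have "ennreal (2 * pi) = ennreal pi * 2" by (simp add: ennreal_mult mult.commute)
    also have "ennreal pi * 2 * (\<integral>\<^sup>+\<rho>. indicator {0<..} \<rho> * k \<rho> \<partial>lborel) = ennreal pi * (\<integral>\<^sup>+\<rho>. k \<rho> \<partial>lborel)"
      unfolding half by (simp add: mult.assoc)
    also have "(\<integral>\<^sup>+\<rho>. k \<rho> \<partial>lborel) = (\<integral>\<^sup>+s. (\<integral>\<^sup>+r. ennreal ((s - r)\<^sup>2) * K s r \<partial>lborel) \<partial>lborel)"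
      unfolding k_def by (rule hint) measurable
    finally show ?thesis .
  qed

  have c1: "\<omega> \<bullet> ((s *\<^sub>R \<omega> + \<psi> z) - (r *\<^sub>R \<omega> + \<psi> z')) = s - r" for s r z z'
    by (simp add: inner_diff_right inner_add_right perp ww)
  \<comment> \<open>The collision exchanges the heights of the two points and keeps their hyperplane
    components, so the collision defect is the integrand of Lagrange's defect.\<close>
  have c2: "(s *\<^sub>R \<omega> + \<psi> z) - (s - r) *\<^sub>R \<omega> = r *\<^sub>R \<omega> + \<psi> z" "(r *\<^sub>R \<omega> + \<psi> z) + (s - r) *\<^sub>R \<omega> = s *\<^sub>R \<omega> + \<psi> z" for s r z
    by (simp_all add: algebra_simps)
  have S2: "(\<integral>\<^sup>+x. (\<integral>\<^sup>+y. ennreal ((\<omega> \<bullet> (x - y))\<^sup>2 *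
        (cmod (f x * f y - f (x - (\<omega> \<bullet> (x - y)) *\<^sub>R \<omega>) * f (y + (\<omega> \<bullet> (x - y)) *\<^sub>R \<omega>)))\<^sup>2) \<partial>lborel) \<partial>lborel)
     = (\<integral>\<^sup>+s. (\<integral>\<^sup>+r. ennreal ((s - r)\<^sup>2) * L s r \<partial>lborel) \<partial>lborel)"
  proof -
    have "(\<integral>\<^sup>+z. (\<integral>\<^sup>+z'. ennreal ((s - r)\<^sup>2 * (cmod (\<phi> s z * \<phi> r z' - \<phi> r z * \<phi> s z'))\<^sup>2) \<partial>N) \<partial>N) = ennreal ((s - r)\<^sup>2) * L s r" for s r
      unfolding L_def
      by (subst ennreal_mult, simp, simp, subst nn_integral_cmult, measurable, subst nn_integral_cmult) auto
    thus ?thesis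
      by (subst dec2, measurable) (simp only: c1 c2 \<phi>_def[symmetric])
  qed
  have S3: "(\<integral>\<^sup>+x. (\<integral>\<^sup>+y. ennreal ((\<omega> \<bullet> (x - y))\<^sup>2 * ((cmod (f x))\<^sup>2 * (cmod (f y))\<^sup>2)) \<partial>lborel) \<partial>lborel)
     = (\<integral>\<^sup>+s. (\<integral>\<^sup>+r. ennreal ((s - r)\<^sup>2) * (m s * m r) \<partial>lborel) \<partial>lborel)"
  proof -
    have "(\<integral>\<^sup>+z. (\<integral>\<^sup>+z'. ennreal ((s - r)\<^sup>2 * ((cmod (\<phi> s z))\<^sup>2 * (cmod (\<phi> r z'))\<^sup>2)) \<partial>N) \<partial>N) = ennreal ((s - r)\<^sup>2) * (m s * m r)" for s r
      unfolding m_def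
      by (simp add: ennreal_mult nn_integral_cmult nn_integral_multc)
    thus ?thesis
      by (subst dec2, measurable) (simp only: c1 \<phi>_def[symmetric])
  qed
  have "ennreal pi * (\<integral>\<^sup>+s. (\<integral>\<^sup>+r. ennreal ((s - r)\<^sup>2) * (m s * m r) \<partial>lborel) \<partial>lborel)
     = ennreal pi * (\<integral>\<^sup>+s. (\<integral>\<^sup>+r. ennreal ((s - r)\<^sup>2) * K s r + ennreal (1/2) * (ennreal ((s - r)\<^sup>2) * L s r) \<partial>lborel) \<partial>lborel)"
  proof (rule arg_cong[where f="(*) (ennreal pi)"], rule nn_integral_cong_AE, rule AE_mp[OF AE2], intro AE_I2 impI, rule nn_integral_cong_AE)
    fix s assume "AE r in lborel. m s < \<infinity> \<and> m r < \<infinity>"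
    thus "AE r in lborel. ennreal ((s - r)\<^sup>2) * (m s * m r) = ennreal ((s - r)\<^sup>2) * K s r + ennreal (1/2) * (ennreal ((s - r)\<^sup>2) * L s r)"
    proof (rule AE_mp, intro AE_I2 impI)
      fix r assume "m s < \<infinity> \<and> m r < \<infinity>"
      thus "ennreal ((s - r)\<^sup>2) * (m s * m r) = ennreal ((s - r)\<^sup>2) * K s r + ennreal (1/2) * (ennreal ((s - r)\<^sup>2) * L s r)"
        by (subst lag[symmetric]) (auto simp: distrib_left mult.left_commute)
    qed
  qed
  also have "\<dots> = ennreal pi * (\<integral>\<^sup>+s. (\<integral>\<^sup>+r. ennreal ((s - r)\<^sup>2) * K s r \<partial>lborel) \<partial>lborel)
     + (ennreal pi * ennreal (1/2)) * (\<integral>\<^sup>+s. (\<integral>\<^sup>+r. ennreal ((s - r)\<^sup>2) * L s r \<partial>lborel) \<partial>lborel)"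
    by (simp add: nn_integral_add nn_integral_cmult distrib_left mult.assoc)
  also have "ennreal pi * ennreal (1/2) = ennreal (pi / 2)"
    by (subst ennreal_mult[symmetric]) auto
  finally show ?thesis unfolding S1 S2 S3 by simp
qed

section \<open>The sharp inequality on the Fourier side\<close>

definition reflection_defect :: "('a::euclidean_space \<Rightarrow> complex) \<Rightarrow> 'a \<Rightarrow> 'a \<Rightarrow> 'a \<Rightarrow> complex" where
  "reflection_defect f \<omega> x y = f x * f y - f (x - (\<omega> \<bullet> (x - y)) *\<^sub>R \<omega>) * f (y + (\<omega> \<bullet> (x - y)) *\<^sub>R \<omega>)"

text \<open>Directions are averaged by means of the unit ball, as in
  \<open>nn_integral_polar\<close>. At \<open>v = 0\<close> the direction is 0 by convention and the
  integrand vanishes.\<close>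

definition total_defect :: "('a::euclidean_space \<Rightarrow> complex) \<Rightarrow> ennreal" where
  "total_defect f = (\<integral>\<^sup>+v. indicator (cball 0 1) v * (\<integral>\<^sup>+x. (\<integral>\<^sup>+y.
     ennreal (((v /\<^sub>R norm v) \<bullet> (x - y))\<^sup>2 * (cmod (reflection_defect f (v /\<^sub>R norm v) x y))\<^sup>2) \<partial>lborel) \<partial>lborel) \<partial>lborel)"

text \<open>Up to a phase, the autocorrelation at \<open>\<xi>\<close> of the data evolved to time
  \<open>t\<close>, see \<open>ip_evolution\<close>; the factor 2 comes from the cross term of
  \<open>|\<xi> + \<eta>|^2\<close>.\<close>

definition interaction :: "('a::euclidean_space \<Rightarrow> complex) \<Rightarrow> real \<Rightarrow> 'a \<Rightarrow> complex" where
  "interaction f t \<xi> = (LINT \<eta>|lborel. exp (- \<i> * complex_of_real (2 * t * (\<xi> \<bullet> \<eta>))) * (f (\<xi> + \<eta>) * cnj (f \<eta>)))"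

lemma interaction_measurable[measurable]:
  fixes f :: "'a::euclidean_space \<Rightarrow> complex"
  assumes [measurable]: "f \<in> borel_measurable borel"
  shows "(\<lambda>p. interaction f (fst p) (snd p)) \<in> borel_measurable (borel \<Otimes>\<^sub>M borel)"
  unfolding interaction_def by measurable

lemma reflection_defect_measurable:
  fixes f :: "'a::euclidean_space \<Rightarrow> complex"
  assumes [measurable]: "f \<in> borel_measurable borel" "w \<in> borel_measurable M" "a \<in> borel_measurable M" "b \<in> borel_measurable M"
  shows "(\<lambda>q. reflection_defect f (w q) (a q) (b q)) \<in> borel_measurable M"
  unfolding reflection_defect_def by measurable

text \<open>The substitution \<open>\<tau> = 2 * \<rho> * t\<close>: on a ray, time is a rescaled
  Fourier variable dual to the height along \<open>\<omega>\<close>.\<close>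

lemma interaction_ray:
  fixes f :: "'a::euclidean_space \<Rightarrow> complex"
  assumes fm[measurable]: "f \<in> borel_measurable borel" and r: "\<rho> > 0"
  shows "ennreal (2 * \<rho>) * (\<integral>\<^sup>+t. ennreal ((cmod (interaction f t (\<rho> *\<^sub>R \<omega>)))\<^sup>2) \<partial>lborel) =
     (\<integral>\<^sup>+\<tau>. ennreal ((cmod (LINT \<eta>|lborel. exp (- \<i> * complex_of_real (\<tau> * (\<omega> \<bullet> \<eta>))) * (f (\<rho> *\<^sub>R \<omega> + \<eta>) * cnj (f \<eta>))))\<^sup>2) \<partial>lborel)"
  (is "_ = (\<integral>\<^sup>+\<tau>. ?j \<tau> \<partial>lborel)")
proof -
  have "(\<integral>\<^sup>+\<tau>. ?j \<tau> \<partial>lborel) = ennreal \<bar>2 * \<rho>\<bar> * (\<integral>\<^sup>+t. ?j (0 + (2 * \<rho>) * t) \<partial>lborel)"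
    by (rule nn_integral_real_affine) (use r in auto)
  also have "\<dots> = ennreal (2 * \<rho>) * (\<integral>\<^sup>+t. ennreal ((cmod (interaction f t (\<rho> *\<^sub>R \<omega>)))\<^sup>2) \<partial>lborel)"
    using r by (simp add: interaction_def mult_ac)
  finally show ?thesis by simp
qed

text \<open>With \<open>directional_identity\<close> in the form
  \<open>2 A + (pi / 2) B = pi C\<close>, multiply by \<open>d / 2\<close> and integrate over the
  ball. The second moment of the direction turns \<open>C\<close> into
  \<open>|x - y|^2 * unit_ball_vol d / d\<close>, whence the constants \<open>pi * d / 4\<close> and
  \<open>pi * unit_ball_vol d / 2\<close>.\<close>

lemma interaction_identity:
  fixes f :: "'a::euclidean_space \<Rightarrow> complex"
  assumes f: "f \<in> L2"
  shows "(\<integral>\<^sup>+\<xi>. ennreal (norm \<xi> powr (4 - real DIM('a))) * (\<integral>\<^sup>+t. ennreal ((cmod (interaction f t \<xi>))\<^sup>2) \<partial>lborel) \<partial>lborel)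
     + ennreal (pi * real DIM('a) / 4) * total_defect f
     = ennreal (pi * unit_ball_vol (real DIM('a)) / 2) *
       (\<integral>\<^sup>+x. (\<integral>\<^sup>+y. ennreal ((norm (x - y))\<^sup>2 * ((cmod (f x))\<^sup>2 * (cmod (f y))\<^sup>2)) \<partial>lborel) \<partial>lborel)"
proof -
  have fm[measurable]: "f \<in> borel_measurable borel" using f by measurable
  note reflection_defect_measurable[measurable]
  let ?d = "DIM('a)"
  have d: "?d > 0" by simp
  define I where "I \<xi> = (\<integral>\<^sup>+t. ennreal ((cmod (interaction f t \<xi>))\<^sup>2) \<partial>lborel)" for \<xi>
  have Im[measurable]: "I \<in> borel_measurable borel" unfolding I_def[abs_def] interaction_def by measurable
  define A where "A v = (\<integral>\<^sup>+\<rho>. indicator {0<..} \<rho> * (ennreal (\<rho> ^ (?d - 1)) * (ennreal (norm (\<rho> *\<^sub>R (v /\<^sub>R norm v)) powr (4 - real ?d)) * I (\<rho> *\<^sub>R (v /\<^sub>R norm v)))) \<partial>lborel)" for v :: 'a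
  define B where "B v = (\<integral>\<^sup>+x. (\<integral>\<^sup>+y. ennreal (((v /\<^sub>R norm v) \<bullet> (x - y))\<^sup>2 * (cmod (reflection_defect f (v /\<^sub>R norm v) x y))\<^sup>2) \<partial>lborel) \<partial>lborel)" for v :: 'a
  define C where "C v = (\<integral>\<^sup>+x. (\<integral>\<^sup>+y. ennreal (((v /\<^sub>R norm v) \<bullet> (x - y))\<^sup>2 * ((cmod (f x))\<^sup>2 * (cmod (f y))\<^sup>2)) \<partial>lborel) \<partial>lborel)" for v :: 'a
  have Am[measurable]: "A \<in> borel_measurable borel" unfolding A_def[abs_def] by measurable
  have Bm[measurable]: "B \<in> borel_measurable borel" unfolding B_def[abs_def] by measurable
  have Cm[measurable]: "C \<in> borel_measurable borel" unfolding C_def[abs_def] by measurable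
  have ident: "2 * A v + ennreal (pi / 2) * B v = ennreal pi * C v" if v: "v \<noteq> 0" for v
  proof -
    let ?w = "v /\<^sub>R norm v"
    have nw: "norm ?w = 1" using v by simp
    have "2 * A v = (\<integral>\<^sup>+\<rho>. 2 * (indicator {0<..} \<rho> * (ennreal (\<rho> ^ (?d - 1)) * (ennreal (norm (\<rho> *\<^sub>R ?w) powr (4 - real ?d)) * I (\<rho> *\<^sub>R ?w)))) \<partial>lborel)"
      unfolding A_def by (rule nn_integral_cmult[symmetric]) measurable
    also have "\<dots> = (\<integral>\<^sup>+\<rho>. indicator {0<..} \<rho> * (ennreal (\<rho>\<^sup>2) * (\<integral>\<^sup>+\<tau>. ennreal ((cmod (LINT \<eta>|lborel.
        exp (- \<i> * complex_of_real (\<tau> * (?w \<bullet> \<eta>))) * (f (\<rho> *\<^sub>R ?w + \<eta>) * cnj (f \<eta>))))\<^sup>2) \<partial>lborel)) \<partial>lborel)"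
    proof (rule nn_integral_cong)
      fix \<rho> :: real
      show "2 * (indicator {0<..} \<rho> * (ennreal (\<rho> ^ (?d - 1)) * (ennreal (norm (\<rho> *\<^sub>R ?w) powr (4 - real ?d)) * I (\<rho> *\<^sub>R ?w))))
       = indicator {0<..} \<rho> * (ennreal (\<rho>\<^sup>2) * (\<integral>\<^sup>+\<tau>. ennreal ((cmod (LINT \<eta>|lborel.
        exp (- \<i> * complex_of_real (\<tau> * (?w \<bullet> \<eta>))) * (f (\<rho> *\<^sub>R ?w + \<eta>) * cnj (f \<eta>))))\<^sup>2) \<partial>lborel))"
      proof (cases "\<rho> > 0")
        case True
        have n: "norm (\<rho> *\<^sub>R ?w) = \<rho>" using True nw by simp
        \<comment> \<open>The exponents add up to 3 in every dimension. Two powers form the weight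
          of \<open>directional_identity\<close>, and the third is the Jacobian of
          \<open>interaction_ray\<close>.\<close>
        have "\<rho> ^ (?d - 1) * \<rho> powr (4 - real ?d) = \<rho> powr (real ?d - 1) * \<rho> powr (4 - real ?d)"
          using True d by (subst powr_realpow[symmetric]) (auto simp: of_nat_diff)
        also have "\<dots> = \<rho> powr 3" by (subst powr_add[symmetric]) simp
        also have "\<dots> = \<rho> ^ 3" using True by (simp add: powr_numeral)
        finally have p: "ennreal (\<rho> ^ (?d - 1)) * ennreal (\<rho> powr (4 - real ?d)) = ennreal (\<rho> ^ 3)"
          by (simp add: ennreal_mult''[symmetric])
        have "2 * (ennreal (\<rho> ^ (?d - 1)) * (ennreal (\<rho> powr (4 - real ?d)) * I (\<rho> *\<^sub>R ?w))) = 2 * ennreal (\<rho> ^ 3) * I (\<rho> *\<^sub>R ?w)"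
          unfolding p[symmetric] by (simp only: mult.assoc)
        also have "2 * ennreal (\<rho> ^ 3) = ennreal (\<rho>\<^sup>2) * ennreal (2 * \<rho>)"
        proof -
          have "2 * ennreal (\<rho> ^ 3) = ennreal 2 * ennreal (\<rho> ^ 3)" by simp
          also have "\<dots> = ennreal (2 * \<rho> ^ 3)" using True by (subst ennreal_mult[symmetric]) auto
          also have "2 * \<rho> ^ 3 = \<rho>\<^sup>2 * (2 * \<rho>)" by (simp add: power2_eq_square power3_eq_cube)
          also have "ennreal (\<rho>\<^sup>2 * (2 * \<rho>)) = ennreal (\<rho>\<^sup>2) * ennreal (2 * \<rho>)" using True by (subst ennreal_mult) auto
          finally show ?thesis .
        qed
        finally show ?thesis
          unfolding interaction_ray[OF fm True, symmetric] n I_def[symmetric] using True by (simp add: mult.assoc)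
      qed simp
    qed
    finally have "2 * A v = \<dots>" .
    thus ?thesis unfolding B_def C_def reflection_defect_def
      using directional_identity[OF nw f] by simp
  qed
  let ?i = "indicator (cball (0::'a) 1) :: 'a \<Rightarrow> ennreal"
  have Q: "(\<integral>\<^sup>+\<xi>. ennreal (norm \<xi> powr (4 - real ?d)) * I \<xi> \<partial>lborel) = ennreal (real ?d) * (\<integral>\<^sup>+v. ?i v * A v \<partial>lborel)"
    unfolding A_def by (rule nn_integral_polar) measurable
  have half: "ennreal (1/2) * (2 * a) = a" for a
  proof -
    have "ennreal (1/2) * 2 = ennreal (1/2) * ennreal 2" by (simp only: ennreal_numeral)
    also have "\<dots> = ennreal (1/2 * 2)" by (rule ennreal_mult[symmetric]) auto
    also have "\<dots> = 1" by simp
    finally show ?thesis by (simp only: mult.assoc[symmetric] mult_1_left)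
  qed
  have "(\<integral>\<^sup>+\<xi>. ennreal (norm \<xi> powr (4 - real ?d)) * I \<xi> \<partial>lborel) + ennreal (pi * real ?d / 4) * total_defect f
    = ennreal (real ?d) * ((\<integral>\<^sup>+v. ?i v * A v \<partial>lborel) + ennreal (pi / 4) * total_defect f)"
    unfolding Q distrib_left mult.assoc[symmetric] by (subst ennreal_mult[symmetric]) (auto simp: mult.commute)
  also have "(\<integral>\<^sup>+v. ?i v * A v \<partial>lborel) + ennreal (pi / 4) * total_defect f
    = (\<integral>\<^sup>+v. ?i v * A v + ennreal (pi / 4) * (?i v * B v) \<partial>lborel)"
    by (subst nn_integral_add, measurable, subst nn_integral_cmult, measurable) (simp only: total_defect_def B_def)
  also have "\<dots> = (\<integral>\<^sup>+v. ennreal (pi / 2) * (?i v * C v) \<partial>lborel)"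
  proof (rule nn_integral_cong_AE, rule AE_mp[OF AE_lborel_singleton[of 0]], intro AE_I2 impI)
    fix v :: 'a assume v: "v \<noteq> 0"
    have a: "ennreal (1/2) * ennreal (pi / 2) = ennreal (pi / 4)" "ennreal (1/2) * ennreal pi = ennreal (pi / 2)"
      by (subst ennreal_mult[symmetric]; simp)+
    have "A v + ennreal (pi / 4) * B v = ennreal (1/2) * (2 * A v + ennreal (pi / 2) * B v)"
      by (simp only: distrib_left half a mult.assoc[symmetric]) (simp only: half mult.assoc)
    also have "\<dots> = ennreal (pi / 2) * C v"
      unfolding ident[OF v] by (simp only: mult.assoc[symmetric] a)
    finally have "?i v * (A v + ennreal (pi / 4) * B v) = ?i v * (ennreal (pi / 2) * C v)" by simp
    thus "?i v * A v + ennreal (pi / 4) * (?i v * B v) = ennreal (pi / 2) * (?i v * C v)"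
      by (simp add: distrib_left mult.left_commute)
  qed
  also have "\<dots> = ennreal (pi / 2) * (\<integral>\<^sup>+v. ?i v * C v \<partial>lborel)"
    by (rule nn_integral_cmult) measurable
  also have "(\<integral>\<^sup>+v. ?i v * C v \<partial>lborel) = ennreal (unit_ball_vol (real ?d) / real ?d) *
      (\<integral>\<^sup>+x. (\<integral>\<^sup>+y. ennreal ((norm (x - y))\<^sup>2 * ((cmod (f x))\<^sup>2 * (cmod (f y))\<^sup>2)) \<partial>lborel) \<partial>lborel)"
  proof -
    define H where "H v x y = ?i v * ennreal (((v /\<^sub>R norm v) \<bullet> (x - y))\<^sup>2) * ennreal ((cmod (f x))\<^sup>2 * (cmod (f y))\<^sup>2)" for v x y
    have "(\<integral>\<^sup>+v. ?i v * C v \<partial>lborel) = (\<integral>\<^sup>+v. (\<integral>\<^sup>+x. (\<integral>\<^sup>+y. H v x y \<partial>lborel) \<partial>lborel) \<partial>lborel)"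
      unfolding C_def H_def
      by (intro nn_integral_cong)
         (simp add: ennreal_mult mult.assoc nn_integral_cmult[symmetric])
    also have "\<dots> = (\<integral>\<^sup>+x. (\<integral>\<^sup>+v. (\<integral>\<^sup>+y. H v x y \<partial>lborel) \<partial>lborel) \<partial>lborel)"
      unfolding H_def by (rule lborel_pair.Fubini'[symmetric]) measurable
    also have "\<dots> = (\<integral>\<^sup>+x. (\<integral>\<^sup>+y. (\<integral>\<^sup>+v. H v x y \<partial>lborel) \<partial>lborel) \<partial>lborel)"
      unfolding H_def by (rule nn_integral_cong, rule lborel_pair.Fubini'[symmetric]) measurable
    also have "\<dots> = (\<integral>\<^sup>+x. (\<integral>\<^sup>+y. ennreal (unit_ball_vol (real ?d) / real ?d) * ennreal ((norm (x - y))\<^sup>2 * ((cmod (f x))\<^sup>2 * (cmod (f y))\<^sup>2)) \<partial>lborel) \<partial>lborel)"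
      unfolding H_def
      by (intro nn_integral_cong, subst nn_integral_multc, measurable, subst direction_second_moment)
         (simp add: ennreal_mult[symmetric] mult_ac)
    also have "\<dots> = ennreal (unit_ball_vol (real ?d) / real ?d) *
      (\<integral>\<^sup>+x. (\<integral>\<^sup>+y. ennreal ((norm (x - y))\<^sup>2 * ((cmod (f x))\<^sup>2 * (cmod (f y))\<^sup>2)) \<partial>lborel) \<partial>lborel)"
      by (simp add: nn_integral_cmult)
    finally show ?thesis .
  qed
  also have "ennreal (real ?d) * (ennreal (pi / 2) * (ennreal (unit_ball_vol (real ?d) / real ?d) *
      (\<integral>\<^sup>+x. (\<integral>\<^sup>+y. ennreal ((norm (x - y))\<^sup>2 * ((cmod (f x))\<^sup>2 * (cmod (f y))\<^sup>2)) \<partial>lborel) \<partial>lborel)))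
     = ennreal (pi * unit_ball_vol (real ?d) / 2) *
      (\<integral>\<^sup>+x. (\<integral>\<^sup>+y. ennreal ((norm (x - y))\<^sup>2 * ((cmod (f x))\<^sup>2 * (cmod (f y))\<^sup>2)) \<partial>lborel) \<partial>lborel)"
    unfolding mult.assoc[symmetric] by (simp add: ennreal_mult[symmetric] mult_ac)
  finally show ?thesis unfolding I_def .
qed

text \<open>The cross term in \<open>|x - y|^2\<close> integrates to the squared length of the first
  moment of \<open>|f|^2\<close>. The last claim is the nonnegativity of the double integral; it
  guards the real subtraction under \<open>ennreal\<close>.\<close>

lemma pair_moment:
  fixes f :: "'a::euclidean_space \<Rightarrow> complex"
  assumes f: "f \<in> L2" and m: "integrable lborel (\<lambda>x. (norm x)\<^sup>2 * (cmod (f x))\<^sup>2)"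
  shows "integrable lborel (\<lambda>x. (cmod (f x))\<^sup>2 *\<^sub>R x)"
    and "(\<integral>\<^sup>+x. (\<integral>\<^sup>+y. ennreal ((norm (x - y))\<^sup>2 * ((cmod (f x))\<^sup>2 * (cmod (f y))\<^sup>2)) \<partial>lborel) \<partial>lborel)
       = ennreal (2 * (nsq f * (LINT x|lborel. (norm x)\<^sup>2 * (cmod (f x))\<^sup>2) - (norm (LINT x|lborel. (cmod (f x))\<^sup>2 *\<^sub>R x))\<^sup>2))"
    and "(norm (LINT x|lborel. (cmod (f x))\<^sup>2 *\<^sub>R x))\<^sup>2 \<le> nsq f * (LINT x|lborel. (norm x)\<^sup>2 * (cmod (f x))\<^sup>2)"
proof -
  have fm[measurable]: "f \<in> borel_measurable borel" using f by measurable
  define g where "g x = (cmod (f x))\<^sup>2" for x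
  have gm[measurable]: "g \<in> borel_measurable borel" unfolding g_def[abs_def] by measurable
  have g0: "g x \<ge> 0" for x by (simp add: g_def)
  have ig: "integrable lborel g" unfolding g_def by (rule L2_integrable[OF f])
  have im: "integrable lborel (\<lambda>x. (norm x)\<^sup>2 * g x)" using m by (simp add: g_def)
  show iv: "integrable lborel (\<lambda>x. (cmod (f x))\<^sup>2 *\<^sub>R x)"
    unfolding g_def[symmetric]
  proof (rule Bochner_Integration.integrable_bound[OF Bochner_Integration.integrable_add[OF ig im]])
    have "a \<le> 1 + a\<^sup>2" for a :: real
    proof -
      have "(a - 1/2)\<^sup>2 \<ge> 0" by simp
      thus ?thesis by (simp add: power2_eq_square algebra_simps)
    qed
    hence "g x * norm x \<le> g x * (1 + (norm x)\<^sup>2)" for x by (intro mult_left_mono g0)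
    thus "AE x in lborel. norm (g x *\<^sub>R x) \<le> norm (g x + (norm x)\<^sup>2 * g x)"
      using g0 by (auto simp: algebra_simps)
  qed measurable
  hence iv': "integrable lborel (\<lambda>x. g x *\<^sub>R x)" by (simp add: g_def)
  define E where "E = nsq f"
  define Mo where "Mo = (LINT x|lborel. (norm x)\<^sup>2 * g x)"
  define p where "p = (LINT x|lborel. g x *\<^sub>R x)"
  have E: "(LINT x|lborel. g x) = E" by (simp add: E_def nsq_def g_def)
  have e: "(norm (x - y))\<^sup>2 * (g x * g y) = (((norm x)\<^sup>2 * g x) * g y + g x * ((norm y)\<^sup>2 * g y)) - 2 * ((g x *\<^sub>R x) \<bullet> (g y *\<^sub>R y))" for x y :: 'a
    by (simp add: power2_norm_eq_inner inner_diff_left inner_diff_right inner_commute algebra_simps)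
  have i1: "integrable lborel (\<lambda>y. (norm (x - y))\<^sup>2 * (g x * g y))" for x
    unfolding e by (intro Bochner_Integration.integrable_diff Bochner_Integration.integrable_add integrable_mult_right ig im integrable_inner_right iv')
  have l1: "(LINT y|lborel. (norm (x - y))\<^sup>2 * (g x * g y)) = (((norm x)\<^sup>2 * g x) * E + g x * Mo) - 2 * ((g x *\<^sub>R x) \<bullet> p)" for x
    unfolding e E[symmetric] Mo_def p_def
    by (subst Bochner_Integration.integral_diff, intro Bochner_Integration.integrable_add integrable_mult_right ig im,
        intro integrable_mult_right integrable_inner_right iv',
        subst Bochner_Integration.integral_add, (intro integrable_mult_right ig im)+)
       (subst integral_inner_right[OF iv', symmetric], simp)
  have i2: "integrable lborel (\<lambda>x. (((norm x)\<^sup>2 * g x) * E + g x * Mo) - 2 * ((g x *\<^sub>R x) \<bullet> p))"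
    by (intro Bochner_Integration.integrable_diff Bochner_Integration.integrable_add integrable_mult_left integrable_mult_right ig im integrable_inner_left iv')
  have l2: "(LINT x|lborel. (((norm x)\<^sup>2 * g x) * E + g x * Mo) - 2 * ((g x *\<^sub>R x) \<bullet> p)) = 2 * (E * Mo - (norm p)\<^sup>2)"
  proof -
    have "(LINT x|lborel. (((norm x)\<^sup>2 * g x) * E + g x * Mo) - 2 * ((g x *\<^sub>R x) \<bullet> p)) = (Mo * E + E * Mo) - 2 * (p \<bullet> p)"
      unfolding E[symmetric] Mo_def p_def
      by (subst Bochner_Integration.integral_diff, intro Bochner_Integration.integrable_add integrable_mult_left ig im,
        intro integrable_mult_right integrable_inner_left iv',
        subst Bochner_Integration.integral_add, (intro integrable_mult_left ig im)+)
       (subst integral_inner_left[OF iv', symmetric], simp)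
    thus ?thesis by (simp add: power2_norm_eq_inner algebra_simps)
  qed
  have n: "(((norm x)\<^sup>2 * g x) * E + g x * Mo) - 2 * ((g x *\<^sub>R x) \<bullet> p) \<ge> 0" for x
    unfolding l1[symmetric] by (intro Bochner_Integration.integral_nonneg mult_nonneg_nonneg g0) auto
  have "(\<integral>\<^sup>+x. (\<integral>\<^sup>+y. ennreal ((norm (x - y))\<^sup>2 * (g x * g y)) \<partial>lborel) \<partial>lborel)
     = (\<integral>\<^sup>+x. ennreal ((((norm x)\<^sup>2 * g x) * E + g x * Mo) - 2 * ((g x *\<^sub>R x) \<bullet> p)) \<partial>lborel)"
    by (intro nn_integral_cong, subst nn_integral_eq_integral[OF i1]) (auto simp: g0 l1)
  also have "\<dots> = ennreal (2 * (E * Mo - (norm p)\<^sup>2))"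
    by (rule nn_integral_eq_integral[OF i2, unfolded l2]) (intro AE_I2 n)
  finally show "(\<integral>\<^sup>+x. (\<integral>\<^sup>+y. ennreal ((norm (x - y))\<^sup>2 * ((cmod (f x))\<^sup>2 * (cmod (f y))\<^sup>2)) \<partial>lborel) \<partial>lborel)
       = ennreal (2 * (nsq f * (LINT x|lborel. (norm x)\<^sup>2 * (cmod (f x))\<^sup>2) - (norm (LINT x|lborel. (cmod (f x))\<^sup>2 *\<^sub>R x))\<^sup>2))"
    unfolding E_def Mo_def p_def g_def .
  have "2 * (E * Mo - (norm p)\<^sup>2) \<ge> 0" unfolding l2[symmetric] by (intro Bochner_Integration.integral_nonneg n)
  thus "(norm (LINT x|lborel. (cmod (f x))\<^sup>2 *\<^sub>R x))\<^sup>2 \<le> nsq f * (LINT x|lborel. (norm x)\<^sup>2 * (cmod (f x))\<^sup>2)"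
    unfolding E_def Mo_def p_def g_def by simp
qed

lemma total_defect_0D:
  fixes f :: "'a::euclidean_space \<Rightarrow> complex"
  assumes [measurable]: "f \<in> borel_measurable borel" and 0: "total_defect f = 0"
  shows "AE v in lborel. v \<in> cball 0 1 \<longrightarrow> (AE x in lborel. AE y in lborel. reflection_defect f (v /\<^sub>R norm v) x y = 0)"
proof -
  note reflection_defect_measurable[measurable]
  let ?h = "\<lambda>v x y. ennreal (((v /\<^sub>R norm v) \<bullet> (x - y))\<^sup>2 * (cmod (reflection_defect f (v /\<^sub>R norm v) x y))\<^sup>2)"
  have "AE v in lborel. indicator (cball 0 1) v * (\<integral>\<^sup>+x. (\<integral>\<^sup>+y. ?h v x y \<partial>lborel) \<partial>lborel) = 0"
    using 0 unfolding total_defect_def by (subst (asm) nn_integral_0_iff_AE) measurable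
  note A = this
  show ?thesis
  proof (rule AE_mp[OF A], rule AE_I2, rule impI, rule impI)
    fix v :: 'a assume v: "v \<in> cball 0 1" and "indicator (cball 0 1) v * (\<integral>\<^sup>+x. (\<integral>\<^sup>+y. ?h v x y \<partial>lborel) \<partial>lborel) = 0"
    hence "(\<integral>\<^sup>+x. (\<integral>\<^sup>+y. ?h v x y \<partial>lborel) \<partial>lborel) = 0" by simp
    hence "AE x in lborel. (\<integral>\<^sup>+y. ?h v x y \<partial>lborel) = 0"
      by (subst (asm) nn_integral_0_iff_AE) measurable
    note A = this
    show "AE x in lborel. AE y in lborel. reflection_defect f (v /\<^sub>R norm v) x y = 0"
    proof (rule AE_mp[OF A], rule AE_I2, rule impI)
      fix x assume "(\<integral>\<^sup>+y. ?h v x y \<partial>lborel) = 0"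
      hence "AE y in lborel. ?h v x y = 0"
        by (subst (asm) nn_integral_0_iff_AE) measurable
      thus "AE y in lborel. reflection_defect f (v /\<^sub>R norm v) x y = 0"
      proof (rule AE_mp, intro AE_I2 impI)
        fix y assume "?h v x y = 0"
        \<comment> \<open>The weight may vanish instead of the defect, but then \<open>x\<close> and
          \<open>y\<close> have equal heights along the direction, the collision does nothing, and
          the defect is 0 as well.\<close>
        hence "((v /\<^sub>R norm v) \<bullet> (x - y))\<^sup>2 * (cmod (reflection_defect f (v /\<^sub>R norm v) x y))\<^sup>2 = 0"
          by (subst (asm) ennreal_eq_0_iff) (metis antisym mult_nonneg_nonneg zero_le_power2)
        thus "reflection_defect f (v /\<^sub>R norm v) x y = 0"
          by (auto simp: reflection_defect_def)
      qed
    qed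
  qed
qed

lemma total_defect_eq_0I:
  fixes f :: "'a::euclidean_space \<Rightarrow> complex"
  assumes "\<And>\<omega> x y. norm \<omega> = 1 \<Longrightarrow> reflection_defect f \<omega> x y = 0"
  shows "total_defect f = 0"
proof -
  have "reflection_defect f (v /\<^sub>R norm v) x y = 0" for v x y
    by (cases "v = 0") (auto intro!: assms simp: reflection_defect_def[of _ 0])
  thus ?thesis by (simp add: total_defect_def)
qed

section \<open>Functions invariant under collisions\<close>

text \<open>The four points are the vertices of a rectangle, and the products are taken over its two
  diagonals: the collision of \<open>p + u + v\<close> and \<open>p\<close> in the direction of
  \<open>u\<close> leads to \<open>p + v\<close> and \<open>p + u\<close>.\<close>

definition rect_mult :: "('a::euclidean_space \<Rightarrow> complex) \<Rightarrow> bool" where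
  "rect_mult k \<longleftrightarrow> (\<forall>p u v. u \<bullet> v = 0 \<longrightarrow> k p * k (p + u + v) = k (p + u) * k (p + v))"

lemma rect_multI:
  fixes k :: "'a::euclidean_space \<Rightarrow> complex"
  assumes "\<And>\<omega> x y. norm \<omega> = 1 \<Longrightarrow> reflection_defect k \<omega> x y = 0"
  shows "rect_mult k"
  unfolding rect_mult_def
proof (intro allI impI)
  fix p u v :: 'a assume uv: "u \<bullet> v = 0"
  show "k p * k (p + u + v) = k (p + u) * k (p + v)"
  proof (cases "u = 0")
    case False
    define \<omega> where "\<omega> = u /\<^sub>R norm u"
    have w: "norm \<omega> = 1" using False by (simp add: \<omega>_def)
    have "\<omega> \<bullet> ((p + u + v) - p) = norm u"
      using uv False by (simp add: \<omega>_def inner_add_right power2_norm_eq_inner[symmetric] power2_eq_square)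
    moreover have "norm u *\<^sub>R \<omega> = u" using False by (simp add: \<omega>_def)
    ultimately show ?thesis using assms[OF w, of "p + u + v" p]
      by (simp add: reflection_defect_def algebra_simps)
  qed simp
qed

lemma orthogonal_vector_same_norm:
  fixes w :: "'a::euclidean_space"
  assumes "DIM('a) \<ge> 2"
  obtains h where "w \<bullet> h = 0" "norm h = norm w"
proof -
  obtain y where y: "y \<noteq> 0" "orthogonal w y"
    using orthogonal_to_vector_exists[OF assms] by blast
  show ?thesis
    by (rule that[of "(norm w / norm y) *\<^sub>R y"]) (use y in \<open>auto simp: orthogonal_def\<close>)
qed

text \<open>Nonvanishing on a ball around \<open>a\<close> spreads to the ball with radius larger by
  the factor \<open>sqrt 2\<close>, and iteration covers the whole space.\<close>

lemma rect_mult_nonzero: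
  fixes k :: "'a::euclidean_space \<Rightarrow> complex"
  assumes dim: "DIM('a) \<ge> 2" and c: "continuous_on UNIV k" and k: "rect_mult k" and a: "k a \<noteq> 0"
  shows "k x \<noteq> 0"
proof -
  have "open {x. k x \<noteq> 0}"
    using open_Collect_neq[OF c continuous_on_const] by simp
  then obtain \<delta> where d: "\<delta> > 0" "ball a \<delta> \<subseteq> {x. k x \<noteq> 0}"
    using a unfolding open_contains_ball by blast
  hence \<delta>: "\<delta> > 0" "\<And>x. dist a x < \<delta> \<Longrightarrow> k x \<noteq> 0" by (auto simp: subset_iff)
  have step: "\<forall>x. dist a x < sqrt 2 * r \<longrightarrow> k x \<noteq> 0" if r: "r > 0" and "\<forall>x. dist a x < r \<longrightarrow> k x \<noteq> 0" for r
  proof (intro allI impI)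
    fix y assume y: "dist a y < sqrt 2 * r"
    \<comment> \<open>Half the diagonal from \<open>a\<close> to \<open>y\<close>. With
      \<open>h\<close> orthogonal to \<open>e\<close> and of equal length, \<open>a\<close>,
      \<open>a + e - h\<close>, \<open>y\<close>, \<open>a + e + h\<close> form a square. Its other
      two vertices are closer to \<open>a\<close> by the factor \<open>sqrt 2\<close>, hence in the
      old ball.\<close>
    define e where "e = (1/2) *\<^sub>R (y - a)"
    obtain h where h: "e \<bullet> h = 0" "norm h = norm e" by (rule orthogonal_vector_same_norm[OF dim])
    have he: "h \<bullet> e = 0" using h(1) by (simp add: inner_commute)
    have "(norm (y - a))\<^sup>2 < 2 * r\<^sup>2"
    proof -
      have "(norm (y - a))\<^sup>2 < (sqrt 2 * r)\<^sup>2"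
        using y r by (intro power_strict_mono) (auto simp: dist_norm norm_minus_commute)
      thus ?thesis by (simp add: power_mult_distrib)
    qed
    hence ne: "4 * (norm e)\<^sup>2 < 2 * r\<^sup>2" by (simp add: e_def power_divide)
    have n: "norm (e - h) < r" "norm (e + h) < r"
    proof -
      have "(norm (e - h))\<^sup>2 = (norm e)\<^sup>2 + (norm h)\<^sup>2" "(norm (e + h))\<^sup>2 = (norm e)\<^sup>2 + (norm h)\<^sup>2"
        using h(1) he by (simp_all add: power2_norm_eq_inner inner_diff_left inner_diff_right inner_add_left inner_add_right)
      hence "(norm (e - h))\<^sup>2 < r\<^sup>2" "(norm (e + h))\<^sup>2 < r\<^sup>2" using ne h(2) by auto
      thus "norm (e - h) < r" "norm (e + h) < r" using r by (auto intro: power2_less_imp_less)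
    qed
    have "(e + h) \<bullet> (h - e) = 0"
      using h he by (simp add: inner_diff_right inner_add_left power2_norm_eq_inner[symmetric])
    hence "k (a + e - h) * k ((a + e - h) + (e + h) + (h - e)) = k ((a + e - h) + (e + h)) * k ((a + e - h) + (h - e))"
      using k unfolding rect_mult_def by blast
    moreover have "(a + e - h) + (e + h) = y"
    proof -
      have "(a + e - h) + (e + h) = a + 2 *\<^sub>R e" by (simp add: scaleR_2)
      thus ?thesis by (simp add: e_def)
    qed
    moreover have "(a + e - h) + (e + h) + (h - e) = a + (e + h)" by simp
    moreover have "k (a + e - h) \<noteq> 0" "k (a + (e + h)) \<noteq> 0"
      using that(2) n by (auto simp: dist_norm norm_minus_commute algebra_simps)
    ultimately show "k y \<noteq> 0" by (metis mult_zero_left mult_eq_0_iff)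
  qed
  have all: "\<forall>x. dist a x < sqrt 2 ^ n * \<delta> \<longrightarrow> k x \<noteq> 0" for n
  proof (induction n)
    case (Suc n)
    have "sqrt 2 ^ n * \<delta> > 0" using \<delta> by simp
    from step[OF this Suc] show ?case by (simp add: mult.assoc)
  qed (use \<delta> in simp)
  obtain n where "dist a x / \<delta> < sqrt 2 ^ n"
    using real_arch_pow[of "sqrt 2" "dist a x / \<delta>"] by auto
  hence "dist a x < sqrt 2 ^ n * \<delta>" using \<delta> by (simp add: divide_less_eq)
  thus ?thesis using all by blast
qed

text \<open>A nonvanishing continuous function on a contractible space has a continuous logarithm.
  For it the product rule holds a priori only modulo \<open>2 * pi * \<i>\<close>.\<close>

lemma rect_mult_log:
  fixes k :: "'a::euclidean_space \<Rightarrow> complex"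
  assumes dim: "DIM('a) \<ge> 2" and c: "continuous_on UNIV k" and k: "rect_mult k" and a: "k a \<noteq> 0"
  obtains g where "continuous_on UNIV g" "\<And>x. k x = exp (g x)"
    "\<And>p u v. u \<bullet> v = 0 \<Longrightarrow> g p + g (p + u + v) = g (p + u) + g (p + v)"
proof -
  have nz: "\<And>x. x \<in> UNIV \<Longrightarrow> k x \<noteq> 0" using rect_mult_nonzero[OF dim c k a] by blast
  have "contractible (UNIV :: 'a set)" by (simp add: convex_imp_contractible)
  then obtain g where g: "continuous_on UNIV g" "\<And>x. k x = exp (g x)"
    using continuous_logarithm_on_contractible[OF c _ nz] by auto
  have "g p + g (p + u + v) = g (p + u) + g (p + v)" if uv: "u \<bullet> v = 0" for p u v
  proof -
    \<comment> \<open>The rectangle is shrunk to the point \<open>p\<close>. The discrepancy is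
      continuous in \<open>s\<close>, takes values in a discrete set and is 0 at
      \<open>s = 0\<close>, hence it is 0 at \<open>s = 1\<close>.\<close>
    define D where "D s = g p + g (p + s *\<^sub>R u + s *\<^sub>R v) - g (p + s *\<^sub>R u) - g (p + s *\<^sub>R v)" for s :: real
    have e: "exp (D s) = 1" for s
    proof -
      have "(s *\<^sub>R u) \<bullet> (s *\<^sub>R v) = 0" using uv by simp
      hence "k p * k (p + s *\<^sub>R u + s *\<^sub>R v) = k (p + s *\<^sub>R u) * k (p + s *\<^sub>R v)"
        using k unfolding rect_mult_def by blast
      thus ?thesis using nz by (simp add: D_def exp_diff exp_add g(2)[symmetric])
    qed
    have cD: "continuous_on UNIV D" unfolding D_def
      by (intro continuous_intros continuous_on_compose2[OF g(1)]) auto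
    have "D constant_on UNIV"
    proof (rule continuous_discrete_range_constant[OF connected_UNIV cD])
      fix s
      show "\<exists>e>0. \<forall>y. y \<in> UNIV \<and> D y \<noteq> D s \<longrightarrow> e \<le> norm (D y - D s)"
      proof (intro exI[of _ "2 * pi"] conjI allI impI)
        fix y assume y: "y \<in> UNIV \<and> D y \<noteq> D s"
        have "exp (D y) = exp (D s)" by (simp add: e)
        then obtain n :: int where n: "D y = D s + (of_int (2 * n) * pi) * \<i>" using exp_eq by metis
        hence "n \<noteq> 0" using y by auto
        hence "\<bar>real_of_int n\<bar> \<ge> 1" by linarith
        have "norm (D y - D s) = 2 * \<bar>real_of_int n\<bar> * pi" using n by (simp add: norm_mult)
        thus "2 * pi \<le> norm (D y - D s)" using \<open>\<bar>real_of_int n\<bar> \<ge> 1\<close> by simp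
      qed simp
    qed
    hence "D 1 = D 0" by (metis UNIV_I constant_on_def)
    thus ?thesis by (simp add: D_def algebra_simps)
  qed
  with g show ?thesis by (rule that)
qed

text \<open>Cauchy's functional equation on the half-line, for rational arguments first and then by
  continuity. The half-line is the natural domain for functions of the squared norm and for positive
  multiples of a vector.\<close>

lemma additive_nonneg_linear:
  fixes \<phi> :: "real \<Rightarrow> complex"
  assumes add: "\<And>s t. s \<ge> 0 \<Longrightarrow> t \<ge> 0 \<Longrightarrow> \<phi> (s + t) = \<phi> s + \<phi> t"
    and c: "continuous_on {0..} \<phi>" and t: "t \<ge> 0"
  shows "\<phi> t = t *\<^sub>R \<phi> 1"
proof -
  have 0: "\<phi> 0 = 0" using add[of 0 0] by simp
  have n: "\<phi> (real n * s) = real n *\<^sub>R \<phi> s" if "s \<ge> 0" for n s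
  proof (induction n)
    case (Suc n)
    have "\<phi> (real (Suc n) * s) = \<phi> (real n * s + s)" by (simp add: algebra_simps)
    also have "\<dots> = \<phi> (real n * s) + \<phi> s" using that by (intro add) auto
    finally show ?case using Suc by (simp add: algebra_simps)
  qed (simp add: 0)
  have q: "\<phi> (real m / real (Suc n)) = (real m / real (Suc n)) *\<^sub>R \<phi> 1" for m n
  proof -
    have "real (Suc n) *\<^sub>R \<phi> (real m / real (Suc n)) = \<phi> (real (Suc n) * (real m / real (Suc n)))"
      by (rule n[symmetric]) simp
    also have "real (Suc n) * (real m / real (Suc n)) = real m * 1" by simp
    also have "\<phi> (real m * 1) = real m *\<^sub>R \<phi> 1" by (rule n) simp
    finally have "inverse (real (Suc n)) *\<^sub>R (real (Suc n) *\<^sub>R \<phi> (real m / real (Suc n))) = inverse (real (Suc n)) *\<^sub>R (real m *\<^sub>R \<phi> 1)" by simp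
    thus ?thesis by (simp add: field_simps del: of_nat_Suc)
  qed
  define r where "r n = real (nat \<lfloor>real (Suc n) * t\<rfloor>) / real (Suc n)" for n
  have rl: "r \<longlonglongrightarrow> t"
  proof (rule LIMSEQ_I)
    fix e :: real assume "e > 0"
    then obtain N where N: "N > 0" "inverse (real N) < e" using real_arch_inverse[of e] by auto
    show "\<exists>no. \<forall>n\<ge>no. norm (r n - t) < e"
    proof (intro exI[of _ N] allI impI)
      fix n assume "n \<ge> N"
      have fl: "real (nat \<lfloor>real (Suc n) * t\<rfloor>) = real_of_int \<lfloor>real (Suc n) * t\<rfloor>" using t by simp
      have "\<bar>real_of_int \<lfloor>real (Suc n) * t\<rfloor> - real (Suc n) * t\<bar> \<le> 1" by linarith
      hence "\<bar>real_of_int \<lfloor>real (Suc n) * t\<rfloor> - real (Suc n) * t\<bar> / real (Suc n) \<le> 1 / real (Suc n)"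
        by (intro divide_right_mono) auto
      moreover have "r n - t = (real_of_int \<lfloor>real (Suc n) * t\<rfloor> - real (Suc n) * t) / real (Suc n)"
        unfolding r_def fl by (simp add: diff_divide_distrib del: of_nat_Suc)
      ultimately have "\<bar>r n - t\<bar> \<le> 1 / real (Suc n)" by (simp add: abs_divide del: of_nat_Suc)
      also have "\<dots> \<le> inverse (real N)" using \<open>n \<ge> N\<close> N(1) by (simp add: field_simps)
      finally show "norm (r n - t) < e" using N by simp
    qed
  qed
  have r0: "r n \<in> {0..}" for n by (simp add: r_def)
  have "(\<lambda>n. \<phi> (r n)) \<longlonglongrightarrow> \<phi> t"
    by (rule continuous_on_tendsto_compose[OF c rl]) (use t r0 in auto)
  moreover have "(\<lambda>n. \<phi> (r n)) \<longlonglongrightarrow> t *\<^sub>R \<phi> 1"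
    unfolding r_def q by (intro tendsto_intros rl[unfolded r_def])
  ultimately show ?thesis by (rule LIMSEQ_unique)
qed

text \<open>Split into even and odd parts. The even part depends on the norm alone and is additive
  in the squared norm by Pythagoras. The odd part is additive along every ray and orthogonally
  across the basis, hence linear.\<close>

lemma orthogonally_additive_quadratic:
  fixes L :: "'a::euclidean_space \<Rightarrow> complex"
  assumes dim: "DIM('a) \<ge> 2" and c: "continuous_on UNIV L"
    and add: "\<And>u v. u \<bullet> v = 0 \<Longrightarrow> L (u + v) = L u + L v"
  obtains a :: complex and \<beta> \<gamma> :: 'a
  where "\<And>x. L x = a * complex_of_real ((norm x)\<^sup>2) + complex_of_real (\<beta> \<bullet> x) + \<i> * complex_of_real (\<gamma> \<bullet> x)"
proof -
  define E where "E x = (L x + L (- x)) / 2" for x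
  define S where "S x = (L x - L (- x)) / 2" for x
  have LES: "L x = E x + S x" for x unfolding E_def S_def by (simp add: field_simps)
  have neg: "L (- (u + v)) = L (- u) + L (- v)" if "u \<bullet> v = 0" for u v
    using add[of "-u" "-v"] that by simp
  have Eadd: "E (u + v) = E u + E v" if "u \<bullet> v = 0" for u v
    unfolding E_def using add[OF that] neg[OF that] by (simp add: field_simps)
  have Sadd: "S (u + v) = S u + S v" if "u \<bullet> v = 0" for u v
    unfolding S_def using add[OF that] neg[OF that] by (simp add: field_simps)
  have Em: "E (- x) = E x" for x by (simp add: E_def)
  have Sm: "S (- x) = - S x" for x by (simp add: S_def minus_divide_left)
  have cE: "continuous_on UNIV E" and cS: "continuous_on UNIV S" unfolding E_def S_def
    by (intro continuous_intros continuous_on_compose2[OF c]; simp)+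
  obtain b :: 'a where b: "b \<in> Basis" using nonempty_Basis by blast
  have nb: "norm b = 1" using b by simp
  obtain c' where c': "b \<bullet> c' = 0" "norm c' = norm b" by (rule orthogonal_vector_same_norm[OF dim])
  have Enorm: "E x = E y" if "norm x = norm y" for x y
  proof -
    \<comment> \<open>For vectors of equal norm, half sum and half difference are orthogonal. Thus
      \<open>x = s + t\<close> and \<open>y = s - t\<close> have the same even part.\<close>
    define s where "s = (1/2) *\<^sub>R (x + y)"
    define t where "t = (1/2) *\<^sub>R (x - y)"
    have xx: "x \<bullet> x = y \<bullet> y" using that by (simp add: norm_eq_sqrt_inner)
    have st: "s \<bullet> t = 0"
      by (simp add: s_def t_def inner_add_left inner_diff_left inner_add_right inner_diff_right inner_commute xx)
    have x: "x = s + t" and y: "y = s + (- t)" unfolding s_def t_def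
      by (simp_all add: algebra_simps flip: scaleR_add_left)
    have "E x = E s + E t" using Eadd[OF st] x by simp
    moreover have "E y = E s + E (- t)" using Eadd[of s "- t"] st y by simp
    ultimately show ?thesis by (simp add: Em)
  qed
  \<comment> \<open>Parametrised by the squared length, so that a sum of orthogonal vectors becomes
    a sum of arguments.\<close>
  define \<phi> where "\<phi> r = E (sqrt r *\<^sub>R b)" for r
  have phi1: "\<phi> t = t *\<^sub>R \<phi> 1" if "t \<ge> 0" for t
  proof (rule additive_nonneg_linear[OF _ _ that])
    show "continuous_on {0..} \<phi>" unfolding \<phi>_def
      by (intro continuous_on_compose2[OF cE] continuous_intros) auto
    fix s t :: real assume st: "s \<ge> 0" "t \<ge> 0"
    have o: "(sqrt s *\<^sub>R b) \<bullet> (sqrt t *\<^sub>R c') = 0" using c' by simp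
    have "(norm (sqrt s *\<^sub>R b + sqrt t *\<^sub>R c'))\<^sup>2 = s + t"
      using o st c' nb by (simp add: power2_norm_eq_inner inner_add_left inner_add_right inner_commute[of c' b])
         (simp add: power2_norm_eq_inner[symmetric])
    hence "norm (sqrt s *\<^sub>R b + sqrt t *\<^sub>R c') = sqrt (s + t)" by (metis norm_ge_zero real_sqrt_unique)
    hence "norm (sqrt (s + t) *\<^sub>R b) = norm (sqrt s *\<^sub>R b + sqrt t *\<^sub>R c')" using nb st by simp
    hence "\<phi> (s + t) = E (sqrt s *\<^sub>R b + sqrt t *\<^sub>R c')" unfolding \<phi>_def by (rule Enorm)
    also have "\<dots> = \<phi> s + E (sqrt t *\<^sub>R c')" unfolding Eadd[OF o] \<phi>_def ..
    also have "E (sqrt t *\<^sub>R c') = \<phi> t" unfolding \<phi>_def by (rule Enorm) (use c' in simp)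
    finally show "\<phi> (s + t) = \<phi> s + \<phi> t" .
  qed
  have Eq: "E x = (norm x)\<^sup>2 *\<^sub>R \<phi> 1" for x
  proof -
    have "E x = \<phi> ((norm x)\<^sup>2)" unfolding \<phi>_def by (rule Enorm) (simp add: nb)
    also have "\<dots> = (norm x)\<^sup>2 *\<^sub>R \<phi> 1" by (rule phi1) simp
    finally show ?thesis .
  qed
  have S0: "S 0 = 0" by (simp add: S_def)
  have Sline: "S (t *\<^sub>R x) = t *\<^sub>R S x" if t: "t \<ge> 0" for t x
  proof -
    have "S (t *\<^sub>R x) = t *\<^sub>R S (1 *\<^sub>R x)"
    proof (rule additive_nonneg_linear[OF _ _ t])
      show "continuous_on {0..} (\<lambda>t. S (t *\<^sub>R x))" by (intro continuous_on_compose2[OF cS] continuous_intros) auto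
      fix s t :: real assume st: "s \<ge> 0" "t \<ge> 0"
      obtain y where y: "x \<bullet> y = 0" "norm y = norm x" by (rule orthogonal_vector_same_norm[OF dim])
      \<comment> \<open>The length \<open>sqrt (s * t) * norm x\<close> is the altitude of a right
        triangle whose hypotenuse is divided into \<open>s x\<close> and \<open>t x\<close>; it
        makes \<open>s x + w\<close> and \<open>t x - w\<close> orthogonal. The contributions of
        \<open>w\<close> and \<open>- w\<close> cancel by oddness.\<close>
      define w where "w = sqrt (s * t) *\<^sub>R y"
      have xy: "x \<bullet> x = y \<bullet> y" using y(2) by (simp add: norm_eq_sqrt_inner)
      have o1: "(s *\<^sub>R x) \<bullet> w = 0" "(t *\<^sub>R x) \<bullet> (- w) = 0" using y by (auto simp: w_def)
      have o2: "(s *\<^sub>R x + w) \<bullet> (t *\<^sub>R x + (- w)) = 0"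
        using y st by (simp add: w_def inner_add_left inner_diff_right inner_commute[of y x] xy)
      have "S ((s + t) *\<^sub>R x) = S ((s *\<^sub>R x + w) + (t *\<^sub>R x + (- w)))" by (simp add: algebra_simps)
      also have "\<dots> = (S (s *\<^sub>R x) + S w) + (S (t *\<^sub>R x) + S (- w))"
        unfolding Sadd[OF o2] Sadd[OF o1(1)] Sadd[OF o1(2)] ..
      finally show "S ((s + t) *\<^sub>R x) = S (s *\<^sub>R x) + S (t *\<^sub>R x)" by (simp add: Sm)
    qed
    thus ?thesis by simp
  qed
  have Sline': "S (t *\<^sub>R x) = t *\<^sub>R S x" for t x
  proof (cases "t \<ge> 0")
    case False
    hence "S ((- t) *\<^sub>R x) = (- t) *\<^sub>R S x" by (intro Sline) simp
    thus ?thesis using Sm[of "t *\<^sub>R x"] by simp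
  qed (rule Sline)
  have Ssum: "S (\<Sum>b\<in>A. (x \<bullet> b) *\<^sub>R b) = (\<Sum>b\<in>A. (x \<bullet> b) *\<^sub>R S b)" if "A \<subseteq> Basis" for A x
    using finite_subset[OF that finite_Basis] that
  proof (induction A rule: finite_induct)
    case (insert b A)
    have "((x \<bullet> b) *\<^sub>R b) \<bullet> (\<Sum>b\<in>A. (x \<bullet> b) *\<^sub>R b) = 0"
      using insert by (auto simp: inner_sum_right inner_Basis intro!: sum.neutral)
    from Sadd[OF this] show ?case using insert by (simp add: Sline')
  qed (simp add: S0)
  have Slin: "S x = complex_of_real ((\<Sum>b\<in>Basis. Re (S b) *\<^sub>R b) \<bullet> x) + \<i> * complex_of_real ((\<Sum>b\<in>Basis. Im (S b) *\<^sub>R b) \<bullet> x)" for x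
  proof -
    have "S x = (\<Sum>b\<in>Basis. (x \<bullet> b) *\<^sub>R S b)" using Ssum[of Basis x] by (simp add: euclidean_representation)
    thus ?thesis
      by (intro complex_eqI) (auto simp: inner_sum_left mult.commute inner_commute[of x])
  qed
  show ?thesis
    by (rule that[of "\<phi> 1" "\<Sum>b\<in>Basis. Re (S b) *\<^sub>R b" "\<Sum>b\<in>Basis. Im (S b) *\<^sub>R b"])
       (subst LES, subst Eq, subst Slin, simp only: scaleR_conv_of_real add.assoc mult.commute)
qed

text \<open>Includes the real linear term \<open>\<beta>\<close>, which the class
  \<open>gaussians\<close> excludes: collision invariance leaves \<open>\<beta>\<close> free, and
  only the momentum condition removes it.\<close>

definition quad_exp :: "complex \<Rightarrow> 'a::euclidean_space \<Rightarrow> 'a \<Rightarrow> complex \<Rightarrow> 'a \<Rightarrow> complex" where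
  "quad_exp a \<beta> \<gamma> c x = exp (a * complex_of_real ((norm x)\<^sup>2) + complex_of_real (\<beta> \<bullet> x) + \<i> * complex_of_real (\<gamma> \<bullet> x) + c)"

theorem rect_mult_imp_quad_exp:
  fixes k :: "'a::euclidean_space \<Rightarrow> complex"
  assumes dim: "DIM('a) \<ge> 2" and c: "continuous_on UNIV k" and k: "rect_mult k" and a: "k x0 \<noteq> 0"
  obtains a \<beta> \<gamma> c where "k = quad_exp a \<beta> \<gamma> c"
proof -
  obtain g where g: "continuous_on UNIV g" "\<And>x. k x = exp (g x)"
    and r: "\<And>p u v. u \<bullet> v = 0 \<Longrightarrow> g p + g (p + u + v) = g (p + u) + g (p + v)"
    by (rule rect_mult_log[OF dim c k a]) blast
  have "(\<lambda>x. g x - g 0) (u + v) = (\<lambda>x. g x - g 0) u + (\<lambda>x. g x - g 0) v" if "u \<bullet> v = 0" for u v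
    using r[OF that, of 0] by (simp add: algebra_simps)
  moreover have "continuous_on UNIV (\<lambda>x. g x - g 0)" by (intro continuous_intros g)
  ultimately obtain a \<beta> \<gamma> where "\<And>x. g x - g 0 = a * complex_of_real ((norm x)\<^sup>2) + complex_of_real (\<beta> \<bullet> x) + \<i> * complex_of_real (\<gamma> \<bullet> x)"
    using orthogonally_additive_quadratic[OF dim, of "\<lambda>x. g x - g 0"] by blast
  hence gx: "g x = a * complex_of_real ((norm x)\<^sup>2) + complex_of_real (\<beta> \<bullet> x) + \<i> * complex_of_real (\<gamma> \<bullet> x) + g 0" for x
    by (metis diff_add_cancel)
  have "k = quad_exp a \<beta> \<gamma> (g 0)"
    by (rule ext) (unfold g(2) quad_exp_def, subst gx, rule refl)
  thus ?thesis by (rule that)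
qed

section \<open>Collision invariance under the Fourier transform\<close>

lemma reflection_inner:
  fixes \<omega> :: "'a::euclidean_space"
  assumes w: "norm \<omega> = 1"
  shows "(x - (\<omega> \<bullet> (x - y)) *\<^sub>R \<omega>) \<bullet> a + (y + (\<omega> \<bullet> (x - y)) *\<^sub>R \<omega>) \<bullet> b
     = x \<bullet> (a - (\<omega> \<bullet> (a - b)) *\<^sub>R \<omega>) + y \<bullet> (b + (\<omega> \<bullet> (a - b)) *\<^sub>R \<omega>)"
  by (simp add: inner_diff_left inner_diff_right inner_add_left inner_add_right inner_commute algebra_simps)

lemma reflection_norm:
  fixes \<omega> :: "'a::euclidean_space"
  assumes w: "norm \<omega> = 1"
  shows "(norm (x - (\<omega> \<bullet> (x - y)) *\<^sub>R \<omega>))\<^sup>2 + (norm (y + (\<omega> \<bullet> (x - y)) *\<^sub>R \<omega>))\<^sup>2 = (norm x)\<^sup>2 + (norm y)\<^sup>2"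
proof -
  have ww: "\<omega> \<bullet> \<omega> = 1" using w by (simp add: norm_eq_sqrt_inner)
  show ?thesis
    by (simp add: power2_norm_eq_inner inner_diff_left inner_diff_right inner_add_left inner_add_right ww inner_commute algebra_simps)
qed

text \<open>Conservation of energy makes the collision an isometry of the space of pairs, so it
  preserves Lebesgue measure there.\<close>

lemma reflection_pair_orthogonal:
  fixes \<omega> :: "'a::euclidean_space"
  assumes w: "norm \<omega> = 1"
  shows "orthogonal_transformation (\<lambda>p::'a \<times> 'a. (fst p - (\<omega> \<bullet> (fst p - snd p)) *\<^sub>R \<omega>, snd p + (\<omega> \<bullet> (fst p - snd p)) *\<^sub>R \<omega>))"
  unfolding orthogonal_transformation
proof
  show "linear (\<lambda>p::'a \<times> 'a. (fst p - (\<omega> \<bullet> (fst p - snd p)) *\<^sub>R \<omega>, snd p + (\<omega> \<bullet> (fst p - snd p)) *\<^sub>R \<omega>))"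
    by (rule linearI) (auto simp: algebra_simps inner_add_right inner_diff_right)
  show "\<forall>p. norm (fst p - (\<omega> \<bullet> (fst p - snd p)) *\<^sub>R \<omega>, snd p + (\<omega> \<bullet> (fst p - snd p)) *\<^sub>R \<omega>) = norm p"
    using reflection_norm[OF w] by (auto simp: norm_Pair)
qed

text \<open>The product of two values of the transform is the transform of
  \<open>F \<otimes> F\<close> at a pair. The collision preserves the measure and is symmetric for
  the inner product, so it can be moved to the frequencies. Integrals ignore null sets; thus almost
  everywhere invariance of \<open>F\<close> yields invariance of the transform at every
  pair.\<close>

lemma fourier_integral_reflection_defect:
  fixes F :: "'a::euclidean_space \<Rightarrow> complex"
  assumes F: "integrable lborel F" and w: "norm \<omega> = 1"
    and ae: "AE x in lborel. AE y in lborel. reflection_defect F \<omega> x y = 0"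
  shows "reflection_defect (fourier_integral F) \<omega> \<xi> \<zeta> = 0"
proof -
  have Fm[measurable]: "F \<in> borel_measurable borel" using F by auto
  note reflection_defect_measurable[measurable]
  define T where "T p = (fst p - (\<omega> \<bullet> (fst p - snd p)) *\<^sub>R \<omega>, snd p + (\<omega> \<bullet> (fst p - snd p)) *\<^sub>R \<omega>)" for p :: "'a \<times> 'a"
  have T: "orthogonal_transformation T" unfolding T_def by (rule reflection_pair_orthogonal[OF w])
  have Tm[measurable]: "T \<in> borel_measurable borel" by (rule orthogonal_transformation_measurable[OF T])
  define \<Phi> where "\<Phi> a b p = F (fst p) * F (snd p) * exp (- \<i> * complex_of_real (fst p \<bullet> a + snd p \<bullet> b))" for a b and p :: "'a \<times> 'a"
  have \<Phi>m[measurable]: "\<Phi> a b \<in> borel_measurable borel" for a b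
    unfolding \<Phi>_def borel_prod[symmetric] by measurable
  have I: "fourier_integral F a * fourier_integral F b = (LINT p|lborel. \<Phi> a b p)" for a b
  proof -
    have i: "integrable (lborel \<Otimes>\<^sub>M lborel) (\<Phi> a b)"
      unfolding \<Phi>_def by (rule integrable_pair_mult[OF F F]) auto
    have "(LINT p|lborel. \<Phi> a b p) = (LINT x|lborel. LINT y|lborel. \<Phi> a b (x, y))"
      unfolding lborel_prod[symmetric] using lborel_pair.integral_fst'[OF i] by simp
    also have "\<dots> = (LINT x|lborel. LINT y|lborel. (F x * exp (- \<i> * complex_of_real (x \<bullet> a))) * (F y * exp (- \<i> * complex_of_real (y \<bullet> b))))"
    proof (intro Bochner_Integration.integral_cong refl)
      fix x y
      have "exp (- \<i> * complex_of_real (x \<bullet> a + y \<bullet> b)) = exp (- \<i> * complex_of_real (x \<bullet> a)) * exp (- \<i> * complex_of_real (y \<bullet> b))"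
        by (simp only: exp_add[symmetric] of_real_add distrib_left)
      thus "\<Phi> a b (x, y) = (F x * exp (- \<i> * complex_of_real (x \<bullet> a))) * (F y * exp (- \<i> * complex_of_real (y \<bullet> b)))"
        by (simp add: \<Phi>_def mult_ac)
    qed
    also have "\<dots> = fourier_integral F a * fourier_integral F b"
      by (simp add: fourier_integral_def)
    finally show ?thesis by simp
  qed
  have "AE p in lborel \<Otimes>\<^sub>M lborel. reflection_defect F \<omega> (fst p) (snd p) = 0"
  proof (rule lborel_pair.AE_pair_measure)
    show "{p \<in> space (lborel \<Otimes>\<^sub>M lborel). reflection_defect F \<omega> (fst p) (snd p) = 0} \<in> sets (lborel \<Otimes>\<^sub>M lborel)"
      by measurable
  qed (use ae in simp)
  hence ae': "AE p in lborel. reflection_defect F \<omega> (fst p) (snd p) = 0" unfolding lborel_prod .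
  have "(LINT p|lborel. \<Phi> \<xi> \<zeta> p) = (LINT p|lborel. \<Phi> \<xi> \<zeta> (T p))"
    by (subst distr_lborel_orthogonal[OF T, symmetric], subst integral_distr) auto
  also have "\<dots> = (LINT p|lborel. \<Phi> (fst (T (\<xi>, \<zeta>))) (snd (T (\<xi>, \<zeta>))) p)"
  proof (rule integral_cong_AE)
    show "AE p in lborel. \<Phi> \<xi> \<zeta> (T p) = \<Phi> (fst (T (\<xi>, \<zeta>))) (snd (T (\<xi>, \<zeta>))) p"
      using ae'
    proof (rule AE_mp, intro AE_I2 impI)
      fix p assume "reflection_defect F \<omega> (fst p) (snd p) = 0"
      thus "\<Phi> \<xi> \<zeta> (T p) = \<Phi> (fst (T (\<xi>, \<zeta>))) (snd (T (\<xi>, \<zeta>))) p"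
        using reflection_inner[OF w, of "fst p" "snd p" \<xi> \<zeta>] by (simp add: \<Phi>_def T_def reflection_defect_def)
    qed
  qed auto
  finally show ?thesis unfolding I[symmetric] by (simp add: reflection_defect_def T_def)
qed

text \<open>A set of full measure meets every ball. The target is \<open>\<omega> / 2\<close>, so
  that balls of radius at most \<open>1 / 2\<close> around it stay inside the unit ball and
  directions converge after normalisation.\<close>

lemma dense_directions:
  fixes \<omega> :: "'a::euclidean_space"
  assumes w: "norm \<omega> = 1" and ae: "AE v in lborel. v \<in> cball 0 1 \<longrightarrow> P v"
  obtains v where "\<And>n::nat. v n \<noteq> 0 \<and> P (v n)" "v \<longlonglongrightarrow> (1/2) *\<^sub>R \<omega>"
proof -
  have "\<exists>v. v \<noteq> 0 \<and> P v \<and> dist v ((1/2) *\<^sub>R \<omega>) < 1 / real (Suc n + 1)" for n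
  proof (rule ccontr)
    assume no: "\<nexists>v. v \<noteq> 0 \<and> P v \<and> dist v ((1/2) *\<^sub>R \<omega>) < 1 / real (Suc n + 1)"
    let ?B = "ball ((1/2) *\<^sub>R \<omega>) (1 / real (Suc n + 1))"
    have B: "?B \<subseteq> cball 0 1"
    proof
      fix v assume "v \<in> ?B"
      hence "norm (v - (1/2) *\<^sub>R \<omega>) < 1 / real (Suc n + 1)" by (simp add: dist_norm norm_minus_commute)
      also have "\<dots> \<le> 1 / 2" by (simp add: field_simps)
      finally have "norm (v - (1/2) *\<^sub>R \<omega>) < 1/2" .
      moreover have "norm ((1/2) *\<^sub>R \<omega>) = 1/2" using w by simp
      ultimately have "norm v < 1" using norm_triangle_sub[of v "(1/2) *\<^sub>R \<omega>"] by linarith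
      thus "v \<in> cball 0 1" by simp
    qed
    have "AE v in lborel. v \<notin> ?B"
      using ae AE_lborel_singleton[of 0]
    proof eventually_elim
      case (elim v)
      show ?case
      proof
        assume "v \<in> ?B"
        hence "v \<in> cball 0 1" "dist v ((1/2) *\<^sub>R \<omega>) < 1 / real (Suc n + 1)" using B by (auto simp: dist_commute)
        thus False using no elim by blast
      qed
    qed
    hence "?B \<in> null_sets lborel" by (subst (asm) AE_iff_null_sets[symmetric]) auto
    moreover have "emeasure lborel ?B \<noteq> 0" by (simp add: emeasure_ball unit_ball_vol_pos[THEN less_imp_neq, symmetric])
    ultimately show False by auto
  qed
  then obtain v where v: "\<And>n. v n \<noteq> 0 \<and> P (v n) \<and> dist (v n) ((1/2) *\<^sub>R \<omega>) < 1 / real (Suc n + 1)" by metis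
  show ?thesis
  proof (rule that[of v])
    show "v n \<noteq> 0 \<and> P (v n)" for n using v by blast
    have "(\<lambda>n. 1 / real (Suc n + 1)) \<longlonglongrightarrow> 0" using LIMSEQ_Suc[OF LIMSEQ_Suc[OF lim_1_over_n]] by simp
    hence "(\<lambda>n. dist (v n) ((1/2) *\<^sub>R \<omega>)) \<longlonglongrightarrow> 0"
      by (rule Lim_null_comparison[rotated]) (use v in \<open>auto intro!: always_eventually less_imp_le simp del: of_nat_Suc\<close>)
    thus "v \<longlonglongrightarrow> (1/2) *\<^sub>R \<omega>" by (rule tendsto_dist_iff[THEN iffD2])
  qed
qed

text \<open>Continuity of \<open>k\<close> upgrades almost every direction to every
  direction.\<close>

lemma reflection_defect_0_all:
  fixes k :: "'a::euclidean_space \<Rightarrow> complex"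
  assumes c: "continuous_on UNIV k" and w: "norm \<omega> = 1"
    and ae: "AE v in lborel. v \<in> cball 0 1 \<longrightarrow> (v \<noteq> 0 \<longrightarrow> reflection_defect k (v /\<^sub>R norm v) x y = 0)"
  shows "reflection_defect k \<omega> x y = 0"
proof -
  obtain v where v: "\<And>n::nat. v n \<noteq> 0 \<and> (v n \<noteq> 0 \<longrightarrow> reflection_defect k (v n /\<^sub>R norm (v n)) x y = 0)"
    and lim: "v \<longlonglongrightarrow> (1/2) *\<^sub>R \<omega>"
    by (rule dense_directions[OF w ae]) blast
  have n: "norm ((1/2) *\<^sub>R \<omega>) = 1/2" using w by simp
  have "(\<lambda>n. v n /\<^sub>R norm (v n)) \<longlonglongrightarrow> ((1/2) *\<^sub>R \<omega>) /\<^sub>R norm ((1/2) *\<^sub>R \<omega>)"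
    by (intro tendsto_intros lim) (use n in simp)
  hence l: "(\<lambda>n. v n /\<^sub>R norm (v n)) \<longlonglongrightarrow> \<omega>" using n by simp
  have cont: "(\<lambda>n. k (z n)) \<longlonglongrightarrow> k z0" if "z \<longlonglongrightarrow> z0" for z :: "nat \<Rightarrow> 'a" and z0
    by (rule continuous_on_tendsto_compose[OF c that]) auto
  have "(\<lambda>n. reflection_defect k (v n /\<^sub>R norm (v n)) x y) \<longlonglongrightarrow> reflection_defect k \<omega> x y"
    unfolding reflection_defect_def by (intro tendsto_intros cont l)
  moreover have "reflection_defect k (v n /\<^sub>R norm (v n)) x y = 0" for n using v by blast
  ultimately show ?thesis by (simp add: LIMSEQ_const_iff)
qed

section \<open>Integrability of exponentials of quadratic polynomials\<close>

lemma L2_gauss: "(\<lambda>x::'a::euclidean_space. complex_of_real (gauss x)) \<in> L2"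
proof -
  have "integrable lborel (\<lambda>x::'a. (gauss x)\<^sup>2)"
    by (rule Bochner_Integration.integrable_bound[OF gauss_integrable])
       (auto simp: power2_eq_square gauss_le_1 mult_left_le)
  thus ?thesis by (simp add: L2_def)
qed

lemma norm_quad_exp: "cmod (quad_exp a \<beta> \<gamma> c x) = exp (Re a * (norm x)\<^sup>2 + \<beta> \<bullet> x + Re c)"
  by (simp add: quad_exp_def)

lemma quad_exp_measurable[measurable]: "quad_exp a \<beta> \<gamma> c \<in> borel_measurable borel"
  unfolding quad_exp_def[abs_def] by measurable

text \<open>If \<open>Re a \<ge> 0\<close>, the linear term favours one of \<open>x\<close> and
  \<open>- x\<close>, so the squared moduli at these two points add up to at least a positive
  constant, which is not integrable over the whole space.\<close>

lemma quad_exp_L2_imp: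
  assumes "quad_exp a \<beta> \<gamma> c \<in> (L2 :: ('a::euclidean_space \<Rightarrow> complex) set)"
  shows "Re a < 0"
proof (rule ccontr)
  assume n: "\<not> Re a < 0"
  let ?k = "quad_exp a \<beta> \<gamma> c"
  have i: "integrable lborel (\<lambda>x. (cmod (?k x))\<^sup>2)" by (rule L2_integrable[OF assms])
  have i': "integrable lborel (\<lambda>x. (cmod (?k (0 - x)))\<^sup>2)"
    using i by (subst integrable_lborel_reflect[of "\<lambda>x. (cmod (?k x))\<^sup>2"]) auto
  have "integrable lborel (\<lambda>x::'a. exp (2 * Re c))"
  proof (rule Bochner_Integration.integrable_bound[OF Bochner_Integration.integrable_add[OF i i']], simp, intro AE_I2)
    fix x :: 'a
    have e: "(cmod (?k y))\<^sup>2 = exp (2 * Re a * (norm y)\<^sup>2 + 2 * (\<beta> \<bullet> y) + 2 * Re c)" for y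
      by (simp add: norm_quad_exp exp_double[symmetric] power2_eq_square exp_add[symmetric] algebra_simps)
    have a0: "2 * Re a * (norm x)\<^sup>2 \<ge> 0" using n by simp
    have "exp (2 * Re c) \<le> (cmod (?k x))\<^sup>2 \<or> exp (2 * Re c) \<le> (cmod (?k (0 - x)))\<^sup>2"
    proof (cases "\<beta> \<bullet> x \<ge> 0")
      case True thus ?thesis unfolding e using a0 by simp
    next
      case False thus ?thesis unfolding e using a0 by simp
    qed
    moreover have "(cmod (?k x))\<^sup>2 \<ge> 0" "(cmod (?k (0 - x)))\<^sup>2 \<ge> 0" by auto
    ultimately have "exp (2 * Re c) \<le> (cmod (?k x))\<^sup>2 + (cmod (?k (0 - x)))\<^sup>2" by linarith
    thus "norm (exp (2 * Re c)) \<le> norm ((cmod (?k x))\<^sup>2 + (cmod (?k (0 - x)))\<^sup>2)" by simp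
  qed
  thus False by (simp add: integrable_iff_bounded ennreal_mult_top)
qed

text \<open>Half of the quadratic decay absorbs the linear term by completing the square, and the
  other half is a rescaled \<open>gauss\<close>. A factor \<open>norm x\<close> is paid for by
  halving the scale once more.\<close>

lemma quad_exp_integrable:
  assumes a: "Re a < 0"
  shows "integrable lborel (quad_exp a \<beta> \<gamma> c :: 'a::euclidean_space \<Rightarrow> complex)"
    and "quad_exp a \<beta> \<gamma> c \<in> (L2 :: ('a::euclidean_space \<Rightarrow> complex) set)"
    and "integrable lborel (\<lambda>x::'a. complex_of_real (norm x) * quad_exp a \<beta> \<gamma> c x)"
    and "(\<lambda>x::'a. complex_of_real (norm x) * quad_exp a \<beta> \<gamma> c x) \<in> L2"
proof -
  define \<epsilon> where "\<epsilon> = sqrt (- Re a)"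
  have e: "\<epsilon> > 0" "\<epsilon>\<^sup>2 = - Re a" using a by (auto simp: \<epsilon>_def)
  have ig: "integrable lborel (\<lambda>x::'a. gauss (\<epsilon> *\<^sub>R x))"
    using fourier_integral_gauss_scaled(1)[OF e(1), where 'a='a] by (simp add: complex_of_real_integrable_eq)
  define K where "K = exp ((norm \<beta>)\<^sup>2 / (- 2 * Re a) + Re c)"
  have b: "cmod (quad_exp a \<beta> \<gamma> c x) \<le> K * gauss (\<epsilon> *\<^sub>R x)" for x :: 'a
  proof -
    have "\<beta> \<bullet> x \<le> norm \<beta> * norm x" by (rule norm_cauchy_schwarz)
    also have "\<dots> \<le> (norm \<beta>)\<^sup>2 / (- 2 * Re a) + (- Re a / 2) * (norm x)\<^sup>2"
    proof -
      have "0 \<le> (norm \<beta> - (- Re a) * norm x)\<^sup>2 / (- 2 * Re a)" using a by (intro divide_nonneg_pos) auto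
      also have "\<dots> = (norm \<beta>)\<^sup>2 / (- 2 * Re a) + (- Re a / 2) * (norm x)\<^sup>2 - norm \<beta> * norm x"
        using a by (simp add: power2_eq_square field_simps)
      finally show ?thesis by simp
    qed
    finally have "Re a * (norm x)\<^sup>2 + \<beta> \<bullet> x + Re c \<le> ((norm \<beta>)\<^sup>2 / (- 2 * Re a) + Re c) + (- (- Re a * (norm x)\<^sup>2) / 2)"
      by (simp add: algebra_simps)
    hence "exp (Re a * (norm x)\<^sup>2 + \<beta> \<bullet> x + Re c) \<le> exp (((norm \<beta>)\<^sup>2 / (- 2 * Re a) + Re c) + (- (- Re a * (norm x)\<^sup>2) / 2))"
      by simp
    also have "\<dots> = K * gauss (\<epsilon> *\<^sub>R x)" unfolding K_def gauss_def exp_add[symmetric] using e by (simp add: power_mult_distrib)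
    finally show ?thesis unfolding norm_quad_exp .
  qed
  have K0: "K > 0" by (simp add: K_def)
  have gx: "norm x * gauss (\<epsilon> *\<^sub>R x) \<le> (2 / \<epsilon>) * gauss ((\<epsilon> / 2) *\<^sub>R x)" for x :: 'a
  proof -
    define s where "s = \<epsilon> * norm x"
    have s0: "s \<ge> 0" using e by (simp add: s_def)
    \<comment> \<open>The rate \<open>3 / 8\<close> is the difference between the rates
      \<open>1 / 2\<close> at \<open>s\<close> and \<open>1 / 8\<close> at \<open>s / 2\<close> of
      the two Gaussians.\<close>
    have "s \<le> 2 * exp (3 * s\<^sup>2 / 8)"
    proof -
      have "1 + 3 * s\<^sup>2 / 8 \<le> exp (3 * s\<^sup>2 / 8)" by (rule exp_ge_add_one_self)
      moreover have "0 \<le> 3 / 4 * (s - 2/3)\<^sup>2" by simp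
      hence "s \<le> 2 * (1 + 3 * s\<^sup>2 / 8)" by (simp add: power2_eq_square algebra_simps)
      ultimately show ?thesis using order_trans[OF _ mult_left_mono] by (metis zero_le_numeral)
    qed
    hence "s * exp (- s\<^sup>2 / 2) \<le> 2 * exp (3 * s\<^sup>2 / 8) * exp (- s\<^sup>2 / 2)" by (intro mult_right_mono) auto
    also have "\<dots> = 2 * exp (- (s / 2)\<^sup>2 / 2)" by (simp add: exp_add[symmetric] power_divide mult.assoc)
    finally have "s * gauss (\<epsilon> *\<^sub>R x) \<le> 2 * gauss ((\<epsilon> / 2) *\<^sub>R x)"
      using e by (simp add: gauss_def s_def power_divide)
    hence "(s * gauss (\<epsilon> *\<^sub>R x)) / \<epsilon> \<le> (2 * gauss ((\<epsilon> / 2) *\<^sub>R x)) / \<epsilon>" using e by (intro divide_right_mono) auto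
    thus ?thesis using e by (simp add: s_def)
  qed
  have ig2: "integrable lborel (\<lambda>x::'a. gauss ((\<epsilon> / 2) *\<^sub>R x))"
    using fourier_integral_gauss_scaled(1)[of "\<epsilon> / 2", where 'a='a] e by (simp add: complex_of_real_integrable_eq)
  have b2: "cmod (complex_of_real (norm x) * quad_exp a \<beta> \<gamma> c x) \<le> (K * (2 / \<epsilon>)) * gauss ((\<epsilon> / 2) *\<^sub>R x)" for x :: 'a
  proof -
    have "norm x * cmod (quad_exp a \<beta> \<gamma> c x) \<le> norm x * (K * gauss (\<epsilon> *\<^sub>R x))" by (intro mult_left_mono b) auto
    also have "\<dots> = K * (norm x * gauss (\<epsilon> *\<^sub>R x))" by simp
    also have "\<dots> \<le> K * ((2 / \<epsilon>) * gauss ((\<epsilon> / 2) *\<^sub>R x))" using K0 by (intro mult_left_mono gx) auto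
    finally show ?thesis by (simp add: norm_mult)
  qed
  have gen: "integrable lborel h \<and> h \<in> L2"
    if [measurable]: "h \<in> borel_measurable borel" and hb: "\<And>x. cmod (h x) \<le> C * gauss (\<delta> *\<^sub>R x)" and C: "C \<ge> 0"
      and ig: "integrable lborel (\<lambda>x::'a. gauss (\<delta> *\<^sub>R x))" for h :: "'a \<Rightarrow> complex" and C \<delta> :: real
  proof
    show "integrable lborel h"
      by (rule Bochner_Integration.integrable_bound[OF integrable_mult_right[OF ig, of C]]) (use hb C in auto)
    have "integrable lborel (\<lambda>x. (cmod (h x))\<^sup>2)"
    proof (rule Bochner_Integration.integrable_bound[OF integrable_mult_right[OF ig, of "C\<^sup>2"]], simp, intro AE_I2)
      fix x
      have "(cmod (h x))\<^sup>2 \<le> (C * gauss (\<delta> *\<^sub>R x))\<^sup>2" by (intro power_mono hb) simp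
      also have "\<dots> = C\<^sup>2 * (gauss (\<delta> *\<^sub>R x))\<^sup>2" by (simp add: power_mult_distrib)
      also have "\<dots> \<le> C\<^sup>2 * gauss (\<delta> *\<^sub>R x)"
        by (intro mult_left_mono) (auto simp: power2_eq_square gauss_le_1 mult_left_le)
      finally show "norm ((cmod (h x))\<^sup>2) \<le> norm (C\<^sup>2 * gauss (\<delta> *\<^sub>R x))" by simp
    qed
    thus "h \<in> L2" by (simp add: L2_def)
  qed
  from gen[of "quad_exp a \<beta> \<gamma> c", OF _ b _ ig] K0
  show "integrable lborel (quad_exp a \<beta> \<gamma> c :: 'a \<Rightarrow> complex)" "quad_exp a \<beta> \<gamma> c \<in> (L2 :: ('a \<Rightarrow> complex) set)" by auto
  have "0 \<le> K * (2 / \<epsilon>)" using K0 e by simp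
  from gen[of "\<lambda>x. complex_of_real (norm x) * quad_exp a \<beta> \<gamma> c x", OF _ b2 this ig2]
  show "integrable lborel (\<lambda>x::'a. complex_of_real (norm x) * quad_exp a \<beta> \<gamma> c x)" "(\<lambda>x::'a. complex_of_real (norm x) * quad_exp a \<beta> \<gamma> c x) \<in> L2" by auto
qed

text \<open>By Plancherel the difference of \<open>f\<close> and \<open>g\<close> has norm 0, its
  transform being 0.\<close>

lemma L2_fourier_inj:
  fixes f g :: "'a::euclidean_space \<Rightarrow> complex"
  assumes 1: "L2_fourier f h" and 2: "L2_fourier g h"
  shows "AE x in lborel. f x = g x"
proof -
  note L = L2_fourierD[OF 1] L2_fourierD[OF 2]
  have "L2_fourier (\<lambda>x. f x + (-1) * g x) (\<lambda>x. h x + (-1) * h x)" by (rule L2_fourier_add_cmult[OF 1 2])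
  from L2_fourier_nsq[OF this] have "nsq (\<lambda>x. f x - g x) = 0" by (simp add: nsq_def)
  from nsq_eq_0_AE[OF L2_diff[OF L(1) L(3)] this] show ?thesis by simp
qed

text \<open>Smoothing by a Gaussian is compatible with the reflections, so \<open>F = f \<cdot> gauss\<close> is still invariant and its
  Fourier transform \<open>k\<close> is a continuous invariant function, hence the exponential of a quadratic polynomial. The same argument
  applied to the inverse transform of \<open>k\<close> identifies \<open>F\<close> without computing a Gaussian integral.\<close>

theorem total_defect_0_imp_quad_exp:
  fixes f :: "'a::euclidean_space \<Rightarrow> complex"
  assumes dim: "DIM('a) \<ge> 2" and f: "f \<in> L2" and nz: "\<not> (AE x in lborel. f x = 0)" and 0: "total_defect f = 0"
  obtains a \<beta> \<gamma> c where "Re a < 0" "AE x in lborel. f x = quad_exp a \<beta> \<gamma> c x"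
proof -
  have fm[measurable]: "f \<in> borel_measurable borel" using f by measurable
  define F where "F x = f x * complex_of_real (gauss x)" for x
  have Fm[measurable]: "F \<in> borel_measurable borel" unfolding F_def by measurable
  have iF: "integrable lborel F" using L2_mult_integrable[OF f L2_gauss] by (simp add: F_def[abs_def])
  have LF: "F \<in> L2" by (rule L2_bound[OF f]) (auto simp: F_def norm_mult gauss_le_1 mult_left_le)
  have nzF: "\<not> (AE x in lborel. F x = 0)" using nz by (simp add: F_def)
  have Fd: "reflection_defect F \<omega> x y = complex_of_real (gauss x * gauss y) * reflection_defect f \<omega> x y" if w: "norm \<omega> = 1" for \<omega> x y
  proof -
    have "gauss (x - (\<omega> \<bullet> (x - y)) *\<^sub>R \<omega>) * gauss (y + (\<omega> \<bullet> (x - y)) *\<^sub>R \<omega>) = gauss x * gauss y"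
      unfolding gauss_def exp_add[symmetric] using reflection_norm[OF w, of x y]
      by (simp add: add_divide_distrib[symmetric] diff_minus_eq_add[symmetric] del: diff_minus_eq_add)
    hence "complex_of_real (gauss (x - (\<omega> \<bullet> (x - y)) *\<^sub>R \<omega>)) * complex_of_real (gauss (y + (\<omega> \<bullet> (x - y)) *\<^sub>R \<omega>)) = complex_of_real (gauss x * gauss y)"
      by (simp flip: of_real_mult)
    thus ?thesis unfolding reflection_defect_def F_def
      by (simp add: right_diff_distrib mult_ac)
  qed
  define k where "k = fourier_integral F"
  have kc: "continuous_on UNIV k" unfolding k_def by (rule continuous_on_fourier_integral[OF iF])
  have kd: "reflection_defect k \<omega> \<xi> \<zeta> = 0" if w: "norm \<omega> = 1" for \<omega> \<xi> \<zeta>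
  proof (rule reflection_defect_0_all[OF kc w])
    show "AE v in lborel. v \<in> cball 0 1 \<longrightarrow> (v \<noteq> 0 \<longrightarrow> reflection_defect k (v /\<^sub>R norm v) \<xi> \<zeta> = 0)"
      using total_defect_0D[OF fm 0]
    proof eventually_elim
      case (elim v)
      show ?case
      proof (intro impI)
        assume v: "v \<in> cball 0 1" "v \<noteq> 0"
        hence n: "norm (v /\<^sub>R norm v) = 1" by simp
        show "reflection_defect k (v /\<^sub>R norm v) \<xi> \<zeta> = 0"
          unfolding k_def
        proof (rule fourier_integral_reflection_defect[OF iF n])
          show "AE x in lborel. AE y in lborel. reflection_defect F (v /\<^sub>R norm v) x y = 0"
            using elim v unfolding Fd[OF n] by auto
        qed
      qed
    qed
  qed
  have Fk: "L2_fourier F k" unfolding k_def by (rule L2_fourier_integrable[OF iF LF]) auto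
  \<comment> \<open>Used to see that the second transform \<open>m\<close> has a nonzero value:
    \<open>F\<close> is almost everywhere a nonzero multiple of the reflected \<open>m\<close>, and
    \<open>F\<close> is not almost everywhere 0.\<close>
  have ex: "\<exists>x. h x \<noteq> 0" if "AE x in lborel. F x = g x" "\<And>x. g x = 0 \<longleftrightarrow> h (s x) = 0" for g h :: "'a \<Rightarrow> complex" and s
  proof (rule ccontr)
    assume "\<nexists>x. h x \<noteq> 0"
    hence "g x = 0" for x using that(2) by auto
    thus False using that(1) nzF by simp
  qed
  have "\<exists>x. k x \<noteq> 0"
  proof (rule ccontr)
    assume "\<nexists>x. k x \<noteq> 0"
    hence "nsq k = 0" by (simp add: nsq_def)
    hence "nsq F = 0" using L2_fourier_nsq[OF Fk] by simp
    thus False using nsq_eq_0_AE[OF LF] nzF by blast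
  qed
  then obtain x0 where "k x0 \<noteq> 0" by blast
  obtain a1 \<beta>1 \<gamma>1 c1 where k: "k = quad_exp a1 \<beta>1 \<gamma>1 c1"
    by (rule rect_mult_imp_quad_exp[OF dim kc rect_multI[OF kd] \<open>k x0 \<noteq> 0\<close>])
  have kL: "k \<in> L2" using L2_fourierD(2)[OF Fk] .
  hence "Re a1 < 0" unfolding k by (rule quad_exp_L2_imp)
  hence ik: "integrable lborel k" unfolding k by (rule quad_exp_integrable)
  define m where "m = fourier_integral k"
  have "L2_fourier (fourier_inverse k) k" by (rule L2_fourier_inverse[OF ik kL])
  hence ae: "AE x in lborel. F x = fourier_inverse k x" by (rule L2_fourier_inj[OF Fk])
  have mc: "continuous_on UNIV m" unfolding m_def by (rule continuous_on_fourier_integral[OF ik])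
  have md: "reflection_defect m \<omega> \<xi> \<zeta> = 0" if w: "norm \<omega> = 1" for \<omega> \<xi> \<zeta>
    unfolding m_def by (rule fourier_integral_reflection_defect[OF ik w]) (simp add: kd[OF w])
  have "\<exists>x. m x \<noteq> 0" by (rule ex[OF ae, of _ uminus]) (simp add: fourier_inverse_def m_def)
  then obtain x1 where "m x1 \<noteq> 0" by blast
  obtain a2 \<beta>2 \<gamma>2 c2 where m: "m = quad_exp a2 \<beta>2 \<gamma>2 c2"
    by (rule rect_mult_imp_quad_exp[OF dim mc rect_multI[OF md] \<open>m x1 \<noteq> 0\<close>])
  \<comment> \<open>The Plancherel constant enters the exponent as a logarithm. Below,
    \<open>1/2\<close> undoes the factor \<open>gauss\<close>, and the signs of the linear terms
    come from the reflection in \<open>fourier_inverse\<close>.\<close>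
  let ?c = "complex_of_real (ln ((2 * pi) ^ DIM('a)))"
  have res: "AE x in lborel. f x = quad_exp (a2 + 1/2) (- \<beta>2) (- \<gamma>2) (c2 - ?c) x"
    using ae
  proof eventually_elim
    case (elim x)
    have g: "complex_of_real (gauss x) = exp (- complex_of_real ((norm x)\<^sup>2) / 2)"
      unfolding gauss_def by (simp add: exp_of_real[symmetric])
    have p: "complex_of_real ((2 * pi) ^ DIM('a)) = exp ?c"
      by (subst exp_of_real) (simp add: exp_ln)
    have "f x * complex_of_real (gauss x) = m (- x) / complex_of_real ((2 * pi) ^ DIM('a))"
      using elim by (simp add: F_def fourier_inverse_def m_def)
    also have "\<dots> = quad_exp (a2 + 1/2) (- \<beta>2) (- \<gamma>2) (c2 - ?c) x * complex_of_real (gauss x)"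
      unfolding m p g quad_exp_def exp_add[symmetric] exp_diff[symmetric]
      by (rule arg_cong[where f=exp]) (simp add: field_simps)
    finally show ?case by simp
  qed
  \<comment> \<open>Decay cannot come from \<open>F\<close>, whose Gaussian factor was put in by
    hand; it is the integrability of \<open>f\<close> itself that forces it.\<close>
  have "quad_exp (a2 + 1/2) (- \<beta>2) (- \<gamma>2) (c2 - ?c) \<in> L2" by (rule L2_cong_AE[OF f _ res]) simp
  hence "Re (a2 + 1/2) < 0" by (rule quad_exp_L2_imp)
  from this res show ?thesis by (rule that)
qed

section \<open>Inverting the Fourier transform measurably in a parameter\<close>

lemma nsq_le_nn:
  assumes "f \<in> borel_measurable borel" "(\<integral>\<^sup>+x. ennreal ((cmod (f x))\<^sup>2) \<partial>lborel) \<le> ennreal C" "C \<ge> 0"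
  shows "f \<in> L2" "nsq f \<le> C"
proof -
  show "f \<in> L2" using assms by (auto simp: L2_iff_nn intro: le_less_trans)
  from nn_integral_nsq[OF this] show "nsq f \<le> C" using assms by (simp add: ennreal_le_iff)
qed

text \<open>The graph of the transform is closed in \<open>L2\<close>. The truncated transform of
  \<open>f - g n\<close> is controlled by Plancherel uniformly in \<open>R\<close>, so
  \<open>n\<close> may be fixed before \<open>R\<close> grows.\<close>

lemma L2_fourier_closed:
  fixes f :: "'a::euclidean_space \<Rightarrow> complex"
  assumes F: "\<And>n. L2_fourier (g n) (k n)" and f: "f \<in> L2" and h: "h \<in> L2"
    and lf: "(\<lambda>n. nsq (\<lambda>x. f x - g n x)) \<longlonglongrightarrow> 0" and lh: "(\<lambda>n. nsq (\<lambda>x. k n x - h x)) \<longlonglongrightarrow> 0"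
  shows "L2_fourier f h"
proof -
  note L = L2_fourierD[OF F]
  define C where "C = (2 * pi) ^ DIM('a)"
  have C: "C > 0" by (simp add: C_def)
  let ?S = "\<lambda>R f. fourier_integral (trunc R f)"
  have b: "nsq (\<lambda>\<xi>. ?S R f \<xi> - h \<xi>) \<le> 2 * (C * nsq (\<lambda>x. f x - g n x)) + 2 * (2 * nsq (\<lambda>\<xi>. ?S R (g n) \<xi> - k n \<xi>) + 2 * nsq (\<lambda>\<xi>. k n \<xi> - h \<xi>))" for R n
  proof -
    have d: "(\<lambda>x. f x - g n x) \<in> L2" by (intro L2_diff f L)
    have e1: "?S R f \<xi> - ?S R (g n) \<xi> = ?S R (\<lambda>x. f x - g n x) \<xi>" for \<xi>
    proof -
      have "trunc R (\<lambda>x. f x - g n x) = (\<lambda>x. trunc R f x - trunc R (g n) x)" by (auto simp: trunc_def algebra_simps)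
      thus ?thesis using fourier_integral_diff[OF trunc_integrable[OF f, of R] trunc_integrable[OF L(1), of R], of n \<xi>] by simp
    qed
    have "(\<lambda>\<xi>. ?S R f \<xi> - h \<xi>) = (\<lambda>\<xi>. ?S R (\<lambda>x. f x - g n x) \<xi> + ((?S R (g n) \<xi> - k n \<xi>) + (k n \<xi> - h \<xi>)))"
      unfolding e1[symmetric] by auto
    moreover have l: "(\<lambda>\<xi>. (?S R (g n) \<xi> - k n \<xi>) + (k n \<xi> - h \<xi>)) \<in> L2"
      using L2_diff[OF fourier_trunc_L2[OF L(1)] h, of R n] by simp
    ultimately have "nsq (\<lambda>\<xi>. ?S R f \<xi> - h \<xi>) \<le> 2 * nsq (?S R (\<lambda>x. f x - g n x)) + 2 * nsq (\<lambda>\<xi>. (?S R (g n) \<xi> - k n \<xi>) + (k n \<xi> - h \<xi>))"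
      using nsq_add_le[OF fourier_trunc_L2[OF d] l, of R] by simp
    also have "nsq (?S R (\<lambda>x. f x - g n x)) \<le> C * nsq (\<lambda>x. f x - g n x)"
    proof -
      have "nsq (trunc R (\<lambda>x. f x - g n x)) \<le> nsq (\<lambda>x. f x - g n x)"
        unfolding nsq_def by (intro integral_mono L2_integrable trunc_L2 d power_mono trunc_bound) auto
      thus ?thesis unfolding plancherel[OF trunc_integrable[OF d] trunc_L2[OF d]] C_def by (intro mult_left_mono) auto
    qed
    also have "nsq (\<lambda>\<xi>. (?S R (g n) \<xi> - k n \<xi>) + (k n \<xi> - h \<xi>)) \<le> 2 * nsq (\<lambda>\<xi>. ?S R (g n) \<xi> - k n \<xi>) + 2 * nsq (\<lambda>\<xi>. k n \<xi> - h \<xi>)"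
      by (intro nsq_add_le L2_diff fourier_trunc_L2 L h)
    finally show ?thesis by simp
  qed
  have "((\<lambda>R. nsq (\<lambda>\<xi>. ?S R f \<xi> - h \<xi>)) \<longlongrightarrow> 0) at_top"
  proof (rule tendstoI)
    fix e :: real assume e: "e > 0"
    have "(\<lambda>n. 2 * (C * nsq (\<lambda>x. f x - g n x)) + 2 * (2 * nsq (\<lambda>\<xi>. k n \<xi> - h \<xi>))) \<longlonglongrightarrow> 2 * (C * 0) + 2 * (2 * 0)"
      by (intro tendsto_intros lf lh)
    hence "eventually (\<lambda>n. 2 * (C * nsq (\<lambda>x. f x - g n x)) + 2 * (2 * nsq (\<lambda>\<xi>. k n \<xi> - h \<xi>)) < e / 2) sequentially"
      using e by (intro order_tendstoD(2)) auto
    then obtain n where n: "2 * (C * nsq (\<lambda>x. f x - g n x)) + 2 * (2 * nsq (\<lambda>\<xi>. k n \<xi> - h \<xi>)) < e / 2"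
      using eventually_happens by fastforce
    have "((\<lambda>R. nsq (\<lambda>\<xi>. ?S R (g n) \<xi> - k n \<xi>)) \<longlongrightarrow> 0) at_top" using F[of n] by (simp add: L2_fourier_def)
    \<comment> \<open>This term enters the bound with the factor 4, so \<open>e / 8\<close> uses up
      the remaining \<open>e / 2\<close>.\<close>
    hence "eventually (\<lambda>R. nsq (\<lambda>\<xi>. ?S R (g n) \<xi> - k n \<xi>) < e / 8) at_top"
      using e by (intro order_tendstoD(2)) auto
    thus "eventually (\<lambda>R. dist (nsq (\<lambda>\<xi>. ?S R f \<xi> - h \<xi>)) 0 < e) at_top"
    proof eventually_elim
      case (elim R)
      have "a < e" if "a \<le> 2 * p + 2 * (2 * s + 2 * q)" "2 * p + 2 * (2 * q) < e / 2" "s < e / 8" for a p q s :: real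
      proof -
        have "2 * (2 * s + 2 * q) = 4 * s + 4 * q" "2 * (2 * q) = 4 * q" by simp_all
        thus ?thesis using that by linarith
      qed
      from this[OF b n elim] show ?case by (simp add: dist_real_def)
    qed
  qed
  thus ?thesis using f h by (simp add: L2_fourier_def)
qed

text \<open>Each weighted term is bounded by the sum, hence consecutive differences decay
  geometrically with ratio \<open>1 / sqrt 2\<close>.\<close>

lemma fast_series_convergent:
  fixes a :: "nat \<Rightarrow> complex"
  assumes "(\<Sum>k. ennreal (2 ^ k * (cmod (a (Suc k) - a k))\<^sup>2)) \<noteq> \<infinity>"
  shows "convergent a"
proof -
  let ?S = "\<Sum>k. ennreal (2 ^ k * (cmod (a (Suc k) - a k))\<^sup>2)"
  define C where "C = enn2real ?S"
  have C: "?S = ennreal C" "C \<ge> 0" using assms by (auto simp: C_def less_top)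
  have b: "cmod (a (Suc k) - a k) \<le> sqrt C * (1 / sqrt 2) ^ k" for k
  proof -
    have le: "d k \<le> (\<Sum>k. d k)" for d :: "nat \<Rightarrow> ennreal"
      using sum_le_suminf[of d "{k}"] by simp
    have "ennreal (2 ^ k * (cmod (a (Suc k) - a k))\<^sup>2) \<le> ennreal C"
      unfolding C(1)[symmetric] by (rule le)
    hence "2 ^ k * (cmod (a (Suc k) - a k))\<^sup>2 \<le> C" using C by (simp add: ennreal_le_iff)
    hence "(cmod (a (Suc k) - a k))\<^sup>2 \<le> C / 2 ^ k" by (simp add: field_simps)
    hence "cmod (a (Suc k) - a k) \<le> sqrt (C / 2 ^ k)" by (rule real_le_rsqrt)
    thus ?thesis by (simp add: real_sqrt_divide real_sqrt_power power_divide)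
  qed
  have "summable (\<lambda>k. sqrt C * (1 / sqrt 2) ^ k)" by (intro summable_mult summable_geometric) simp
  hence "summable (\<lambda>k. a (Suc k) - a k)" by (rule summable_comparison_test'[where N=0]) (use b in auto)
  hence "convergent (\<lambda>n. \<Sum>k<n. a (Suc k) - a k)" by (simp add: summable_iff_convergent)
  hence "convergent (\<lambda>n. a n - a 0)" by (simp add: sum_lessThan_telescope)
  hence "convergent (\<lambda>n. (a n - a 0) + a 0)" by (intro convergent_add convergent_const)
  thus ?thesis by simp
qed

lemma nsq_trunc_diff_mono:
  fixes h :: "'a::euclidean_space \<Rightarrow> complex"
  assumes "h \<in> L2" "R \<le> S"
  shows "nsq (\<lambda>x. trunc S h x - trunc R h x) \<le> nsq (\<lambda>x. h x - trunc R h x)"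
  unfolding nsq_def
  by (intro integral_mono L2_integrable L2_diff trunc_L2 assms power_mono) (use assms(2) in \<open>auto simp: trunc_def indicator_def\<close>)

text \<open>An \<open>L2\<close> limit at each time would be determined only up to a null set
  depending on the time, without joint measurability. The truncated data have explicit inverse
  transforms that are jointly measurable. Along radii chosen once for all times these converge
  pointwise almost everywhere, and their pointwise limit is measurable.\<close>

lemma L2_fourier_inverse_param:
  fixes H :: "real \<Rightarrow> 'a::euclidean_space \<Rightarrow> complex"
  assumes Hm[measurable]: "case_prod H \<in> borel_measurable (borel \<Otimes>\<^sub>M borel)"
    and HL: "\<And>t. H t \<in> L2"
    and fin: "(\<integral>\<^sup>+t. ennreal (nsq (H t)) \<partial>lborel) < \<infinity>"
  obtains G where "case_prod G \<in> borel_measurable (borel \<Otimes>\<^sub>M borel)" "AE t in lborel. L2_fourier (G t) (H t)"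
proof -
  define c where "c = 1 / (2 * pi) ^ DIM('a)"
  have c: "c > 0" "c \<le> 1"
  proof -
    have "(1::real) \<le> (2 * pi) ^ DIM('a)" using pi_ge_two by (intro one_le_power) simp
    thus "c \<le> 1" by (simp add: c_def)
  qed (simp add: c_def)
  define T where "T R t = nsq (\<lambda>\<xi>. H t \<xi> - trunc R (H t) \<xi>)" for R t
  have trm[measurable]: "(\<lambda>p. trunc R (H (fst p)) (snd p)) \<in> borel_measurable (borel \<Otimes>\<^sub>M borel)" for R
  proof -
    have "(\<lambda>p::real \<times> 'a. trunc R (H (fst p)) (snd p)) = (\<lambda>p. (if norm (snd p) < R then 1 else 0) * case_prod H p)"
      by (auto simp: trunc_def indicator_def)
    also have "\<dots> \<in> borel_measurable (borel \<Otimes>\<^sub>M borel)" by measurable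
    finally show ?thesis .
  qed
  have Tm[measurable]: "T R \<in> borel_measurable borel" for R unfolding T_def nsq_def by measurable
  have T0: "T R t \<ge> 0" for R t by (simp add: T_def)
  have Tle: "T R t \<le> nsq (H t)" for R t
    unfolding T_def nsq_def
    by (intro integral_mono L2_integrable L2_diff trunc_L2 HL power_mono) (auto simp: trunc_def indicator_def)
  have Tlim: "((\<lambda>R. T R t) \<longlongrightarrow> 0) at_top" for t
    using trunc_tendsto[OF HL, of t] unfolding T_def nsq_def by (simp add: norm_minus_commute)
  have Hint: "integrable lborel (\<lambda>t. nsq (H t))"
  proof (rule integrableI_bounded)
    show "(\<lambda>t. nsq (H t)) \<in> borel_measurable lborel" unfolding nsq_def by measurable
    show "(\<integral>\<^sup>+t. ennreal (norm (nsq (H t))) \<partial>lborel) < \<infinity>" using fin by simp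
  qed
  have TI: "integrable lborel (T R)" for R
    by (rule Bochner_Integration.integrable_bound[OF Hint]) (use Tle T0 in auto)
  have "((\<lambda>R. LINT t|lborel. T R t) \<longlongrightarrow> (LINT t|(lborel::real measure). (0::real))) at_top"
    by (rule integral_dominated_convergence_at_top[OF _ _ Hint]) (use Tlim Tle T0 in \<open>auto intro!: always_eventually\<close>)
  hence Il: "((\<lambda>R. LINT t|lborel. T R t) \<longlongrightarrow> 0) at_top" by simp
  have "\<exists>r. \<forall>R\<ge>r. (LINT t|lborel. T R t) < (1/4) ^ k" for k
  proof -
    have "eventually (\<lambda>R. (LINT t|lborel. T R t) < (1/4) ^ k) at_top"
      by (rule order_tendstoD(2)[OF Il]) simp
    thus ?thesis by (simp add: eventually_at_top_linorder)
  qed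
  then obtain r0 where r0: "\<And>k R. R \<ge> r0 k \<Longrightarrow> (LINT t|lborel. T R t) < (1/4) ^ k" by metis
  \<comment> \<open>The partial sums make the radii increasing and at least \<open>r0 k\<close>; the
    summand \<open>k\<close> makes them unbounded.\<close>
  define r where "r k = (\<Sum>j\<le>k. \<bar>r0 j\<bar>) + real k" for k
  have rmono: "r j \<le> r k" if "j \<le> k" for j k
    unfolding r_def using that by (intro add_mono sum_mono2) auto
  have rk: "r k \<ge> r0 k" for k
  proof -
    have "\<bar>r0 k\<bar> \<le> (\<Sum>j\<le>k. \<bar>r0 j\<bar>)" by (rule member_le_sum) auto
    thus ?thesis by (simp add: r_def)
  qed
  have rtop: "filterlim r at_top sequentially"
  proof (rule filterlim_at_top_mono[OF filterlim_real_sequentially])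
    show "eventually (\<lambda>k. real k \<le> r k) sequentially" by (auto simp: r_def intro!: always_eventually sum_nonneg)
  qed
  have Tr: "(LINT t|lborel. T (r k) t) \<le> (1/4) ^ k" for k using r0[OF rk, of k] by simp
  define g where "g k t = fourier_inverse (trunc (r k) (H t))" for k t
  have gF: "L2_fourier (g k t) (trunc (r k) (H t))" for k t
    unfolding g_def by (intro L2_fourier_inverse trunc_integrable trunc_L2 HL)
  have gm[measurable]: "(\<lambda>p. g k (fst p) (snd p)) \<in> borel_measurable (borel \<Otimes>\<^sub>M borel)" for k
  proof -
    have "(\<lambda>q::(real \<times> 'a) \<times> 'a. (fst (fst q), snd q)) \<in> ((borel \<Otimes>\<^sub>M borel) \<Otimes>\<^sub>M borel) \<rightarrow>\<^sub>M (borel \<Otimes>\<^sub>M borel)"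
      by measurable
    from measurable_compose[OF this trm]
    have [measurable]: "(\<lambda>q::(real \<times> 'a) \<times> 'a. trunc (r k) (H (fst (fst q))) (snd q)) \<in> borel_measurable ((borel \<Otimes>\<^sub>M borel) \<Otimes>\<^sub>M borel)"
      by simp
    show ?thesis unfolding g_def fourier_inverse_def fourier_integral_def by measurable
  qed
  have gL: "g k t \<in> L2" for k t using L2_fourierD(1)[OF gF] .
  have gm1[measurable]: "g k t \<in> borel_measurable borel" for k t by (rule L2_measurable[OF gL])
  have gd: "nsq (\<lambda>x. g l t x - g k t x) \<le> c * T (r k) t" if "k \<le> l" for k l t
  proof -
    have "L2_fourier (\<lambda>x. g l t x + (-1) * g k t x) (\<lambda>\<xi>. trunc (r l) (H t) \<xi> + (-1) * trunc (r k) (H t) \<xi>)"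
      by (rule L2_fourier_add_cmult[OF gF gF])
    from L2_fourier_nsq[OF this]
    have "nsq (\<lambda>x. g l t x - g k t x) = c * nsq (\<lambda>\<xi>. trunc (r l) (H t) \<xi> - trunc (r k) (H t) \<xi>)"
      by (simp add: c_def)
    also have "\<dots> \<le> c * T (r k) t" unfolding T_def
      using c by (intro mult_left_mono nsq_trunc_diff_mono HL rmono that) simp
    finally show ?thesis .
  qed
  \<comment> \<open>\<open>lim\<close> is total, so \<open>G\<close> is defined and measurable
    everywhere; its values where the sequence diverges lie in a null set for almost every
    \<open>t\<close>.\<close>
  define G where "G t x = lim (\<lambda>k. g k t x)" for t x
  have Gm: "case_prod G \<in> borel_measurable (borel \<Otimes>\<^sub>M borel)"
    unfolding G_def case_prod_unfold by measurable
  hence Gm1[measurable]: "G t \<in> borel_measurable borel" for t by measurable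

  \<comment> \<open>The weight \<open>2 ^ k\<close> against tails of size \<open>(1/4) ^ k\<close>
    still leaves a summable \<open>(1/2) ^ k\<close>, and it makes finiteness of the sum imply
    pointwise convergence.\<close>
  define D where "D k p = ennreal (2 ^ k * (cmod (g (Suc k) (fst p) (snd p) - g k (fst p) (snd p)))\<^sup>2)" for k p
  have Dm[measurable]: "D k \<in> borel_measurable (borel \<Otimes>\<^sub>M borel)" for k unfolding D_def by measurable
  have Dint: "(\<integral>\<^sup>+t. (\<integral>\<^sup>+x. D k (t, x) \<partial>lborel) \<partial>lborel) \<le> ennreal ((1/2) ^ k)" for k
  proof -
    have "(\<integral>\<^sup>+x. D k (t, x) \<partial>lborel) \<le> ennreal (2 ^ k * T (r k) t)" for t
    proof -
      have "(\<integral>\<^sup>+x. D k (t, x) \<partial>lborel) = ennreal (2 ^ k) * ennreal (nsq (\<lambda>x. g (Suc k) t x - g k t x))"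
        unfolding D_def by (simp add: ennreal_mult nn_integral_cmult nn_integral_nsq[OF L2_diff[OF gL gL], symmetric])
      also have "\<dots> = ennreal (2 ^ k * nsq (\<lambda>x. g (Suc k) t x - g k t x))" by (simp add: ennreal_mult)
      also have "\<dots> \<le> ennreal (2 ^ k * T (r k) t)"
      proof (intro ennreal_leI mult_left_mono)
        have "c * T (r k) t \<le> 1 * T (r k) t" using c by (intro mult_right_mono T0) auto
        thus "nsq (\<lambda>x. g (Suc k) t x - g k t x) \<le> T (r k) t" using gd[of k "Suc k" t] by simp
      qed simp
      finally show ?thesis .
    qed
    hence "(\<integral>\<^sup>+t. (\<integral>\<^sup>+x. D k (t, x) \<partial>lborel) \<partial>lborel) \<le> (\<integral>\<^sup>+t. ennreal (2 ^ k * T (r k) t) \<partial>lborel)"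
      by (intro nn_integral_mono)
    also have "\<dots> = ennreal (2 ^ k * (LINT t|lborel. T (r k) t))"
      by (subst nn_integral_eq_integral) (auto intro!: integrable_mult_right TI simp: T0)
    also have "\<dots> \<le> ennreal (2 ^ k * (1/4) ^ k)" by (intro ennreal_leI mult_left_mono Tr) simp
    also have "2 ^ k * (1/4) ^ k = ((1/2) ^ k :: real)" by (simp add: power_mult_distrib[symmetric])
    finally show ?thesis .
  qed
  have "(\<integral>\<^sup>+t. (\<integral>\<^sup>+x. (\<Sum>k. D k (t, x)) \<partial>lborel) \<partial>lborel) = (\<Sum>k. \<integral>\<^sup>+t. (\<integral>\<^sup>+x. D k (t, x) \<partial>lborel) \<partial>lborel)"
    by (simp add: nn_integral_suminf)
  also have "\<dots> \<le> (\<Sum>k. ennreal ((1/2) ^ k))" by (intro suminf_le Dint) auto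
  also have "\<dots> < \<infinity>" by (subst suminf_ennreal2) (auto intro!: summable_geometric)
  finally have fin2: "(\<integral>\<^sup>+t. (\<integral>\<^sup>+x. (\<Sum>k. D k (t, x)) \<partial>lborel) \<partial>lborel) < \<infinity>" .
  have "AE t in lborel. (\<integral>\<^sup>+x. (\<Sum>k. D k (t, x)) \<partial>lborel) \<noteq> \<infinity>"
    using fin2 by (intro nn_integral_PInf_AE) auto
  hence "AE t in lborel. L2_fourier (G t) (H t)"
  proof eventually_elim
    case (elim t)
    have "AE x in lborel. (\<Sum>k. D k (t, x)) \<noteq> \<infinity>"
      using elim by (intro nn_integral_PInf_AE) auto
    hence conv: "AE x in lborel. (\<lambda>k. g k t x) \<longlonglongrightarrow> G t x"
    proof eventually_elim
      case (elim x)
      hence "convergent (\<lambda>k. g k t x)" by (intro fast_series_convergent) (simp add: D_def)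
      thus ?case by (simp add: G_def convergent_LIMSEQ_iff)
    qed
    \<comment> \<open>Fatou's lemma as \<open>l\<close> grows: the bound for
      \<open>g l t - g k t\<close> is independent of \<open>l\<close> and passes to the pointwise
      limit, which identifies it as the \<open>L2\<close> limit.\<close>
    have bound: "(\<lambda>x. G t x - g k t x) \<in> L2" "nsq (\<lambda>x. G t x - g k t x) \<le> c * T (r k) t" for k
    proof -
      have "(\<integral>\<^sup>+x. ennreal ((cmod (G t x - g k t x))\<^sup>2) \<partial>lborel) = (\<integral>\<^sup>+x. liminf (\<lambda>l. ennreal ((cmod (g l t x - g k t x))\<^sup>2)) \<partial>lborel)"
      proof (rule nn_integral_cong_AE)
        show "AE x in lborel. ennreal ((cmod (G t x - g k t x))\<^sup>2) = liminf (\<lambda>l. ennreal ((cmod (g l t x - g k t x))\<^sup>2))"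
          using conv
        proof eventually_elim
          case (elim x)
          hence "(\<lambda>l. ennreal ((cmod (g l t x - g k t x))\<^sup>2)) \<longlonglongrightarrow> ennreal ((cmod (G t x - g k t x))\<^sup>2)"
            by (intro tendsto_ennrealI tendsto_intros)
          from lim_imp_Liminf[OF _ this] show ?case by simp
        qed
      qed
      also have "\<dots> \<le> liminf (\<lambda>l. \<integral>\<^sup>+x. ennreal ((cmod (g l t x - g k t x))\<^sup>2) \<partial>lborel)"
        using L2_measurable[OF gL] by (intro nn_integral_liminf) measurable
      also have "\<dots> \<le> limsup (\<lambda>l. \<integral>\<^sup>+x. ennreal ((cmod (g l t x - g k t x))\<^sup>2) \<partial>lborel)"
        by (rule Liminf_le_Limsup) simp
      also have "\<dots> \<le> ennreal (c * T (r k) t)"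
      proof (rule Limsup_bounded)
        show "eventually (\<lambda>l. (\<integral>\<^sup>+x. ennreal ((cmod (g l t x - g k t x))\<^sup>2) \<partial>lborel) \<le> ennreal (c * T (r k) t)) sequentially"
          using eventually_ge_at_top[of k]
          by eventually_elim (simp add: nn_integral_nsq[OF L2_diff[OF gL gL]] gd ennreal_leI)
      qed
      finally have 1: "(\<integral>\<^sup>+x. ennreal ((cmod (G t x - g k t x))\<^sup>2) \<partial>lborel) \<le> ennreal (c * T (r k) t)" .
      have 2: "(\<lambda>x. G t x - g k t x) \<in> borel_measurable borel" using L2_measurable[OF gL] by measurable
      have 3: "c * T (r k) t \<ge> 0" using c T0 by simp
      show "(\<lambda>x. G t x - g k t x) \<in> L2" "nsq (\<lambda>x. G t x - g k t x) \<le> c * T (r k) t" by (rule nsq_le_nn[OF 2 1 3])+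
    qed
    have GL: "G t \<in> L2" using L2_add_cmult(1)[OF bound(1)[of 0] gL[of 0 t], of 1] by simp
    have Tl: "(\<lambda>k. T (r k) t) \<longlonglongrightarrow> 0" by (rule filterlim_compose[OF Tlim rtop])
    have "(\<lambda>k. c * T (r k) t) \<longlonglongrightarrow> c * 0" by (intro tendsto_intros Tl)
    hence "(\<lambda>k. nsq (\<lambda>x. G t x - g k t x)) \<longlonglongrightarrow> 0" unfolding mult_zero_right
      by (rule Lim_null_comparison[rotated]) (intro always_eventually allI, simp only: real_norm_def abs_of_nonneg[OF nsq_nonneg] bound)
    moreover have "(\<lambda>k. nsq (\<lambda>\<xi>. trunc (r k) (H t) \<xi> - H t \<xi>)) \<longlonglongrightarrow> 0"
      using Tl unfolding T_def nsq_def by (simp add: norm_minus_commute)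
    ultimately show ?case by (rule L2_fourier_closed[OF gF GL HL])
  qed
  with Gm show ?thesis by (rule that)
qed

section \<open>Solutions of the free equation\<close>

lemma has_fourier_measurable: "has_fourier f h \<Longrightarrow> h \<in> borel_measurable borel"
  by (auto simp: has_fourier_def L2_def)

text \<open>Outside \<open>L2\<close> only the integral clause can hold, and it determines the
  transform almost everywhere.\<close>

lemma has_fourier_unique:
  fixes f :: "'a::euclidean_space \<Rightarrow> complex"
  assumes 1: "has_fourier f h" and 2: "has_fourier f k" shows "AE \<xi> in lborel. h \<xi> = k \<xi>"
proof (cases "f \<in> L2")
  case True
  show ?thesis using 1 2 L2_fourier_unique unfolding has_fourier_L2_iff[OF True] by blast
next
  case False
  hence "AE \<xi> in lborel. h \<xi> = fourier_integral f \<xi>" "AE \<xi> in lborel. k \<xi> = fourier_integral f \<xi>"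
    using 1 2 by (auto simp: has_fourier_def)
  thus ?thesis by eventually_elim simp
qed

lemma L2_fourier_cong_AE:
  fixes f :: "'a::euclidean_space \<Rightarrow> complex"
  assumes 1: "L2_fourier f h" and k[measurable]: "k \<in> borel_measurable borel" and ae: "AE \<xi> in lborel. h \<xi> = k \<xi>"
  shows "L2_fourier f k"
proof -
  note L = L2_fourierD[OF 1]
  have [measurable]: "f \<in> borel_measurable borel" "h \<in> borel_measurable borel" using L by (auto simp: L2_def)
  have "nsq (\<lambda>\<xi>. fourier_integral (trunc R f) \<xi> - k \<xi>) = nsq (\<lambda>\<xi>. fourier_integral (trunc R f) \<xi> - h \<xi>)" for R
    by (rule nsq_cong_AE) (use ae in auto)
  thus ?thesis using 1 L2_cong_AE[OF L(2) k ae] by (simp add: L2_fourier_def)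
qed

text \<open>The existentially quantified transform in \<open>has_frac_laplacian\<close> is replaced
  by a given one, by uniqueness.\<close>

lemma frac_laplacian_fourier:
  fixes F :: "'a::euclidean_space \<Rightarrow> complex"
  assumes g: "has_frac_laplacian \<sigma> F g" and h: "has_fourier F h"
  shows "L2_fourier g (\<lambda>\<xi>. complex_of_real (norm \<xi> powr (2 * \<sigma>)) * h \<xi>)"
proof -
  obtain k where gL: "g \<in> L2" and k: "has_fourier F k" and gk: "has_fourier g (\<lambda>\<xi>. complex_of_real (norm \<xi> powr (2 * \<sigma>)) * k \<xi>)"
    using g by (auto simp: has_frac_laplacian_def)
  have [measurable]: "h \<in> borel_measurable borel" by (rule has_fourier_measurable[OF h])
  show ?thesis
    by (rule L2_fourier_cong_AE[OF gk[unfolded has_fourier_L2_iff[OF gL]]])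
       (use has_fourier_unique[OF k h] in auto)
qed

text \<open>\<open>|v|^2\<close> is integrable, so its transform is an honest integral, namely the
  pairing of the modulated \<open>v\<close> with \<open>v\<close>; Parseval carries it to the
  frequency side.\<close>

lemma density_fourier:
  fixes v :: "'a::euclidean_space \<Rightarrow> complex"
  assumes v: "L2_fourier v h"
  shows "has_fourier (\<lambda>x. complex_of_real ((cmod (v x))\<^sup>2)) (\<lambda>\<xi>. ip (\<lambda>\<eta>. h (\<xi> + \<eta>)) h / complex_of_real ((2 * pi) ^ DIM('a)))"
proof -
  note L = L2_fourierD[OF v]
  have [measurable]: "h \<in> borel_measurable borel" using L by (auto simp: L2_def)
  have "fourier_integral (\<lambda>x. complex_of_real ((cmod (v x))\<^sup>2)) \<xi> = ip (\<lambda>\<eta>. h (\<xi> + \<eta>)) h / complex_of_real ((2 * pi) ^ DIM('a))" for \<xi>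
  proof -
    have "fourier_integral (\<lambda>x. complex_of_real ((cmod (v x))\<^sup>2)) \<xi> = ip (\<lambda>x. v x * exp (- \<i> * complex_of_real (\<xi> \<bullet> x))) v"
      unfolding fourier_integral_def ip_def complex_norm_square by (simp add: mult_ac inner_commute)
    thus ?thesis using parseval[OF L2_fourier_modulate[OF v, of \<xi>] v] by simp
  qed
  moreover have "integrable lborel (\<lambda>x. complex_of_real ((cmod (v x))\<^sup>2))"
    using L2_integrable[OF L(1)] unfolding complex_of_real_integrable_eq .
  moreover have "(\<lambda>\<xi>. ip (\<lambda>\<eta>. h (\<xi> + \<eta>)) h / complex_of_real ((2 * pi) ^ DIM('a))) \<in> borel_measurable borel"
    unfolding ip_def by measurable
  ultimately show ?thesis by (auto simp: has_fourier_def)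
qed

text \<open>In \<open>|\<xi> + \<eta>|^2 - |\<eta>|^2 = |\<xi>|^2 + 2 * (\<xi> \<bullet>
  \<eta>)\<close> the part quadratic in \<open>\<eta>\<close> cancels. The remaining phase is linear
  in \<open>\<eta>\<close>, which is why time acts as a Fourier variable.\<close>

lemma ip_evolution:
  fixes f :: "'a::euclidean_space \<Rightarrow> complex"
  shows "ip (\<lambda>\<eta>. exp (- \<i> * complex_of_real (t * (norm (\<xi> + \<eta>))\<^sup>2)) * f (\<xi> + \<eta>)) (\<lambda>\<eta>. exp (- \<i> * complex_of_real (t * (norm \<eta>)\<^sup>2)) * f \<eta>)
    = exp (- \<i> * complex_of_real (t * (norm \<xi>)\<^sup>2)) * interaction f t \<xi>"
proof -
  have e: "exp (- \<i> * complex_of_real (t * (norm (\<xi> + \<eta>))\<^sup>2)) * cnj (exp (- \<i> * complex_of_real (t * (norm \<eta>)\<^sup>2)))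
     = exp (- \<i> * complex_of_real (t * (norm \<xi>)\<^sup>2)) * exp (- \<i> * complex_of_real (2 * t * (\<xi> \<bullet> \<eta>)))" for \<eta>
  proof -
    have n: "t * (norm (\<xi> + \<eta>))\<^sup>2 - t * (norm \<eta>)\<^sup>2 = t * (norm \<xi>)\<^sup>2 + 2 * t * (\<xi> \<bullet> \<eta>)"
      by (simp add: power2_norm_eq_inner inner_add_left inner_add_right inner_commute algebra_simps)
    have "cnj (exp (- \<i> * complex_of_real (t * (norm \<eta>)\<^sup>2))) = exp (\<i> * complex_of_real (t * (norm \<eta>)\<^sup>2))"
      by (simp add: exp_cnj)
    hence "exp (- \<i> * complex_of_real (t * (norm (\<xi> + \<eta>))\<^sup>2)) * cnj (exp (- \<i> * complex_of_real (t * (norm \<eta>)\<^sup>2)))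
      = exp (- \<i> * complex_of_real (t * (norm (\<xi> + \<eta>))\<^sup>2 - t * (norm \<eta>)\<^sup>2))"
      by (simp only: exp_add[symmetric]) (simp add: algebra_simps)
    also have "\<dots> = exp (- \<i> * complex_of_real (t * (norm \<xi>)\<^sup>2)) * exp (- \<i> * complex_of_real (2 * t * (\<xi> \<bullet> \<eta>)))"
      unfolding n by (simp only: exp_add[symmetric] of_real_add distrib_left)
    finally show ?thesis .
  qed
  have "ip (\<lambda>\<eta>. exp (- \<i> * complex_of_real (t * (norm (\<xi> + \<eta>))\<^sup>2)) * f (\<xi> + \<eta>)) (\<lambda>\<eta>. exp (- \<i> * complex_of_real (t * (norm \<eta>)\<^sup>2)) * f \<eta>)
     = (LINT \<eta>|lborel. exp (- \<i> * complex_of_real (t * (norm \<xi>)\<^sup>2)) * (exp (- \<i> * complex_of_real (2 * t * (\<xi> \<bullet> \<eta>))) * (f (\<xi> + \<eta>) * cnj (f \<eta>))))"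
    unfolding ip_def
  proof (intro Bochner_Integration.integral_cong refl)
    fix \<eta>
    have "exp (- \<i> * complex_of_real (t * (norm (\<xi> + \<eta>))\<^sup>2)) * f (\<xi> + \<eta>) * cnj (exp (- \<i> * complex_of_real (t * (norm \<eta>)\<^sup>2)) * f \<eta>)
      = (exp (- \<i> * complex_of_real (t * (norm (\<xi> + \<eta>))\<^sup>2)) * cnj (exp (- \<i> * complex_of_real (t * (norm \<eta>)\<^sup>2)))) * (f (\<xi> + \<eta>) * cnj (f \<eta>))"
      unfolding complex_cnj_mult by (simp only: mult_ac)
    thus "exp (- \<i> * complex_of_real (t * (norm (\<xi> + \<eta>))\<^sup>2)) * f (\<xi> + \<eta>) * cnj (exp (- \<i> * complex_of_real (t * (norm \<eta>)\<^sup>2)) * f \<eta>)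
      = exp (- \<i> * complex_of_real (t * (norm \<xi>)\<^sup>2)) * (exp (- \<i> * complex_of_real (2 * t * (\<xi> \<bullet> \<eta>))) * (f (\<xi> + \<eta>) * cnj (f \<eta>)))"
      unfolding e by (simp only: mult.assoc)
  qed
  thus ?thesis unfolding interaction_def integral_mult_right_zero .
qed

definition interaction_energy :: "('a::euclidean_space \<Rightarrow> complex) \<Rightarrow> ennreal" where
  "interaction_energy f = (\<integral>\<^sup>+\<xi>. ennreal (norm \<xi> powr (4 - real DIM('a))) * (\<integral>\<^sup>+t. ennreal ((cmod (interaction f t \<xi>))\<^sup>2) \<partial>lborel) \<partial>lborel)"

lemma nn_integral_lborel_pair:
  fixes G :: "real \<times> 'a::euclidean_space \<Rightarrow> complex"
  assumes "G \<in> borel_measurable borel"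
  shows "(\<integral>\<^sup>+z. ennreal ((cmod (G z))\<^sup>2) \<partial>lborel) = (\<integral>\<^sup>+t. (\<integral>\<^sup>+x. ennreal ((cmod (G (t, x)))\<^sup>2) \<partial>lborel) \<partial>lborel)"
proof -
  have [measurable]: "G \<in> borel_measurable (borel \<Otimes>\<^sub>M borel)" using assms by (simp add: borel_prod)
  show ?thesis unfolding lborel_prod[symmetric] by (subst lborel.nn_integral_fst[symmetric]) auto
qed

text \<open>Plancherel in space at each time. Of the three factors \<open>1 / (2 * pi) ^ d\<close>,
  two come from squaring the normalisation in \<open>density_fourier\<close> and one from
  Plancherel.\<close>

theorem density_frac_laplacian:
  fixes f :: "'a::euclidean_space \<Rightarrow> complex" and u :: "real \<times> 'a \<Rightarrow> complex"
  defines "\<sigma> \<equiv> (4 - real DIM('a)) / 4"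
  assumes f: "f \<in> L2"
    and u: "\<And>t. L2_fourier (\<lambda>x. u (t, x)) (\<lambda>\<xi>. exp (- \<i> * complex_of_real (t * (norm \<xi>)\<^sup>2)) * f \<xi>)"
    and fin: "interaction_energy f < \<infinity>"
  shows "\<exists>G. has_spatial_frac_laplacian \<sigma> (\<lambda>z. complex_of_real ((cmod (u z))\<^sup>2)) G"
    and "\<And>G. has_spatial_frac_laplacian \<sigma> (\<lambda>z. complex_of_real ((cmod (u z))\<^sup>2)) G \<Longrightarrow>
      ennreal (nsq G) = ennreal (1 / ((2 * pi) ^ DIM('a)) ^ 3) * interaction_energy f"
proof -
  have fm[measurable]: "f \<in> borel_measurable borel" using f by measurable
  define C where "C = (2 * pi) ^ DIM('a)"
  have C: "C > 0" by (simp add: C_def)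
  define W where "W t \<xi> = exp (- \<i> * complex_of_real (t * (norm \<xi>)\<^sup>2)) * interaction f t \<xi> / complex_of_real C" for t \<xi>
  define H where "H t \<xi> = complex_of_real (norm \<xi> powr (2 * \<sigma>)) * W t \<xi>" for t \<xi>
  have Wm[measurable]: "case_prod W \<in> borel_measurable (borel \<Otimes>\<^sub>M borel)"
    unfolding W_def case_prod_unfold by measurable
  have Hm[measurable]: "case_prod H \<in> borel_measurable (borel \<Otimes>\<^sub>M borel)"
    unfolding H_def case_prod_unfold by measurable
  have W: "has_fourier (\<lambda>x. complex_of_real ((cmod (u (t, x)))\<^sup>2)) (W t)" for t
    using density_fourier[OF u[of t]] unfolding ip_evolution W_def C_def .
  have Hsq: "ennreal ((cmod (H t \<xi>))\<^sup>2) = ennreal (1 / C\<^sup>2) * (ennreal (norm \<xi> powr (4 - real DIM('a))) * ennreal ((cmod (interaction f t \<xi>))\<^sup>2))" for t \<xi>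
  proof -
    have "(norm \<xi> powr (2 * \<sigma>))\<^sup>2 = norm \<xi> powr (4 - real DIM('a))"
    proof -
      have "2 * \<sigma> + 2 * \<sigma> = 4 * \<sigma>" by simp
      also have "\<dots> = 4 - real DIM('a)" by (simp add: \<sigma>_def)
      finally have "2 * \<sigma> + 2 * \<sigma> = 4 - real DIM('a)" .
      thus ?thesis unfolding power2_eq_square powr_add[symmetric] by (rule arg_cong)
    qed
    hence "(cmod (H t \<xi>))\<^sup>2 = 1 / C\<^sup>2 * (norm \<xi> powr (4 - real DIM('a)) * (cmod (interaction f t \<xi>))\<^sup>2)"
      using C by (simp add: H_def W_def norm_mult norm_divide power_mult_distrib power_divide)
    thus ?thesis using C by (simp only: ennreal_mult[symmetric] zero_le_power2 powr_ge_zero mult_nonneg_nonneg) (subst ennreal_mult[symmetric], auto)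
  qed
  have Hint: "(\<integral>\<^sup>+t. (\<integral>\<^sup>+\<xi>. ennreal ((cmod (H t \<xi>))\<^sup>2) \<partial>lborel) \<partial>lborel) = ennreal (1 / C\<^sup>2) * interaction_energy f"
  proof -
    have "(\<integral>\<^sup>+t. (\<integral>\<^sup>+\<xi>. ennreal ((cmod (H t \<xi>))\<^sup>2) \<partial>lborel) \<partial>lborel) = (\<integral>\<^sup>+\<xi>. (\<integral>\<^sup>+t. ennreal ((cmod (H t \<xi>))\<^sup>2) \<partial>lborel) \<partial>lborel)"
      by (rule lborel_pair.Fubini'[symmetric]) measurable
    also have "\<dots> = ennreal (1 / C\<^sup>2) * interaction_energy f"
    proof -
      have [measurable]: "(\<lambda>t. interaction f t \<xi>) \<in> borel_measurable borel" for \<xi>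
        unfolding interaction_def by measurable
      have [measurable]: "(\<lambda>\<xi>. \<integral>\<^sup>+t. ennreal ((cmod (interaction f t \<xi>))\<^sup>2) \<partial>lborel) \<in> borel_measurable borel"
        unfolding interaction_def by measurable
      show ?thesis unfolding Hsq interaction_energy_def by (simp add: nn_integral_cmult)
    qed
    finally show ?thesis .
  qed
  have Hfin: "(\<integral>\<^sup>+t. (\<integral>\<^sup>+\<xi>. ennreal ((cmod (H t \<xi>))\<^sup>2) \<partial>lborel) \<partial>lborel) < \<infinity>"
    unfolding Hint using fin by (simp add: ennreal_mult_less_top)
  define good where "good t \<longleftrightarrow> (\<integral>\<^sup>+\<xi>. ennreal ((cmod (H t \<xi>))\<^sup>2) \<partial>lborel) < \<infinity>" for t
  have goodm[measurable]: "Measurable.pred borel good" unfolding good_def by measurable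
  have good: "AE t in lborel. good t"
  proof -
    have "AE t in lborel. (\<integral>\<^sup>+\<xi>. ennreal ((cmod (H t \<xi>))\<^sup>2) \<partial>lborel) \<noteq> \<infinity>"
      using Hfin by (intro nn_integral_PInf_AE) auto
    thus ?thesis by (simp add: good_def less_top)
  qed
  \<comment> \<open>The parametric inversion asks for square integrable data at every time, so the
    data are set to 0 on the null set of bad times.\<close>
  define H' where "H' t \<xi> = (if good t then H t \<xi> else 0)" for t \<xi>
  have H'm[measurable]: "case_prod H' \<in> borel_measurable (borel \<Otimes>\<^sub>M borel)"
    unfolding H'_def case_prod_unfold by measurable
  have H'L: "H' t \<in> L2" for t
  proof (cases "good t")
    case True
    have "H t \<in> borel_measurable borel" unfolding H_def W_def interaction_def by measurable
    thus ?thesis using True unfolding H'_def[abs_def] L2_iff_nn by (simp add: good_def)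
  qed (simp add: H'_def[abs_def] L2_def)
  have "(\<integral>\<^sup>+t. ennreal (nsq (H' t)) \<partial>lborel) \<le> (\<integral>\<^sup>+t. (\<integral>\<^sup>+\<xi>. ennreal ((cmod (H t \<xi>))\<^sup>2) \<partial>lborel) \<partial>lborel)"
    unfolding nn_integral_nsq[OF H'L, symmetric] by (intro nn_integral_mono) (auto simp: H'_def)
  hence H'fin: "(\<integral>\<^sup>+t. ennreal (nsq (H' t)) \<partial>lborel) < \<infinity>" using Hfin by (rule le_less_trans)
  obtain G where Gm[measurable]: "case_prod G \<in> borel_measurable (borel \<Otimes>\<^sub>M borel)" and GF: "AE t in lborel. L2_fourier (G t) (H' t)"
    by (rule L2_fourier_inverse_param[OF H'm H'L H'fin])
  have Gb: "case_prod G \<in> borel_measurable borel" using Gm by (simp add: borel_prod)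
  have "(\<integral>\<^sup>+z. ennreal ((cmod (case_prod G z))\<^sup>2) \<partial>lborel) = (\<integral>\<^sup>+t. (\<integral>\<^sup>+x. ennreal ((cmod (G t x))\<^sup>2) \<partial>lborel) \<partial>lborel)"
    unfolding nn_integral_lborel_pair[OF Gb] by simp
  also have "\<dots> \<le> (\<integral>\<^sup>+t. ennreal (1 / C) * ennreal (nsq (H' t)) \<partial>lborel)"
  proof (rule nn_integral_mono_AE)
    show "AE t in lborel. (\<integral>\<^sup>+x. ennreal ((cmod (G t x))\<^sup>2) \<partial>lborel) \<le> ennreal (1 / C) * ennreal (nsq (H' t))"
      using GF
    proof eventually_elim
      case (elim t)
      show ?case unfolding nn_integral_nsq[OF L2_fourierD(1)[OF elim]] L2_fourier_nsq[OF elim] C_def[symmetric]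
        using C by (simp add: ennreal_mult[symmetric])
    qed
  qed
  also have "\<dots> = ennreal (1 / C) * (\<integral>\<^sup>+t. ennreal (nsq (H' t)) \<partial>lborel)"
    by (rule nn_integral_cmult) (auto simp: nsq_def)
  also have "\<dots> < \<infinity>" using H'fin by (simp add: ennreal_mult_less_top)
  finally have GL: "case_prod G \<in> L2" using Gb by (simp add: L2_iff_nn)
  have "AE t in lborel. has_frac_laplacian \<sigma> (\<lambda>x. complex_of_real ((cmod (u (t, x)))\<^sup>2)) (G t)"
    using GF good
  proof eventually_elim
    case (elim t)
    have "L2_fourier (G t) (\<lambda>\<xi>. complex_of_real (norm \<xi> powr (2 * \<sigma>)) * W t \<xi>)"
      using elim by (simp add: H'_def[abs_def] H_def[abs_def])
    thus ?case unfolding has_frac_laplacian_def using W[of t] by (metis L2_fourierD(1) has_fourier_L2_iff)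
  qed
  hence "has_spatial_frac_laplacian \<sigma> (\<lambda>z. complex_of_real ((cmod (u z))\<^sup>2)) (case_prod G)"
    using GL by (simp add: has_spatial_frac_laplacian_def)
  thus "\<exists>G. has_spatial_frac_laplacian \<sigma> (\<lambda>z. complex_of_real ((cmod (u z))\<^sup>2)) G" by blast
  \<comment> \<open>The norm is computed for an arbitrary candidate, so the choice made in
    \<open>spatial_frac_laplacian\<close> does not matter.\<close>
  fix G assume G: "has_spatial_frac_laplacian \<sigma> (\<lambda>z. complex_of_real ((cmod (u z))\<^sup>2)) G"
  hence GL: "G \<in> L2" and GA: "AE t in lborel. has_frac_laplacian \<sigma> (\<lambda>x. complex_of_real ((cmod (u (t, x)))\<^sup>2)) (\<lambda>x. G (t, x))"
    by (auto simp: has_spatial_frac_laplacian_def)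
  have "ennreal (nsq G) = (\<integral>\<^sup>+t. (\<integral>\<^sup>+x. ennreal ((cmod (G (t, x)))\<^sup>2) \<partial>lborel) \<partial>lborel)"
    unfolding nn_integral_nsq[OF GL, symmetric] by (rule nn_integral_lborel_pair) (use GL in measurable)
  also have "\<dots> = (\<integral>\<^sup>+t. ennreal (1 / C) * (\<integral>\<^sup>+\<xi>. ennreal ((cmod (H t \<xi>))\<^sup>2) \<partial>lborel) \<partial>lborel)"
  proof (rule nn_integral_cong_AE)
    show "AE t in lborel. (\<integral>\<^sup>+x. ennreal ((cmod (G (t, x)))\<^sup>2) \<partial>lborel) = ennreal (1 / C) * (\<integral>\<^sup>+\<xi>. ennreal ((cmod (H t \<xi>))\<^sup>2) \<partial>lborel)"
      using GA
    proof eventually_elim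
      case (elim t)
      have F: "L2_fourier (\<lambda>x. G (t, x)) (H t)"
        unfolding H_def by (rule frac_laplacian_fourier[OF elim W])
      show ?case unfolding nn_integral_nsq[OF L2_fourierD(1)[OF F]] nn_integral_nsq[OF L2_fourierD(2)[OF F]] L2_fourier_nsq[OF F] C_def[symmetric]
        using C by (simp add: ennreal_mult[symmetric])
    qed
  qed
  also have "\<dots> = ennreal (1 / C) * (ennreal (1 / C\<^sup>2) * interaction_energy f)"
    unfolding Hint[symmetric] by (rule nn_integral_cmult) measurable
  also have "\<dots> = ennreal (1 / C ^ 3) * interaction_energy f"
    unfolding mult.assoc[symmetric] using C by (simp add: ennreal_mult[symmetric] power2_eq_square power3_eq_cube mult.assoc)
  finally show "ennreal (nsq G) = ennreal (1 / ((2 * pi) ^ DIM('a)) ^ 3) * interaction_energy f" unfolding C_def .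
qed

section \<open>The sharp estimate\<close>

definition momentum :: "('a::euclidean_space \<Rightarrow> complex) \<Rightarrow> 'a" where
  "momentum f = (LINT x|lborel. (cmod (f x))\<^sup>2 *\<^sub>R x)"

text \<open>Both coefficients are those of \<open>interaction_identity\<close> and
  \<open>pair_moment\<close> combined, the denominator that of
  \<open>density_frac_laplacian\<close>. \<open>enn2real\<close> would turn an infinite defect into
  0; \<open>interaction_energy_eq\<close> excludes that case.\<close>

definition deficit :: "('a::euclidean_space \<Rightarrow> complex) \<Rightarrow> real" where
  "deficit f = (pi * real DIM('a) / 4 * enn2real (total_defect f) + pi * unit_ball_vol (real DIM('a)) * (norm (momentum f))\<^sup>2)
     / ((2 * pi) ^ DIM('a)) ^ 3"

lemma deficit_nonneg: "deficit f \<ge> 0"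
  unfolding deficit_def by (intro divide_nonneg_nonneg add_nonneg_nonneg mult_nonneg_nonneg) auto

text \<open>With a finite second moment the right-hand side of \<open>interaction_identity\<close>
  is finite, hence so are both summands on the left, and the identity may be rearranged with real
  numbers.\<close>

lemma interaction_energy_eq:
  fixes f :: "'a::euclidean_space \<Rightarrow> complex"
  assumes f: "f \<in> L2" and m: "integrable lborel (\<lambda>x. (norm x)\<^sup>2 * (cmod (f x))\<^sup>2)"
  shows "interaction_energy f < \<infinity>" "total_defect f < \<infinity>"
    and "enn2real (interaction_energy f) / ((2 * pi) ^ DIM('a)) ^ 3 =
      pi * unit_ball_vol (real DIM('a)) * (nsq f * (LINT x|lborel. (norm x)\<^sup>2 * (cmod (f x))\<^sup>2)) / ((2 * pi) ^ DIM('a)) ^ 3 - deficit f"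
proof -
  let ?b = "unit_ball_vol (real DIM('a))" and ?d = "real DIM('a)"
  define X where "X = nsq f * (LINT x|lborel. (norm x)\<^sup>2 * (cmod (f x))\<^sup>2) - (norm (momentum f))\<^sup>2"
  have X0: "X \<ge> 0" using pair_moment(3)[OF f m] by (simp add: X_def momentum_def)
  have d: "?d > 0" by simp
  have I: "interaction_energy f + ennreal (pi * ?d / 4) * total_defect f = ennreal (pi * ?b * X)"
  proof -
    have "interaction_energy f + ennreal (pi * ?d / 4) * total_defect f = ennreal (pi * ?b / 2) * ennreal (2 * X)"
      using interaction_identity[OF f] unfolding interaction_energy_def pair_moment(2)[OF f m] X_def momentum_def .
    also have "\<dots> = ennreal (pi * ?b * X)" using X0 by (subst ennreal_mult[symmetric]) auto
    finally show ?thesis .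
  qed
  have lt: "interaction_energy f + ennreal (pi * ?d / 4) * total_defect f < \<infinity>" unfolding I by simp
  thus a: "interaction_energy f < \<infinity>" by simp
  have p: "ennreal (pi * ?d / 4) \<noteq> 0" using d by simp
  from lt show b: "total_defect f < \<infinity>" using p by (auto simp: ennreal_mult_less_top)
  have "enn2real (interaction_energy f) + pi * ?d / 4 * enn2real (total_defect f) = pi * ?b * X"
  proof -
    obtain q where q: "interaction_energy f = ennreal q" "q \<ge> 0" using a by (cases "interaction_energy f") auto
    obtain D where D: "total_defect f = ennreal D" "D \<ge> 0" using b by (cases "total_defect f") auto
    have "ennreal (enn2real (interaction_energy f) + pi * ?d / 4 * enn2real (total_defect f))
       = interaction_energy f + ennreal (pi * ?d / 4) * total_defect f"
      unfolding q(1) D(1) using q(2) D(2)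
      by (subst ennreal_mult[symmetric], simp, simp, subst ennreal_plus[symmetric]) (simp_all del: ennreal_plus)
    also have "\<dots> = ennreal (pi * ?b * X)" by (rule I)
    finally show ?thesis using X0 by (subst (asm) ennreal_inj) (auto intro!: add_nonneg_nonneg mult_nonneg_nonneg)
  qed
  thus "enn2real (interaction_energy f) / ((2 * pi) ^ DIM('a)) ^ 3 =
      pi * ?b * (nsq f * (LINT x|lborel. (norm x)\<^sup>2 * (cmod (f x))\<^sup>2)) / ((2 * pi) ^ DIM('a)) ^ 3 - deficit f"
    unfolding deficit_def diff_divide_distrib[symmetric] X_def by (simp add: algebra_simps)
qed

definition sharp_const :: "nat \<Rightarrow> real" where
  "sharp_const d = 2 powr (- real d) * pi powr ((2 - real d) / 2) / Gamma ((real d + 2) / 2)"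

text \<open>The Gamma function enters only through the volume of the unit ball,
  \<open>pi powr (d / 2) / Gamma (d / 2 + 1)\<close>.\<close>

lemma sharp_const_eq: "sharp_const d = pi * unit_ball_vol (real d) / (2 * pi) ^ d"
proof -
  have "pi powr ((2 - real d) / 2) * pi ^ d = pi * pi powr (real d / 2)"
  proof -
    have "pi powr ((2 - real d) / 2) * pi ^ d = pi powr ((2 - real d) / 2 + real d)"
      by (simp add: powr_add powr_realpow)
    also have "(2 - real d) / 2 + real d = 1 + real d / 2" by (simp add: field_simps)
    finally show ?thesis by (simp add: powr_add)
  qed
  moreover have "2 powr (- real d) * 2 ^ d = (1::real)" by (simp add: powr_minus powr_realpow)
  ultimately have "(2 powr (- real d) * pi powr ((2 - real d) / 2)) * (2 * pi) ^ d = pi * pi powr (real d / 2)"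
    by (simp add: power_mult_distrib mult_ac) (metis mult.assoc mult.commute mult_1)
  hence "2 powr (- real d) * pi powr ((2 - real d) / 2) = pi * pi powr (real d / 2) / (2 * pi) ^ d"
    by (simp add: field_simps)
  moreover have "Gamma ((real d + 2) / 2) = Gamma (real d / 2 + 1)" by (rule arg_cong) (simp add: field_simps)
  ultimately show ?thesis by (simp add: sharp_const_def unit_ball_vol_def)
qed

text \<open>Membership in \<open>Sobolev 1\<close> makes the choice in \<open>frac_laplacian\<close>
  a genuine one; its transform has multiplier \<open>norm \<xi>\<close>, and Plancherel gives the
  norm.\<close>

lemma Hdot_norm_fourier:
  fixes u0 :: "'a::euclidean_space \<Rightarrow> complex"
  assumes u0: "u0 \<in> Sobolev 1" and f: "L2_fourier u0 f"
  shows "integrable lborel (\<lambda>x. (norm x)\<^sup>2 * (cmod (f x))\<^sup>2)"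
    and "(LINT x|lborel. (norm x)\<^sup>2 * (cmod (f x))\<^sup>2) = (2 * pi) ^ DIM('a) * (Hdot_norm 1 u0)\<^sup>2"
proof -
  have "\<exists>g. has_frac_laplacian (1 / 2) u0 g" using u0 by (auto simp: Sobolev_def)
  hence g: "has_frac_laplacian (1 / 2) u0 (frac_laplacian (1 / 2) u0)"
    unfolding frac_laplacian_def by (rule someI_ex)
  have "has_fourier u0 f" using f L2_fourierD(1)[OF f] by (simp add: has_fourier_L2_iff)
  from frac_laplacian_fourier[OF g this]
  have F: "L2_fourier (frac_laplacian (1 / 2) u0) (\<lambda>\<xi>. complex_of_real (norm \<xi>) * f \<xi>)" by simp
  have e: "(cmod (complex_of_real (norm x) * f x))\<^sup>2 = (norm x)\<^sup>2 * (cmod (f x))\<^sup>2" for x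
    by (simp add: norm_mult power_mult_distrib)
  show "integrable lborel (\<lambda>x. (norm x)\<^sup>2 * (cmod (f x))\<^sup>2)"
    using L2_integrable[OF L2_fourierD(2)[OF F]] unfolding e .
  show "(LINT x|lborel. (norm x)\<^sup>2 * (cmod (f x))\<^sup>2) = (2 * pi) ^ DIM('a) * (Hdot_norm 1 u0)\<^sup>2"
    using L2_fourier_nsq[OF F] unfolding nsq_def[of "\<lambda>\<xi>. complex_of_real (norm \<xi>) * f \<xi>"] e Hdot_norm_def L2_norm_power2 .
qed

text \<open>The two norms of the data contribute \<open>(2 * pi) ^ d\<close> each on the Fourier
  side, which leaves a single such power of the three in the denominator. The estimate and its
  equality case both follow from this identity.\<close>

theorem sharp_identity:
  fixes f :: "'a::euclidean_space \<Rightarrow> complex" and u :: "real \<times> 'a \<Rightarrow> complex"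
  defines "\<sigma> \<equiv> (4 - real DIM('a)) / 4"
  assumes u0: "u0 \<in> Sobolev 1" and f: "L2_fourier u0 f"
    and u: "\<And>t. L2_fourier (\<lambda>x. u (t, x)) (\<lambda>\<xi>. exp (- \<i> * complex_of_real (t * (norm \<xi>)\<^sup>2)) * f \<xi>)"
  shows "\<exists>G. has_spatial_frac_laplacian \<sigma> (\<lambda>z. complex_of_real ((cmod (u z))\<^sup>2)) G"
    and "(L2_norm (spatial_frac_laplacian \<sigma> (\<lambda>z. complex_of_real ((cmod (u z))\<^sup>2))))\<^sup>2
      = sharp_const DIM('a) * ((Hdot_norm 1 u0)\<^sup>2 * (L2_norm u0)\<^sup>2) - deficit f"
proof -
  note fL = L2_fourierD(2)[OF f]
  note H = Hdot_norm_fourier[OF u0 f]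
  note E = interaction_energy_eq[OF fL H(1)]
  note D = density_frac_laplacian[OF fL u E(1), folded \<sigma>_def]
  show ex: "\<exists>G. has_spatial_frac_laplacian \<sigma> (\<lambda>z. complex_of_real ((cmod (u z))\<^sup>2)) G" by (rule D(1))
  let ?G = "spatial_frac_laplacian \<sigma> (\<lambda>z. complex_of_real ((cmod (u z))\<^sup>2))"
  have "has_spatial_frac_laplacian \<sigma> (\<lambda>z. complex_of_real ((cmod (u z))\<^sup>2)) ?G"
    unfolding spatial_frac_laplacian_def using ex by (rule someI_ex)
  from D(2)[OF this] have n: "ennreal (nsq ?G) = ennreal (1 / ((2 * pi) ^ DIM('a)) ^ 3) * interaction_energy f" .
  have "nsq ?G = enn2real (interaction_energy f) / ((2 * pi) ^ DIM('a)) ^ 3"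
    using arg_cong[OF n, of enn2real] by (simp add: enn2real_mult)
  also have "\<dots> = sharp_const DIM('a) * ((Hdot_norm 1 u0)\<^sup>2 * (L2_norm u0)\<^sup>2) - deficit f"
    unfolding E(3) H(2) L2_fourier_nsq[OF f] sharp_const_eq L2_norm_power2
    by (simp add: power3_eq_cube mult_ac)
  finally show "(L2_norm ?G)\<^sup>2 = sharp_const DIM('a) * ((Hdot_norm 1 u0)\<^sup>2 * (L2_norm u0)\<^sup>2) - deficit f"
    unfolding L2_norm_power2 .
qed

section \<open>Extremisers\<close>

text \<open>Collisions conserve \<open>x + y\<close> and \<open>|x|^2 + |y|^2\<close>, and the
  product of the two values depends on nothing else.\<close>

lemma quad_exp_reflection_defect:
  assumes "norm \<omega> = 1"
  shows "reflection_defect (quad_exp a 0 \<gamma> c) \<omega> x y = 0"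
proof -
  let ?x = "x - (\<omega> \<bullet> (x - y)) *\<^sub>R \<omega>" and ?y = "y + (\<omega> \<bullet> (x - y)) *\<^sub>R \<omega>"
  have p: "quad_exp a 0 \<gamma> c x * quad_exp a 0 \<gamma> c y
      = exp (a * complex_of_real ((norm x)\<^sup>2 + (norm y)\<^sup>2) + \<i> * complex_of_real (\<gamma> \<bullet> (x + y)) + 2 * c)" for x y :: 'a
    by (simp add: quad_exp_def exp_add[symmetric] inner_add_right algebra_simps)
  have "?x + ?y = x + y" by simp
  thus ?thesis unfolding reflection_defect_def p reflection_norm[OF assms] by simp
qed

lemma quad_exp_even: "cmod (quad_exp a 0 \<gamma> c (- x)) = cmod (quad_exp a 0 \<gamma> c x)"
  by (simp add: norm_quad_exp)

lemma momentum_even: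
  fixes f :: "'a::euclidean_space \<Rightarrow> complex"
  assumes [measurable]: "f \<in> borel_measurable borel" and e: "\<And>x. cmod (f (- x)) = cmod (f x)"
  shows "momentum f = 0"
proof -
  have "momentum f = (LINT x|lborel. (cmod (f (0 - x)))\<^sup>2 *\<^sub>R (0 - x))"
    unfolding momentum_def by (rule integral_lborel_reflect[symmetric, of "\<lambda>x. (cmod (f x))\<^sup>2 *\<^sub>R x"]) measurable
  also have "\<dots> = - momentum f" unfolding momentum_def by (simp add: e)
  finally have "2 *\<^sub>R momentum f = 0" unfolding scaleR_2 by (simp only: eq_neg_iff_add_eq_0)
  thus ?thesis by simp
qed

lemma momentum_cong_AE:
  fixes f :: "'a::euclidean_space \<Rightarrow> complex"
  assumes [measurable]: "f \<in> borel_measurable borel" "g \<in> borel_measurable borel" and ae: "AE x in lborel. f x = g x"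
  shows "momentum f = momentum g"
  unfolding momentum_def by (rule integral_cong_AE) (use ae in auto)

text \<open>With \<open>w\<close> the squared modulus, the component of the momentum along
  \<open>\<beta>\<close> symmetrises to an integral of
  \<open>(\<beta> \<bullet> x) * (w x - w (- x))\<close>. Both factors have the same sign, so a
  vanishing integral forces a vanishing integrand. This avoids computing the mean of a
  Gaussian.\<close>

lemma momentum_quad_exp_0D:
  fixes \<beta> :: "'a::euclidean_space"
  assumes a: "Re a < 0" and i: "integrable lborel (\<lambda>x. (cmod (quad_exp a \<beta> \<gamma> c x))\<^sup>2 *\<^sub>R x)"
    and 0: "momentum (quad_exp a \<beta> \<gamma> c) = 0"
  shows "\<beta> = 0"
proof (rule ccontr)
  assume b: "\<beta> \<noteq> 0"
  define w where "w x = (cmod (quad_exp a \<beta> \<gamma> c x))\<^sup>2" for x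
  have wm[measurable]: "w \<in> borel_measurable borel" unfolding w_def[abs_def] by measurable
  define s where "s x = (\<beta> \<bullet> x) * w x" for x
  have sm[measurable]: "s \<in> borel_measurable borel" unfolding s_def[abs_def] by measurable
  have s: "s x = \<beta> \<bullet> (w x *\<^sub>R x)" for x by (simp add: s_def)
  have si: "integrable lborel s" unfolding s by (rule integrable_inner_right) (use i in \<open>simp add: w_def\<close>)
  have "(LINT x|lborel. s x) = \<beta> \<bullet> momentum (quad_exp a \<beta> \<gamma> c)"
    unfolding s momentum_def w_def by (rule integral_inner_right) (rule i)
  hence Is: "(LINT x|lborel. s x) = 0" using 0 by simp
  have si': "integrable lborel (\<lambda>x. s (0 - x))" using si integrable_lborel_reflect[OF sm, of 0] by blast
  have Is': "(LINT x|lborel. s (0 - x)) = 0" using Is integral_lborel_reflect[OF sm, of 0] by simp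
  have wexp: "w x = exp (2 * (Re a * (norm x)\<^sup>2 + \<beta> \<bullet> x + Re c))" for x
    unfolding w_def norm_quad_exp by (simp only: exp_double)
  have lt: "w (- x) < w x \<longleftrightarrow> \<beta> \<bullet> x > 0" "w x < w (- x) \<longleftrightarrow> \<beta> \<bullet> x < 0" for x
    unfolding wexp by auto
  have e: "s x + s (0 - x) = (\<beta> \<bullet> x) * (w x - w (- x))" for x by (simp add: s_def algebra_simps)
  have pos: "s x + s (0 - x) \<ge> 0" for x
  proof -
    have "(\<beta> \<bullet> x \<ge> 0 \<and> w x - w (- x) \<ge> 0) \<or> (\<beta> \<bullet> x \<le> 0 \<and> w x - w (- x) \<le> 0)"
      using lt[of x] by linarith
    thus ?thesis unfolding e by (auto simp: zero_le_mult_iff)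
  qed
  have "(LINT x|lborel. s x + s (0 - x)) = 0"
    by (subst Bochner_Integration.integral_add[OF si si']) (simp only: Is Is' add_0)
  hence "AE x in lborel. s x + s (0 - x) = 0"
    by (subst (asm) integral_nonneg_eq_0_iff_AE) (use pos si si' in \<open>auto intro: Bochner_Integration.integrable_add\<close>)
  \<comment> \<open>A ball of positive measure inside the half-space
    \<open>\<beta> \<bullet> x > 0\<close>, where the integrand is positive.\<close>
  hence "AE x in lborel. x \<notin> ball \<beta> (norm \<beta>)"
  proof eventually_elim
    case (elim x)
    show ?case
    proof
      assume "x \<in> ball \<beta> (norm \<beta>)"
      hence n: "norm (\<beta> - x) < norm \<beta>" by (simp add: dist_norm)
      have "\<beta> \<bullet> (\<beta> - x) \<le> norm \<beta> * norm (\<beta> - x)" by (rule norm_cauchy_schwarz)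
      also have "\<dots> < norm \<beta> * norm \<beta>" using n b by (intro mult_strict_left_mono) auto
      finally have "\<beta> \<bullet> x > 0" by (simp add: inner_diff_right power2_norm_eq_inner[symmetric] power2_eq_square)
      moreover from this have "w x - w (- x) > 0" using lt(1)[of x] by simp
      ultimately have "(\<beta> \<bullet> x) * (w x - w (- x)) > 0" by (rule mult_pos_pos)
      thus False using elim unfolding e by simp
    qed
  qed
  hence "ball \<beta> (norm \<beta>) \<in> null_sets lborel" by (subst (asm) AE_iff_null_sets[symmetric]) auto
  moreover have "emeasure lborel (ball \<beta> (norm \<beta>)) \<noteq> 0"
    using b by (simp add: emeasure_ball unit_ball_vol_pos[THEN less_imp_neq, symmetric])
  ultimately show False by auto
qed

lemma deficit_0_iff:
  fixes f :: "'a::euclidean_space \<Rightarrow> complex"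
  assumes f: "f \<in> L2" and m: "integrable lborel (\<lambda>x. (norm x)\<^sup>2 * (cmod (f x))\<^sup>2)"
  shows "deficit f = 0 \<longleftrightarrow> total_defect f = 0 \<and> momentum f = 0"
proof -
  have t: "enn2real (total_defect f) = 0 \<longleftrightarrow> total_defect f = 0"
    using interaction_energy_eq(2)[OF f m] by (auto simp: enn2real_eq_0_iff)
  have p: "pi * real DIM('a) / 4 > 0" "pi * unit_ball_vol (real DIM('a)) > 0" by auto
  have "deficit f = 0 \<longleftrightarrow> pi * real DIM('a) / 4 * enn2real (total_defect f) + pi * unit_ball_vol (real DIM('a)) * (norm (momentum f))\<^sup>2 = 0"
    by (simp add: deficit_def)
  also have "\<dots> \<longleftrightarrow> pi * real DIM('a) / 4 * enn2real (total_defect f) = 0 \<and> pi * unit_ball_vol (real DIM('a)) * (norm (momentum f))\<^sup>2 = 0"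
    by (rule add_nonneg_eq_0_iff) (use p in \<open>auto intro!: mult_nonneg_nonneg\<close>)
  also have "\<dots> \<longleftrightarrow> total_defect f = 0 \<and> momentum f = 0"
    using p[THEN less_imp_neq] t by auto
  finally show ?thesis .
qed

lemma quad_exp_gaussian: "Re a < 0 \<Longrightarrow> quad_exp a 0 \<gamma> c \<in> gaussians"
  unfolding gaussians_def quad_exp_def[abs_def] by auto

lemma gaussiansE:
  assumes "G \<in> gaussians" obtains a \<gamma> c where "Re a < 0" "G = quad_exp a 0 \<gamma> c"
  using assms unfolding gaussians_def quad_exp_def[abs_def] by auto

lemma deficit_gaussian:
  fixes \<gamma> :: "'a::euclidean_space"
  assumes "Re a < 0" shows "deficit (quad_exp a 0 \<gamma> c) = 0"
proof -
  have "total_defect (quad_exp a 0 \<gamma> c) = 0" by (rule total_defect_eq_0I) (rule quad_exp_reflection_defect)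
  moreover have "momentum (quad_exp a 0 \<gamma> c) = 0" by (rule momentum_even) (auto simp: quad_exp_even)
  ultimately show ?thesis by (simp add: deficit_def)
qed

lemma schroedinger_solution_fourier:
  assumes "u0 \<in> L2" "schroedinger_solution u0 u"
  obtains f where "L2_fourier u0 f" "\<And>t. L2_fourier (\<lambda>x. u (t, x)) (\<lambda>\<xi>. exp (- \<i> * complex_of_real (t * (norm \<xi>)\<^sup>2)) * f \<xi>)"
  using assms has_fourier_L2_iff unfolding schroedinger_solution_def by metis

text \<open>Vanishing total defect gives a \<open>quad_exp\<close>, and vanishing momentum then
  removes its real linear term. Conversely, a Gaussian has no deficit, and this has to be
  transferred to \<open>f\<close>, which equals it only almost everywhere.\<close>

lemma extremiser_iff:
  fixes f :: "'a::euclidean_space \<Rightarrow> complex"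
  assumes dim: "DIM('a) \<ge> 2" and u0: "u0 \<in> Sobolev 1" and nz: "\<not> (AE x in lborel. u0 x = 0)" and f: "L2_fourier u0 f"
  shows "deficit f = 0 \<longleftrightarrow> (\<exists>G\<in>gaussians. has_fourier u0 G)"
proof (rule iffI)
  note L = L2_fourierD[OF f]
  note m = Hdot_norm_fourier(1)[OF u0 f]
  have fm[measurable]: "f \<in> borel_measurable borel" using L by measurable
  show "\<exists>G\<in>gaussians. has_fourier u0 G" if "deficit f = 0"
  proof -
    from that have d: "total_defect f = 0" "momentum f = 0" using deficit_0_iff[OF L(2) m] by auto
    have "\<not> (AE x in lborel. f x = 0)"
    proof
      assume "AE x in lborel. f x = 0"
      hence "nsq f = nsq (\<lambda>_::'a. 0)" by (intro nsq_cong_AE) auto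
      hence "nsq u0 = 0" using L2_fourier_nsq[OF f] by (simp add: nsq_def[of "\<lambda>_. 0"])
      thus False using nsq_eq_0_AE[OF L(1)] nz by blast
    qed
    from total_defect_0_imp_quad_exp[OF dim L(2) this d(1)]
    obtain a \<beta> \<gamma> c where a: "Re a < 0" and ae: "AE x in lborel. f x = quad_exp a \<beta> \<gamma> c x"
      by blast
    have qL: "quad_exp a \<beta> \<gamma> c \<in> (L2 :: ('a \<Rightarrow> complex) set)" by (rule quad_exp_integrable(2)[OF a])
    have "integrable lborel (\<lambda>x. (norm x)\<^sup>2 * (cmod (quad_exp a \<beta> \<gamma> c x))\<^sup>2)"
    proof (rule integrable_cong_AE_imp[OF m])
      show "AE x in lborel. (norm x)\<^sup>2 * (cmod (f x))\<^sup>2 = (norm x)\<^sup>2 * (cmod (quad_exp a \<beta> \<gamma> c x))\<^sup>2"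
        using ae by eventually_elim simp
    qed measurable
    from pair_moment(1)[OF qL this]
    have i: "integrable lborel (\<lambda>x. (cmod (quad_exp a \<beta> \<gamma> c x))\<^sup>2 *\<^sub>R x)" .
    have "momentum (quad_exp a \<beta> \<gamma> c) = 0" using momentum_cong_AE[OF fm _ ae] d(2) by simp
    from momentum_quad_exp_0D[OF a i this] have b: "\<beta> = 0" .
    have "L2_fourier u0 (quad_exp a 0 \<gamma> c)" by (rule L2_fourier_cong_AE[OF f _ ae[unfolded b]]) simp
    thus ?thesis using has_fourier_L2_iff[OF L(1)] quad_exp_gaussian[OF a] by blast
  qed
  assume "\<exists>G\<in>gaussians. has_fourier u0 G"
  then obtain a and \<gamma> :: 'a and c where a: "Re a < 0" and G: "has_fourier u0 (quad_exp a 0 \<gamma> c)"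
    by (metis gaussiansE)
  have G': "L2_fourier u0 (quad_exp a 0 \<gamma> c)" using G has_fourier_L2_iff[OF L(1)] by blast
  have ae: "AE x in lborel. f x = quad_exp a 0 \<gamma> c x" by (rule L2_fourier_unique[OF f G'])
  \<comment> \<open>The deficit is compared through the energy identity: energy, norm and second
    moment visibly ignore null sets, while the defect evaluates \<open>f\<close> at collided
    points.\<close>
  have E: "interaction_energy (quad_exp a 0 \<gamma> c) = interaction_energy f"
  proof -
    have "interaction (quad_exp a 0 \<gamma> c) t \<xi> = interaction f t \<xi>" for t \<xi>
      unfolding interaction_def
    proof (rule integral_cong_AE)
      have "AE x in lborel. f (\<xi> + x) = quad_exp a 0 \<gamma> c (\<xi> + x)" by (rule AE_lborel_shift[OF ae])
      with ae show "AE x in lborel. exp (- \<i> * complex_of_real (2 * t * (\<xi> \<bullet> x))) * (quad_exp a 0 \<gamma> c (\<xi> + x) * cnj (quad_exp a 0 \<gamma> c x))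
         = exp (- \<i> * complex_of_real (2 * t * (\<xi> \<bullet> x))) * (f (\<xi> + x) * cnj (f x))"
        by eventually_elim simp
    qed measurable
    thus ?thesis by (simp add: interaction_energy_def)
  qed
  note m' = Hdot_norm_fourier(1)[OF u0 G']
  have "nsq f * (LINT x|lborel. (norm x)\<^sup>2 * (cmod (f x))\<^sup>2) = nsq (quad_exp a 0 \<gamma> c) * (LINT x|lborel. (norm x)\<^sup>2 * (cmod (quad_exp a 0 \<gamma> c x))\<^sup>2)"
    unfolding Hdot_norm_fourier(2)[OF u0 f] Hdot_norm_fourier(2)[OF u0 G'] L2_fourier_nsq[OF f] L2_fourier_nsq[OF G'] ..
  with interaction_energy_eq(3)[OF L(2) m] interaction_energy_eq(3)[OF L2_fourierD(2)[OF G'] m'] E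
  have "deficit f = deficit (quad_exp a 0 \<gamma> c)" by simp
  thus "deficit f = 0" using deficit_gaussian[OF a] by simp
qed

text \<open>Supplies one extremiser with positive norms, on which optimality of the constant is
  tested.\<close>

lemma gaussian_solution:
  obtains u0 :: "'a::euclidean_space \<Rightarrow> complex" and u
  where "u0 \<in> Sobolev 1" "schroedinger_solution u0 u" "\<not> (AE x in lborel. u0 x = 0)" "Hdot_norm 1 u0 > 0" "L2_norm u0 > 0"
    "\<exists>G\<in>gaussians. has_fourier u0 G"
proof -
  define f :: "'a \<Rightarrow> complex" where "f = quad_exp (- 1) 0 0 0"
  note q = quad_exp_integrable[of "-1" "0::'a" 0 0, folded f_def, simplified]
  have fm[measurable]: "f \<in> borel_measurable borel" by (simp add: f_def)
  define h where "h t \<xi> = exp (- \<i> * complex_of_real (t * (norm \<xi>)\<^sup>2)) * f \<xi>" for t \<xi>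
  have hm[measurable]: "case_prod h \<in> borel_measurable (borel \<Otimes>\<^sub>M borel)"
    unfolding h_def case_prod_unfold by measurable
  have hm1[measurable]: "h t \<in> borel_measurable borel" for t unfolding h_def by measurable
  have hi: "integrable lborel (h t)" for t
    by (rule Bochner_Integration.integrable_bound[OF q(1)]) (auto simp: h_def norm_mult)
  have hL: "h t \<in> L2" for t by (rule L2_bound[OF q(2)]) (auto simp: h_def norm_mult)
  \<comment> \<open>The evolved Gaussian is integrable at every time, so the inversion integral
    defines \<open>u\<close> at all points and makes it jointly measurable.\<close>
  define u where "u z = fourier_inverse (h (fst z)) (snd z)" for z
  have uF: "L2_fourier (\<lambda>x. u (t, x)) (h t)" for t
    using L2_fourier_inverse[OF hi hL, of t] by (simp add: u_def)
  have um: "u \<in> borel_measurable borel"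
    unfolding u_def[abs_def] fourier_inverse_def fourier_integral_def borel_prod[symmetric] by measurable
  define u0 where "u0 x = u (0, x)" for x
  have h0: "h 0 = f" by (auto simp: h_def)
  have u0F: "L2_fourier u0 f" using uF[of 0] unfolding h0 by (simp add: u0_def[abs_def])
  note L = L2_fourierD[OF u0F]
  have sol: "schroedinger_solution u0 u"
    unfolding schroedinger_solution_def
  proof (intro conjI exI[of _ f] allI)
    show "has_fourier u0 f" using u0F has_fourier_L2_iff[OF L(1)] by blast
    fix t
    show "(\<lambda>x. u (t, x)) \<in> L2" by (rule L2_fourierD(1)[OF uF])
    show "has_fourier (\<lambda>x. u (t, x)) (\<lambda>\<xi>. exp (- \<i> * complex_of_real (t * (norm \<xi>)\<^sup>2)) * f \<xi>)"
      using uF[of t] unfolding has_fourier_L2_iff[OF L2_fourierD(1)[OF uF]] h_def .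
  qed (use um in simp)
  have "L2_fourier (fourier_inverse (\<lambda>x. complex_of_real (norm x) * f x)) (\<lambda>x. complex_of_real (norm x) * f x)"
    by (rule L2_fourier_inverse[OF q(3,4)])
  hence "has_frac_laplacian (1 / 2) u0 (fourier_inverse (\<lambda>x. complex_of_real (norm x) * f x))"
    unfolding has_frac_laplacian_def using u0F L by (auto simp: has_fourier_L2_iff L2_fourierD(1) intro!: exI[of _ f])
  hence S: "u0 \<in> Sobolev 1" using L(1) by (auto simp: Sobolev_def)
  have fnz: "f x \<noteq> 0" for x by (simp add: f_def quad_exp_def)
  have pos: "nsq g > 0" if "g \<in> L2" "\<And>x. x \<noteq> 0 \<Longrightarrow> g x \<noteq> 0" for g :: "'a \<Rightarrow> complex"
  proof (rule ccontr)
    assume "\<not> nsq g > 0"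
    hence "nsq g = 0" using nsq_nonneg[of g] by (simp del: nsq_nonneg)
    from nsq_eq_0_AE[OF that(1) this] AE_lborel_singleton[of 0]
    have "AE x in (lborel::'a measure). x \<notin> UNIV" by eventually_elim (use that(2) in blast)
    hence "(UNIV :: 'a set) \<in> null_sets lborel" by (subst (asm) AE_iff_null_sets[symmetric]) auto
    thus False by (auto simp: null_sets_def)
  qed
  have "nsq f > 0" by (rule pos[OF q(2) fnz])
  hence n: "nsq u0 > 0" unfolding L2_fourier_nsq[OF u0F] using nsq_nonneg[of u0] by (auto simp: zero_less_mult_iff not_less[symmetric] simp del: nsq_nonneg)
  have "nsq (\<lambda>x. complex_of_real (norm x) * f x) > 0" by (rule pos[OF q(4)]) (simp add: fnz)
  hence "(LINT x|lborel. (norm x)\<^sup>2 * (cmod (f x))\<^sup>2) > 0" by (simp add: nsq_def norm_mult power_mult_distrib)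
  hence "(Hdot_norm 1 u0)\<^sup>2 > 0" unfolding Hdot_norm_fourier(2)[OF S u0F] by (simp add: zero_less_mult_iff)
  moreover have "Hdot_norm 1 u0 \<ge> 0" "L2_norm u0 \<ge> 0" by (auto simp: Hdot_norm_def L2_norm_def)
  moreover have "(L2_norm u0)\<^sup>2 > 0" using n unfolding L2_norm_power2 .
  ultimately have H: "Hdot_norm 1 u0 > 0" "L2_norm u0 > 0" by (auto simp: less_le)
  have nz: "\<not> (AE x in lborel. u0 x = 0)"
  proof
    assume "AE x in lborel. u0 x = 0"
    hence "nsq u0 = nsq (\<lambda>_::'a. 0)" using L by (intro nsq_cong_AE) (auto simp: L2_def)
    thus False using n by (simp add: nsq_def[of "\<lambda>_. 0"])
  qed
  have "\<exists>G\<in>gaussians. has_fourier u0 G"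
    unfolding has_fourier_L2_iff[OF L(1)] using u0F quad_exp_gaussian[of "-1" "0::'a" 0] by (auto simp: f_def)
  with S sol nz H show ?thesis by (rule that)
qed

theorem corollary1p2:
  assumes "CARD('n::finite) \<ge> 2"
  shows
    "let d = real CARD('n);
         \<sigma> = (4 - d) / 4;
         K = 2 powr (- d) * pi powr ((2 - d) / 2) / Gamma ((d + 2) / 2);
         density = (\<lambda>(u :: real \<times> (real ^ 'n) \<Rightarrow> complex) z. complex_of_real ((cmod (u z))\<^sup>2));
         lhs = (\<lambda>u :: real \<times> (real ^ 'n) \<Rightarrow> complex. (L2_norm (spatial_frac_laplacian \<sigma> (density u)))\<^sup>2);
         rhs = (\<lambda>u0 :: real ^ 'n \<Rightarrow> complex. (Hdot_norm 1 u0)\<^sup>2 * (L2_norm u0)\<^sup>2)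
     in
       (\<forall>u0 u. u0 \<in> Sobolev 1 \<and> schroedinger_solution u0 u \<longrightarrow>
          (\<exists>G. has_spatial_frac_laplacian \<sigma> (density u) G) \<and> lhs u \<le> K * rhs u0) \<and>
       (\<forall>C::real. (\<forall>u0 u. u0 \<in> Sobolev 1 \<and> schroedinger_solution u0 u \<longrightarrow> lhs u \<le> C * rhs u0) \<longrightarrow> K \<le> C) \<and>
       (\<forall>u0 u. u0 \<in> Sobolev 1 \<and> \<not> (AE x in lborel. u0 x = 0) \<and> schroedinger_solution u0 u \<longrightarrow>
          (lhs u = K * rhs u0 \<longleftrightarrow> (\<exists>G\<in>gaussians. has_fourier u0 G)))"
proof -
  define \<sigma> where "\<sigma> = (4 - real CARD('n)) / 4"
  define K where "K = 2 powr (- real CARD('n)) * pi powr ((2 - real CARD('n)) / 2) / Gamma ((real CARD('n) + 2) / 2)"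
  define density where "density = (\<lambda>(u :: real \<times> (real ^ 'n) \<Rightarrow> complex) z. complex_of_real ((cmod (u z))\<^sup>2))"
  define lhs where "lhs = (\<lambda>u :: real \<times> (real ^ 'n) \<Rightarrow> complex. (L2_norm (spatial_frac_laplacian \<sigma> (density u)))\<^sup>2)"
  define rhs where "rhs = (\<lambda>u0 :: real ^ 'n \<Rightarrow> complex. (Hdot_norm 1 u0)\<^sup>2 * (L2_norm u0)\<^sup>2)"
  have dim: "DIM(real ^ 'n) = CARD('n)" by simp
  have dim2: "DIM(real ^ 'n) \<ge> 2" using assms by simp
  have K: "K = sharp_const DIM(real ^ 'n)" unfolding K_def sharp_const_def dim ..
  \<comment> \<open>All three claims follow from this equality: the deficit is nonnegative, vanishes
    for Gaussian data, and vanishes only for them.\<close>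
  have main: "\<exists>f. L2_fourier u0 f \<and> (\<exists>G. has_spatial_frac_laplacian \<sigma> (density u) G) \<and> lhs u = K * rhs u0 - deficit f"
    if u0: "u0 \<in> Sobolev 1" and u: "schroedinger_solution u0 u" for u0 u
  proof -
    have "u0 \<in> L2" using u0 by (simp add: Sobolev_def)
    then obtain f where f: "L2_fourier u0 f"
      and uf: "\<And>t. L2_fourier (\<lambda>x. u (t, x)) (\<lambda>\<xi>. exp (- \<i> * complex_of_real (t * (norm \<xi>)\<^sup>2)) * f \<xi>)"
      using u by (rule schroedinger_solution_fourier) blast
    show ?thesis
      using sharp_identity[OF u0 f uf] f unfolding lhs_def rhs_def density_def \<sigma>_def K dim by blast
  qed
  have 1: "(\<exists>G. has_spatial_frac_laplacian \<sigma> (density u) G) \<and> lhs u \<le> K * rhs u0"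
    if u0: "u0 \<in> Sobolev 1" and u: "schroedinger_solution u0 u" for u0 u
  proof -
    obtain f where "L2_fourier u0 f" "\<exists>G. has_spatial_frac_laplacian \<sigma> (density u) G" "lhs u = K * rhs u0 - deficit f"
      using main[OF u0 u] by blast
    thus ?thesis using deficit_nonneg[of f] by simp
  qed
  have 3: "lhs u = K * rhs u0 \<longleftrightarrow> (\<exists>G\<in>gaussians. has_fourier u0 G)"
    if u0: "u0 \<in> Sobolev 1" and nz: "\<not> (AE x in lborel. u0 x = 0)" and u: "schroedinger_solution u0 u" for u0 u
  proof -
    obtain f where "L2_fourier u0 f" "lhs u = K * rhs u0 - deficit f" using main[OF u0 u] by blast
    thus ?thesis using extremiser_iff[OF dim2 u0 nz] by simp
  qed
  \<comment> \<open>For the Gaussian solution equality holds with constant \<open>K\<close>, and the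
    product of norms is positive, so it can be cancelled.\<close>
  have 2: "K \<le> C" if C: "\<forall>u0 u. u0 \<in> Sobolev 1 \<and> schroedinger_solution u0 u \<longrightarrow> lhs u \<le> C * rhs u0" for C
  proof -
    obtain u0 :: "real ^ 'n \<Rightarrow> complex" and u where u: "u0 \<in> Sobolev 1" "schroedinger_solution u0 u"
      "\<not> (AE x in lborel. u0 x = 0)" "Hdot_norm 1 u0 > 0" "L2_norm u0 > 0" "\<exists>G\<in>gaussians. has_fourier u0 G"
      by (rule gaussian_solution)
    have "K * rhs u0 \<le> C * rhs u0" using 3[OF u(1,3,2)] u(6) C u(1,2) by metis
    moreover have "rhs u0 > 0" using u(4,5) by (simp add: rhs_def)
    ultimately show ?thesis by simp
  qed
  show ?thesis
    using 1 2 3 unfolding Let_def lhs_def rhs_def density_def \<sigma>_def K_def by blast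
qed

end
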